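(* Consider $n$ nodes communicating in the $\mathsf{GOSSIP}(1/n^c)$ model for a sufficiently large constant $c$, each node $v$ holding a value $\mathrm{val}(v)\in\{1,\dots,N\}\cup\{\mathrm{NULL}\}$ with $N=\mathrm{poly}(n)$. Let $p\ge 2$ be fixed and let $k$ be an integer with $2\le k\le p$. If $F_0=O(n^{1/(k-1)})$, then there is an algorithm that approximates $F_p$ up to a $1\pm\epsilon$ factor in $O(\epsilon^{-2}n^{1-k/p}\log^2 n)$ rounds with high probability.
   Context: $f_i=|\{v:\mathrm{val}(v)=i\}|$, $F_p=\sum_{i=1}^N f_i^p$ for $p>0$, and $F_0=|\{i: f_i>0\}|$ (number of distinct values). $\mathsf{GOSSIP}(\lambda)$ model with $n$ nodes: in each synchronous round each node $u$ samples a node $t(u)$ such that for any node $v$ and any set of nodes $Z$ with $u\notin Z$, $\Pr\big(t(u)=v\mid\bigwedge_{z\in Z}t(z)\big)\in[\tfrac{1-\lambda}{n},\tfrac{1+\lambda}{n}]$ (conditioning on any assignment of $t(z)$, $z\in Z$); then $u$ may PUSH an $O(\log n)$-bit message to $t(u)$ or PULL one from $t(u)$, and compute locally. An approximation up to a $1\pm\epsilon$ factor is a value $\hat F$ with $(1-\epsilon)F_p\le\hat F\le(1+\epsilon)F_p$. With high probability means with probability $1-1/\mathrm{poly}(n)$. *)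

theory Defs
  imports "HOL-Probability.Probability" "HOL-Probability.Product_PMF" "HOL-Library.Multiset"
begin

text \<open>Nodes are \<open>{..<n}\<close>; an input is \<open>val :: nat \<Rightarrow> nat option\<close>, with \<open>None\<close> for NULL.\<close>

definition valid_input :: "nat \<Rightarrow> nat \<Rightarrow> (nat \<Rightarrow> nat option) \<Rightarrow> bool" where
  "valid_input n N val \<longleftrightarrow> (\<forall>v<n. val v = None \<or> (\<exists>i\<in>{1..N}. val v = Some i))"

definition freq :: "nat \<Rightarrow> (nat \<Rightarrow> nat option) \<Rightarrow> nat \<Rightarrow> nat" where
  "freq n val i = card {v. v < n \<and> val v = Some i}"

definition freq_moment :: "nat \<Rightarrow> nat \<Rightarrow> (nat \<Rightarrow> nat option) \<Rightarrow> real \<Rightarrow> real" where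
  "freq_moment n N val p = (\<Sum>i=1..N. real (freq n val i) powr p)"

definition num_distinct :: "nat \<Rightarrow> nat \<Rightarrow> (nat \<Rightarrow> nat option) \<Rightarrow> nat" where
  "num_distinct n N val = card {i\<in>{1..N}. freq n val i > 0}"

definition approximates :: "real \<Rightarrow> real \<Rightarrow> real \<Rightarrow> bool" where
  "approximates \<epsilon> x F \<longleftrightarrow> (1 - \<epsilon>) * F \<le> x \<and> x \<le> (1 + \<epsilon>) * F"

type_synonym message = "bool list"

datatype action = Push message | Pull | Idle

text \<open>
  An algorithm with local states in \<open>'s\<close>. Nodes are anonymous: the initial state depends
  only on the input value (and private coins), and a node learns nothing about the identity of
  the nodes it communicates with. In each round, the current state determines the action of the
  node and the message it returns to every node pulling from it; the next state is chosen, using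
  fresh private coins, from the current state, the multiset of messages pushed to the node, and
  the message it pulled, if any. Local computation is not bounded.
\<close>

record 's gossip_alg =
  init :: "nat option \<Rightarrow> 's pmf"
  act :: "'s \<Rightarrow> action"
  reply :: "'s \<Rightarrow> message"
  update :: "'s \<Rightarrow> message multiset \<Rightarrow> message option \<Rightarrow> 's pmf"
  result :: "'s \<Rightarrow> real"

definition message_bits_le :: "'s gossip_alg \<Rightarrow> real \<Rightarrow> bool" where
  "message_bits_le alg b \<longleftrightarrow>
     (\<forall>s m. act alg s = Push m \<longrightarrow> real (length m) \<le> b) \<and>
     (\<forall>s. real (length (reply alg s)) \<le> b)"

text \<open>The admissible joint distributions of \<open>t\<close> in a single round of \<open>GOSSIP(l)\<close>.\<close>

definition gossip_law :: "nat \<Rightarrow> real \<Rightarrow> (nat \<Rightarrow> nat) pmf \<Rightarrow> bool" where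
  "gossip_law n l D \<longleftrightarrow>
     set_pmf D \<subseteq> {..<n} \<rightarrow>\<^sub>E {..<n} \<and>
     (\<forall>u<n. \<forall>v<n. \<forall>Z\<subseteq>{..<n}. \<forall>s. u \<notin> Z \<longrightarrow>
        measure_pmf.prob D {t. \<forall>z\<in>Z. t z = s z} > 0 \<longrightarrow>
        \<P>(t in measure_pmf D. t u = v \<bar> \<forall>z\<in>Z. t z = s z)
          \<in> {(1 - l) / real n .. (1 + l) / real n})"

text \<open>
  The execution so far is a pair of the list of past rounds (most recent first; for each round the
  configuration at its beginning and the sampled \<open>t\<close>) and the current configuration. The law
  of \<open>t\<close> in the next round may depend on it in an arbitrary way.
\<close>

type_synonym 's execution = "((nat \<Rightarrow> 's) \<times> (nat \<Rightarrow> nat)) list \<times> (nat \<Rightarrow> 's)"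

definition gossip_sampler :: "nat \<Rightarrow> real \<Rightarrow> ('s execution \<Rightarrow> (nat \<Rightarrow> nat) pmf) \<Rightarrow> bool" where
  "gossip_sampler n l S \<longleftrightarrow> (\<forall>e. gossip_law n l (S e))"

definition pushed_to ::
  "nat \<Rightarrow> 's gossip_alg \<Rightarrow> (nat \<Rightarrow> nat) \<Rightarrow> (nat \<Rightarrow> 's) \<Rightarrow> nat \<Rightarrow> message multiset" where
  "pushed_to n alg t \<sigma> u =
     (\<Sum>w<n. if t w = u then (case act alg (\<sigma> w) of Push m \<Rightarrow> {#m#} | _ \<Rightarrow> {#}) else {#})"

definition pulled_by ::
  "'s gossip_alg \<Rightarrow> (nat \<Rightarrow> nat) \<Rightarrow> (nat \<Rightarrow> 's) \<Rightarrow> nat \<Rightarrow> message option" where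
  "pulled_by alg t \<sigma> u =
     (case act alg (\<sigma> u) of Pull \<Rightarrow> Some (reply alg (\<sigma> (t u))) | _ \<Rightarrow> None)"

definition gossip_step ::
  "nat \<Rightarrow> 's gossip_alg \<Rightarrow> (nat \<Rightarrow> nat) \<Rightarrow> (nat \<Rightarrow> 's) \<Rightarrow> (nat \<Rightarrow> 's) pmf" where
  "gossip_step n alg t \<sigma> =
     Pi_pmf {..<n} undefined
       (\<lambda>u. update alg (\<sigma> u) (pushed_to n alg t \<sigma> u) (pulled_by alg t \<sigma> u))"

primrec gossip_run ::
  "nat \<Rightarrow> 's gossip_alg \<Rightarrow> ('s execution \<Rightarrow> (nat \<Rightarrow> nat) pmf) \<Rightarrow> (nat \<Rightarrow> nat option) \<Rightarrow> nat
     \<Rightarrow> 's execution pmf" where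
  "gossip_run n alg S val 0 =
     map_pmf (\<lambda>\<sigma>. ([], \<sigma>)) (Pi_pmf {..<n} undefined (\<lambda>u. init alg (val u)))"
| "gossip_run n alg S val (Suc r) =
     bind_pmf (gossip_run n alg S val r) (\<lambda>(h, \<sigma>).
     bind_pmf (S (h, \<sigma>)) (\<lambda>t.
     map_pmf (\<lambda>\<sigma>'. ((\<sigma>, t) # h, \<sigma>')) (gossip_step n alg t \<sigma>)))"

end

theory Submission
  imports Defs
begin

text \<open>
  Every law of the targets admitted in one round of \<open>GOSSIP(\<lambda>)\<close> is dominated pointwise by
  \<open>(1 + \<lambda>)\<^sup>n\<close> times the uniform law. Hence \<open>T\<close> rounds cost at most a factor
  \<open>(1 + \<lambda>)\<^bsup>nT\<^esup> \<le> 2\<close> in the failure probability, and one may assume that all targets are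
  independent and uniform.

  Two primitives take \<open>O(log n)\<close> rounds. A maximum is broadcast by pulling: if \<open>I\<close> is the set of
  informed nodes, then \<open>n / |I| - 1\<close> shrinks by a factor \<open>2/3\<close> in expectation in every round.
  A sum is computed exactly by push-sum on dyadic numbers: the squared deviation of the masses from their
  multiples of the weights halves in expectation, and the node of largest weight broadcasts its
  ratio, which determines the integer sum by rounding.

  For the estimator, let \<open>m\<close> be the number of non-NULL nodes. Every value is first replicated
  by repeated doubling until each has \<open>r\<close> copies with \<open>n/2 < r m \<le> n\<close>; without this step NULL nodes would make
  collisions too rare. In one sample, all copies are thrown to uniformly random nodes in \<open>k\<close>
  independent blocks. Let \<open>Y\<close> be the number of \<open>k\<close>-tuples of equal values, one from each block,
  that meet in a node, and let \<open>i\<close> be the value of a uniformly chosen such tuple. Then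
  \<open>n\<^bsup>k-1\<^esup> / r\<^sup>k * Y * f\<^sub>i\<^bsup>p-k\<^esup>\<close> has mean \<open>F\<^sub>p\<close> and, because \<open>F\<^sub>0 = O(n\<^bsup>1/(k-1)\<^esup>)\<close> makes
  the mean of \<open>Y\<close> bounded below, second moment
  \<open>O(F\<^sub>k F\<^bsub>2p-k\<^esub>) = O(n\<^bsup>1-k/p\<^esup> F\<^sub>p\<^sup>2)\<close>. The median of \<open>O(log n)\<close> means
  of \<open>O(\<epsilon>\<^sup>-\<^sup>2 n\<^bsup>1-k/p\<^esup>)\<close> samples is the result. If this takes more than \<open>O(n log n)\<close> rounds,
  the distinct values are instead enumerated in descending order, and their frequencies summed exactly.
\<close>

section \<open>Comparison with uniform targets\<close>

text \<open>A node sees which values meet in it but not how frequent they are, and only one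
  frequency can be looked up in \<open>O(log n)\<close> rounds. This is why a sample draws a single
  value: given the throws, let \<open>y_i\<close> be the number of tuples of value \<open>i\<close>;
  drawing \<open>i\<close> with probability \<open>y_i / Y\<close> makes
  \<open>Y * f_i^(p-k)\<close> an unbiased estimate of the sum of all
  \<open>y_i * f_i^(p-k)\<close>.

  In the second moment, unrelated pairs of tuples give \<open>F_k * F_(2p-k)\<close>. Pairs of the
  same value in the same node add a term with only one scaling factor,
  \<open>2^k * n^(k-1) / r^k * F_(2p-k)\<close>. It is absorbed because \<open>F_k\<close> is at
  least of order \<open>m^k / F_0^(k-1)\<close> and \<open>r * m > n/2\<close>; the hypothesis on
  \<open>F_0\<close> enters only here.

  The exponent \<open>c\<close> is chosen before \<open>\<epsilon>\<close>, so the comparison with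
  uniform targets needs a number of rounds that is polynomial in \<open>n\<close> for every
  \<open>\<epsilon>\<close>. The same bound limits the errors that accumulate over the samples. This
  forces the second, exact algorithm: at most \<open>n\<close> values occur, and treating one of
  them is cheaper than taking one sample.\<close>

abbreviation (input) Pr :: "'a pmf \<Rightarrow> 'a set \<Rightarrow> real" where
  "Pr M \<equiv> measure_pmf.prob M"

abbreviation (input) expect :: "'a pmf \<Rightarrow> ('a \<Rightarrow> 'b::{banach, second_countable_topology}) \<Rightarrow> 'b" where
  "expect M \<equiv> measure_pmf.expectation M"

definition uniform_targets :: "nat \<Rightarrow> (nat \<Rightarrow> nat) pmf" where
  "uniform_targets n = Pi_pmf {..<n} undefined (\<lambda>_. pmf_of_set {..<n})"

text \<open>The chain rule: each further fixed target contributes a factor at most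
  \<open>(1 + l) / real n\<close> by the conditional bound. If the conditioning event is null, so is
  the smaller one.\<close>

lemma gossip_law_prob_le:
  assumes D: "gossip_law n l D" and l: "0 \<le> l" and Z: "Z \<subseteq> {..<n}" and s: "\<And>z. z \<in> Z \<Longrightarrow> s z < n"
  shows "Pr D {t. \<forall>z\<in>Z. t z = s z} \<le> ((1 + l) / real n) ^ card Z"
proof -
  have "finite Z" using Z finite_subset by blast
  then show ?thesis using Z s
  proof (induction Z rule: finite_induct)
    case empty
    then show ?case by simp
  next
    case (insert u Z)
    let ?Q = "{t. \<forall>z\<in>Z. t z = s z}"
    let ?R = "{t. \<forall>z\<in>insert u Z. t z = s z}"
    have sub: "?R \<subseteq> ?Q" by auto
    have IH: "Pr D ?Q \<le> ((1 + l) / real n) ^ card Z"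
      using insert by auto
    show ?case
    proof (cases "Pr D ?Q = 0")
      case True
      have "Pr D ?R \<le> Pr D ?Q"
        by (rule measure_pmf.finite_measure_mono[OF sub]) simp
      also have "\<dots> = 0" by (rule True)
      also have "0 \<le> ((1 + l) / real n) ^ card (insert u Z)" using l by simp
      finally show ?thesis .
    next
      case False
      then have pos: "Pr D ?Q > 0" using measure_nonneg[of D ?Q] by linarith
      have "\<P>(t in measure_pmf D. t u = s u \<bar> \<forall>z\<in>Z. t z = s z) \<le> (1 + l) / real n"
        using D insert.prems insert.hyps pos unfolding gossip_law_def by auto
      then have "Pr D {t. t u = s u \<and> (\<forall>z\<in>Z. t z = s z)} / Pr D ?Q \<le> (1 + l) / real n"
        by (simp add: cond_prob_def)
      then have "Pr D ?R / Pr D ?Q \<le> (1 + l) / real n" by simp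
      then have "Pr D ?R \<le> (1 + l) / real n * Pr D ?Q"
        using pos by (simp only: pos_divide_le_eq)
      also have "\<dots> \<le> (1 + l) / real n * ((1 + l) / real n) ^ card Z"
        using IH l by (intro mult_left_mono) auto
      finally show ?thesis using insert.hyps by simp
    qed
  qed
qed

lemma pmf_gossip_law_le:
  assumes D: "gossip_law n l D" and l: "0 \<le> l" and n: "0 < n"
  shows "pmf D t \<le> (1 + l) ^ n * pmf (uniform_targets n) t"
proof (cases "t \<in> {..<n} \<rightarrow>\<^sub>E {..<n}")
  case True
  have "pmf D t = Pr D {t}" by (simp add: measure_pmf_single)
  also have "\<dots> \<le> Pr D {t'. \<forall>z\<in>{..<n}. t' z = t z}"
    by (intro measure_pmf.finite_measure_mono) auto
  also have "\<dots> \<le> ((1 + l) / real n) ^ card {..<n}"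
    using gossip_law_prob_le[OF D l, of "{..<n}" t] True by auto
  also have "\<dots> = (1 + l) ^ n * (1 / real n) ^ n"
    by (simp add: power_divide)
  also have "(1 / real n) ^ n = pmf (uniform_targets n) t"
  proof -
    have "pmf (uniform_targets n) t = (\<Prod>v<n. pmf (pmf_of_set {..<n}) (t v))"
      unfolding uniform_targets_def using True by (intro pmf_Pi') (auto simp: PiE_def extensional_def)
    also have "\<dots> = (\<Prod>v<n. 1 / real n)"
    proof (intro prod.cong refl)
      fix v assume "v \<in> {..<n}"
      then have v: "t v \<in> {..<n}" using True by blast
      then have ne: "{..<n} \<noteq> {}" by blast
      show "pmf (pmf_of_set {..<n}) (t v) = 1 / real n"
        unfolding pmf_of_set[OF ne finite_lessThan] by (simp only: indicator_simps(1)[OF v] card_lessThan)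
    qed
    finally show ?thesis by simp
  qed
  finally show ?thesis .
next
  case False
  then have "pmf D t = 0" using D unfolding gossip_law_def by (auto simp: set_pmf_iff)
  then show ?thesis using l by simp
qed

lemma nn_integral_gossip_law_le:
  assumes D: "gossip_law n l D" and l: "0 \<le> l" and n: "0 < n"
  shows "(\<integral>\<^sup>+t. g t \<partial>measure_pmf D) \<le> ennreal ((1 + l) ^ n) * (\<integral>\<^sup>+t. g t \<partial>measure_pmf (uniform_targets n))"
proof -
  have "(\<integral>\<^sup>+t. g t \<partial>measure_pmf D) = (\<integral>\<^sup>+t. ennreal (pmf D t) * g t \<partial>count_space UNIV)"
    by (simp add: nn_integral_measure_pmf)
  also have "\<dots> \<le> (\<integral>\<^sup>+t. ennreal ((1 + l) ^ n) * (ennreal (pmf (uniform_targets n) t) * g t) \<partial>count_space UNIV)"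
  proof (intro nn_integral_mono)
    fix t
    have "ennreal (pmf D t) \<le> ennreal ((1 + l) ^ n) * ennreal (pmf (uniform_targets n) t)"
      using pmf_gossip_law_le[OF D l n, of t] l by (simp flip: ennreal_mult' add: ennreal_leI)
    then show "ennreal (pmf D t) * g t \<le> ennreal ((1 + l) ^ n) * (ennreal (pmf (uniform_targets n) t) * g t)"
      by (metis mult.assoc mult_right_mono zero_le)
  qed
  also have "\<dots> = ennreal ((1 + l) ^ n) * (\<integral>\<^sup>+t. ennreal (pmf (uniform_targets n) t) * g t \<partial>count_space UNIV)"
    by (simp add: nn_integral_cmult)
  finally show ?thesis by (simp add: nn_integral_measure_pmf)
qed

text \<open>The sampler may react to the whole execution, so the last round is integrated out first:
  its inner integral over uniform targets is a new function of the execution, to which the induction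
  hypothesis, quantified over all \<open>g\<close>, applies.\<close>

lemma gossip_run_le_uniform:
  assumes S: "gossip_sampler n l S" and l: "0 \<le> l" and n: "0 < n"
  shows "(\<integral>\<^sup>+e. g e \<partial>gossip_run n alg S val r)
     \<le> ennreal ((1 + l) ^ (n * r)) * (\<integral>\<^sup>+e. g e \<partial>gossip_run n alg (\<lambda>_. uniform_targets n) val r)"
proof (induction r arbitrary: g)
  case 0
  then show ?case by simp
next
  case (Suc r)
  let ?G = "\<lambda>(h, \<sigma>) t. \<integral>\<^sup>+\<sigma>'. g ((\<sigma>, t) # h, \<sigma>') \<partial>gossip_step n alg t \<sigma>"
  let ?U = "uniform_targets n"
  have "(\<integral>\<^sup>+e. g e \<partial>gossip_run n alg S val (Suc r))
      = (\<integral>\<^sup>+e. (\<integral>\<^sup>+t. ?G e t \<partial>S e) \<partial>gossip_run n alg S val r)"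
    by (simp add: case_prod_beta)
  also have "\<dots> \<le> (\<integral>\<^sup>+e. ennreal ((1 + l) ^ n) * (\<integral>\<^sup>+t. ?G e t \<partial>?U) \<partial>gossip_run n alg S val r)"
    using S unfolding gossip_sampler_def
    by (intro nn_integral_mono nn_integral_gossip_law_le l n) auto
  also have "\<dots> = ennreal ((1 + l) ^ n) * (\<integral>\<^sup>+e. (\<integral>\<^sup>+t. ?G e t \<partial>?U) \<partial>gossip_run n alg S val r)"
    by (simp add: nn_integral_cmult)
  also have "\<dots> \<le> ennreal ((1 + l) ^ n) * (ennreal ((1 + l) ^ (n * r)) *
      (\<integral>\<^sup>+e. (\<integral>\<^sup>+t. ?G e t \<partial>?U) \<partial>gossip_run n alg (\<lambda>_. ?U) val r))"
    by (intro mult_left_mono Suc.IH) auto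
  also have "\<dots> = ennreal ((1 + l) ^ (n * Suc r)) * (\<integral>\<^sup>+e. g e \<partial>gossip_run n alg (\<lambda>_. ?U) val (Suc r))"
    using l by (simp add: case_prod_beta mult.assoc power_add flip: ennreal_mult')
       (simp add: ennreal_mult' mult.assoc)
  finally show ?case .
qed

section \<open>Gossip programs\<close>

text \<open>All nodes perform the same rule in the same round, and messages are natural numbers.
  Only local rules toss coins, so a push or pull round is a function of the targets.\<close>

datatype 's rule =
    Push_rule "'s \<Rightarrow> nat option" "'s \<Rightarrow> nat multiset \<Rightarrow> 's"
  | Pull_rule "'s \<Rightarrow> nat" "'s \<Rightarrow> nat \<Rightarrow> 's"
  | Local_rule "'s \<Rightarrow> 's pmf"

definition opt_mset :: "'a option \<Rightarrow> 'a multiset" where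
  "opt_mset x = (case x of Some y \<Rightarrow> {#y#} | None \<Rightarrow> {#})"

text \<open>Outside \<open>{..<n}\<close> the value is the default of the \<open>Pi_pmf\<close> in
  \<open>gossip_step\<close>, so that configurations can be compared by plain equality.\<close>

definition config :: "nat \<Rightarrow> (nat \<Rightarrow> 's) \<Rightarrow> nat \<Rightarrow> 's" where
  "config n f = (\<lambda>v. if v < n then f v else undefined)"

lemma config_apply [simp]: "v < n \<Longrightarrow> config n f v = f v"
  by (simp add: config_def)

text \<open>Messages are cut to \<open>b\<close> bits here, which makes the message bound of the
  compiled algorithm unconditional; each use has to show that nothing is lost.\<close>

primrec step :: "nat \<Rightarrow> nat \<Rightarrow> 's rule \<Rightarrow> (nat \<Rightarrow> 's) \<Rightarrow> (nat \<Rightarrow> 's) pmf" where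
  "step n b (Push_rule m u) \<sigma> = map_pmf (\<lambda>t. config n (\<lambda>v. u (\<sigma> v)
     (\<Sum>w<n. if t w = v then image_mset (take_bit b) (opt_mset (m (\<sigma> w))) else {#}))) (uniform_targets n)"
| "step n b (Pull_rule m u) \<sigma> =
     map_pmf (\<lambda>t. config n (\<lambda>v. u (\<sigma> v) (take_bit b (m (\<sigma> (t v)))))) (uniform_targets n)"
| "step n b (Local_rule f) \<sigma> = Pi_pmf {..<n} undefined (\<lambda>v. f (\<sigma> v))"

primrec exec :: "nat \<Rightarrow> nat \<Rightarrow> 's rule list \<Rightarrow> (nat \<Rightarrow> 's) \<Rightarrow> (nat \<Rightarrow> 's) pmf" where
  "exec n b [] \<sigma> = return_pmf \<sigma>"
| "exec n b (r # rs) \<sigma> = bind_pmf (step n b r \<sigma>) (exec n b rs)"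

lemma exec_append: "exec n b (xs @ ys) \<sigma> = bind_pmf (exec n b xs \<sigma>) (exec n b ys)"
  by (induction xs arbitrary: \<sigma>) (auto simp: bind_return_pmf bind_assoc_pmf intro!: bind_pmf_cong)

definition bits :: "nat \<Rightarrow> nat \<Rightarrow> bool list" where
  "bits b m = map (bit m) [0..<b]"

definition unbits :: "bool list \<Rightarrow> nat" where
  "unbits = horner_sum of_bool 2"

lemma unbits_bits: "unbits (bits b m) = take_bit b m"
  by (simp add: unbits_def bits_def horner_sum_bit_eq_take_bit)

text \<open>A local state of the compiled algorithm encodes the number of the current round together with
  the state of the program.\<close>

definition compile ::
    "nat \<Rightarrow> ('s \<Rightarrow> nat) \<Rightarrow> (nat option \<Rightarrow> 's) \<Rightarrow> 's rule list \<Rightarrow> ('s \<Rightarrow> real) \<Rightarrow> nat gossip_alg" where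
  "compile b enc ini P res = (let R = (\<lambda>x. fst (prod_decode x)); D = (\<lambda>x. inv enc (snd (prod_decode x)));
       E = (\<lambda>r s. prod_encode (r, enc s)) in
   \<lparr> init = (\<lambda>v. return_pmf (E 0 (ini v))),
     act = (\<lambda>x. if R x < length P then (case P ! R x of
         Push_rule m u \<Rightarrow> (case m (D x) of Some y \<Rightarrow> Push (bits b y) | None \<Rightarrow> Idle)
       | Pull_rule m u \<Rightarrow> Pull | Local_rule f \<Rightarrow> Idle) else Idle),
     reply = (\<lambda>x. if R x < length P then (case P ! R x of Pull_rule m u \<Rightarrow> bits b (m (D x)) | _ \<Rightarrow> []) else []),
     update = (\<lambda>x M p. if R x < length P then map_pmf (E (Suc (R x))) (case P ! R x of
         Push_rule m u \<Rightarrow> return_pmf (u (D x) (image_mset unbits M))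
       | Pull_rule m u \<Rightarrow> return_pmf (u (D x) (unbits (the p)))
       | Local_rule f \<Rightarrow> f (D x)) else return_pmf x),
     result = (\<lambda>x. res (D x)) \<rparr>)"

lemma message_bits_compile:
  assumes "real b \<le> B"
  shows "message_bits_le (compile b enc ini P res) B"
  using assms
  unfolding message_bits_le_def
proof (intro conjI allI impI)
  have B: "0 \<le> B" using assms by linarith
  show "real (length m) \<le> B" if "act (compile b enc ini P res) s = Push m" for s m
    using that assms by (auto simp: compile_def Let_def bits_def split: rule.splits option.splits if_splits)
  show "real (length (reply (compile b enc ini P res) s)) \<le> B" for s
    using assms B by (simp add: compile_def Let_def bits_def split: rule.split)
qed

definition encode_config :: "nat \<Rightarrow> ('s \<Rightarrow> nat) \<Rightarrow> nat \<Rightarrow> (nat \<Rightarrow> 's) \<Rightarrow> nat \<Rightarrow> nat" where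
  "encode_config n enc r \<sigma> = (\<lambda>v. if v < n then prod_encode (r, enc (\<sigma> v)) else undefined)"

lemma map_encode_Pi_pmf:
  "map_pmf (encode_config n enc r) (Pi_pmf {..<n} d p)
     = Pi_pmf {..<n} undefined (\<lambda>v. map_pmf (\<lambda>s. prod_encode (r, enc s)) (p v))"
proof -
  have "map_pmf (encode_config n enc r) (Pi_pmf {..<n} d p) =
     map_pmf (\<lambda>f v. if v \<in> {..<n} then f v else undefined)
       (map_pmf (\<lambda>g. (\<lambda>s. prod_encode (r, enc s)) \<circ> g) (Pi_pmf {..<n} d p))"
    by (simp add: pmf.map_comp encode_config_def[abs_def] comp_def)
  also have "map_pmf (\<lambda>g. (\<lambda>s. prod_encode (r, enc s)) \<circ> g) (Pi_pmf {..<n} d p)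
     = Pi_pmf {..<n} (prod_encode (r, enc d)) (\<lambda>v. map_pmf (\<lambda>s. prod_encode (r, enc s)) (p v))"
    by (subst Pi_pmf_map[of _ _ d]) auto
  also have "map_pmf (\<lambda>f v. if v \<in> {..<n} then f v else undefined) \<dots> =
     Pi_pmf {..<n} undefined (\<lambda>v. map_pmf (\<lambda>s. prod_encode (r, enc s)) (p v))"
    by (rule Pi_pmf_default_swap) simp
  finally show ?thesis .
qed

lemma set_uniform_targets:
  assumes "0 < n" "t \<in> set_pmf (uniform_targets n)" "v < n"
  shows "t v < n"
proof -
  have "{..<n} \<noteq> {}" using assms(1) by (metis lessThan_iff empty_iff)
  then have "set_pmf (pmf_of_set {..<n}) = {..<n}" by (rule set_pmf_of_set) simp
  then have "t \<in> PiE_dflt {..<n} undefined (\<lambda>_. {..<n})"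
    using assms(2) unfolding uniform_targets_def by (simp add: set_Pi_pmf comp_def)
  then show ?thesis using assms(3) unfolding PiE_dflt_def by blast
qed

lemma config_eq_Pi_return:
  "return_pmf (config n f) = Pi_pmf {..<n} undefined (\<lambda>v. return_pmf (f v))"
  by (subst Pi_pmf_return_pmf) (auto simp: config_def fun_eq_iff)

lemma image_mset_sum_set: "image_mset f (sum g A) = (\<Sum>x\<in>A. image_mset f (g x))"
  by (induction A rule: infinite_finite_induct) auto

text \<open>The targets are averaged on the left because \<open>step\<close> draws them itself. A
  local rule ignores them but still takes a round.\<close>

lemma gossip_step_compile:
  assumes n: "0 < n" and inj: "inj enc" and r: "r < length P"
  shows "bind_pmf (uniform_targets n) (\<lambda>t. gossip_step n (compile b enc ini P res) t (encode_config n enc r \<sigma>))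
     = map_pmf (encode_config n enc (Suc r)) (step n b (P ! r) \<sigma>)"
proof (cases "P ! r")
  case (Push_rule m u)
  let ?alg = "compile b enc ini P res" and ?e = "encode_config n enc r \<sigma>"
  have "gossip_step n ?alg t ?e = return_pmf (encode_config n enc (Suc r) (config n (\<lambda>v. u (\<sigma> v)
     (\<Sum>w<n. if t w = v then image_mset (take_bit b) (opt_mset (m (\<sigma> w))) else {#}))))" for t
  proof -
    have pu: "image_mset unbits (pushed_to n ?alg t ?e v)
       = (\<Sum>w<n. if t w = v then image_mset (take_bit b) (opt_mset (m (\<sigma> w))) else {#})" for v
      unfolding pushed_to_def
      by (simp add: image_mset_sum_set, intro sum.cong)
         (auto simp: compile_def Let_def Push_rule r encode_config_def inj opt_mset_def
               unbits_bits split: option.splits)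
    have "gossip_step n ?alg t ?e = Pi_pmf {..<n} undefined (\<lambda>v. return_pmf (prod_encode (Suc r, enc (u (\<sigma> v)
     (\<Sum>w<n. if t w = v then image_mset (take_bit b) (opt_mset (m (\<sigma> w))) else {#})))))"
      unfolding gossip_step_def
      by (intro Pi_pmf_cong) (auto simp: compile_def Let_def Push_rule r encode_config_def inj
          simp flip: pu)
    then show ?thesis
      by (simp add: encode_config_def flip: config_eq_Pi_return) (auto simp: config_def)
  qed
  then show ?thesis by (simp add: Push_rule map_pmf_def bind_assoc_pmf bind_return_pmf)
next
  case (Pull_rule m u)
  let ?alg = "compile b enc ini P res" and ?e = "encode_config n enc r \<sigma>"
  have "gossip_step n ?alg t ?e = return_pmf (encode_config n enc (Suc r)
     (config n (\<lambda>v. u (\<sigma> v) (take_bit b (m (\<sigma> (t v)))))))" if t: "t \<in> set_pmf (uniform_targets n)" for t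
  proof -
    have "gossip_step n ?alg t ?e = Pi_pmf {..<n} undefined (\<lambda>v. return_pmf (prod_encode (Suc r, enc (u (\<sigma> v)
       (take_bit b (m (\<sigma> (t v))))))))"
      unfolding gossip_step_def using set_uniform_targets[OF n t]
      by (intro Pi_pmf_cong) (auto simp: compile_def Let_def Pull_rule r encode_config_def inj
          pulled_by_def unbits_bits)
    then show ?thesis
      by (simp add: encode_config_def flip: config_eq_Pi_return) (auto simp: config_def)
  qed
  then show ?thesis by (simp add: Pull_rule map_pmf_def bind_assoc_pmf bind_return_pmf cong: bind_pmf_cong)
next
  case (Local_rule f)
  let ?alg = "compile b enc ini P res" and ?e = "encode_config n enc r \<sigma>"
  have "gossip_step n ?alg t ?e = Pi_pmf {..<n} undefined (\<lambda>v. map_pmf (\<lambda>s. prod_encode (Suc r, enc s)) (f (\<sigma> v)))" for t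
    unfolding gossip_step_def
    by (intro Pi_pmf_cong) (auto simp: compile_def Let_def Local_rule r encode_config_def inj)
  then show ?thesis by (simp add: Local_rule map_encode_Pi_pmf bind_return_pmf')
qed

text \<open>Uniform targets do not look at the history, so it can be projected away.\<close>

lemma gossip_run_compile:
  assumes n: "0 < n" and inj: "inj enc" and r: "r \<le> length P"
  shows "map_pmf snd (gossip_run n (compile b enc ini P res) (\<lambda>_. uniform_targets n) val r)
     = map_pmf (encode_config n enc r) (exec n b (take r P) (config n (\<lambda>v. ini (val v))))"
  using r
proof (induction r)
  case 0
  have "Pi_pmf {..<n} undefined (\<lambda>u. init (compile b enc ini P res) (val u))
     = return_pmf (encode_config n enc 0 (config n (\<lambda>v. ini (val v))))"
    by (simp add: compile_def Let_def encode_config_def flip: config_eq_Pi_return)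
       (auto simp: config_def)
  then show ?case by (simp add: pmf.map_comp comp_def)
next
  case (Suc r)
  let ?alg = "compile b enc ini P res"
  have "map_pmf snd (gossip_run n ?alg (\<lambda>_. uniform_targets n) val (Suc r))
     = bind_pmf (map_pmf snd (gossip_run n ?alg (\<lambda>_. uniform_targets n) val r))
         (\<lambda>\<sigma>. bind_pmf (uniform_targets n) (\<lambda>t. gossip_step n ?alg t \<sigma>))"
    by (simp add: map_bind_pmf bind_map_pmf case_prod_beta pmf.map_comp comp_def)
  also have "\<dots> = bind_pmf (exec n b (take r P) (config n (\<lambda>v. ini (val v))))
         (\<lambda>\<sigma>. map_pmf (encode_config n enc (Suc r)) (step n b (P ! r) \<sigma>))"
    using Suc by (simp add: bind_map_pmf gossip_step_compile[OF n inj])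
  also have "\<dots> = map_pmf (encode_config n enc (Suc r)) (exec n b (take (Suc r) P) (config n (\<lambda>v. ini (val v))))"
    using Suc.prems by (simp add: take_Suc_conv_app_nth exec_append map_bind_pmf bind_return_pmf' flip: map_pmf_def)
  finally show ?case .
qed

text \<open>The comparison is applied to the failure event, where a factor 2 does no harm; applied
  to the success event it would say nothing.\<close>

lemma prob_gossip_run_compile:
  assumes n: "0 < n" and inj: "inj enc" and S: "gossip_sampler n l S" and l: "0 \<le> l"
    and fail: "Pr (exec n b P (config n (\<lambda>v. ini (val v)))) {\<sigma>. \<exists>u<n. \<not> good (res (\<sigma> u))} \<le> q"
    and small: "(1 + l) ^ (n * length P) \<le> 2"
  shows "Pr (gossip_run n (compile b enc ini P res) S val (length P))
      {(h, \<sigma>). \<forall>u<n. good (result (compile b enc ini P res) (\<sigma> u))} \<ge> 1 - 2 * q"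
proof -
  let ?alg = "compile b enc ini P res"
  let ?bad = "{(h :: ((nat \<Rightarrow> nat) \<times> (nat \<Rightarrow> nat)) list, \<sigma>). \<not> (\<forall>u<n. good (result ?alg (\<sigma> u)))}"
  let ?run = "gossip_run n ?alg S val (length P)"
  let ?urun = "gossip_run n ?alg (\<lambda>_. uniform_targets n) val (length P)"
  have "Pr ?urun ?bad
      = Pr (map_pmf snd ?urun) {\<sigma>. \<exists>u<n. \<not> good (result ?alg (\<sigma> u))}"
    by (auto simp: intro!: arg_cong[where f = "Pr ?urun"])
  also have "\<dots> = Pr (exec n b P (config n (\<lambda>v. ini (val v))))
       {\<sigma>. \<exists>u<n. \<not> good (res (\<sigma> u))}"
    by (simp add: gossip_run_compile[OF n inj] vimage_def)
       (simp add: encode_config_def compile_def Let_def inj cong: conj_cong)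
  finally have u: "Pr ?urun ?bad \<le> q" using fail by simp
  have "emeasure ?run ?bad = (\<integral>\<^sup>+e. indicator ?bad e \<partial>?run)" by simp
  also have "\<dots> \<le> ennreal ((1 + l) ^ (n * length P)) * (\<integral>\<^sup>+e. indicator ?bad e \<partial>?urun)"
    by (rule gossip_run_le_uniform[OF S l n])
  also have "\<dots> = ennreal ((1 + l) ^ (n * length P) * Pr ?urun ?bad)"
    using l by (simp add: measure_pmf.emeasure_eq_measure ennreal_mult')
  finally have "Pr ?run ?bad \<le> (1 + l) ^ (n * length P) * Pr ?urun ?bad"
    using l by (simp add: measure_pmf.emeasure_eq_measure)
  also have "\<dots> \<le> 2 * q"
    using small u by (intro mult_mono) auto
  finally have "Pr ?run ?bad \<le> 2 * q" .
  moreover have "Pr ?run {(h, \<sigma>). \<forall>u<n. good (result ?alg (\<sigma> u))} = 1 - Pr ?run ?bad"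
    by (subst measure_pmf.prob_compl[symmetric]) (auto intro!: arg_cong[where f = "Pr ?run"])
  ultimately show ?thesis by linarith
qed

section \<open>Approximate equality of distributions\<close>

text \<open>Quantifying over \<open>[0, 1]\<close>-valued functions instead of events makes the relation compose under
  \<open>bind_pmf\<close>.\<close>

definition apx :: "real \<Rightarrow> 'a pmf \<Rightarrow> 'a pmf \<Rightarrow> bool" where
  "apx d M N \<longleftrightarrow> (\<forall>g. (\<forall>x. g x \<le> 1) \<longrightarrow> (\<integral>\<^sup>+x. g x \<partial>M) \<le> (\<integral>\<^sup>+x. g x \<partial>N) + ennreal d)"

lemma apx_refl: "apx 0 M M"
  by (simp add: apx_def)

lemma apx_mono: "apx d M N \<Longrightarrow> d \<le> e \<Longrightarrow> apx e M N"
  unfolding apx_def by (meson add_left_mono ennreal_leI order_trans)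

lemma nn_integral_pmf_le_1: "(\<And>x. g x \<le> 1) \<Longrightarrow> (\<integral>\<^sup>+x. g x \<partial>measure_pmf M) \<le> 1"
  using nn_integral_mono[of "measure_pmf M" g "\<lambda>_. 1"] by simp

text \<open>Since \<open>g <= 1\<close>, the exceptional event costs no more than its
  probability.\<close>

lemma apx_bind_except:
  assumes M: "Pr M A \<le> d" and e: "0 \<le> e"
    and K: "\<And>x. x \<in> set_pmf M \<Longrightarrow> x \<notin> A \<Longrightarrow> apx e (K x) N"
  shows "apx (d + e) (bind_pmf M K) N"
  unfolding apx_def
proof (intro allI impI)
  fix g :: "'b \<Rightarrow> ennreal" assume g: "\<forall>x. g x \<le> 1"
  have d: "0 \<le> d" using M measure_nonneg[of M A] by linarith
  have "(\<integral>\<^sup>+x. g x \<partial>bind_pmf M K) = (\<integral>\<^sup>+x. (\<integral>\<^sup>+y. g y \<partial>K x) \<partial>M)" by simp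
  also have "\<dots> \<le> (\<integral>\<^sup>+x. indicator A x + ((\<integral>\<^sup>+y. g y \<partial>N) + ennreal e) \<partial>M)"
  proof (intro nn_integral_mono_AE AE_pmfI)
    fix x assume x: "x \<in> set_pmf M"
    show "(\<integral>\<^sup>+y. g y \<partial>K x) \<le> indicator A x + ((\<integral>\<^sup>+y. g y \<partial>N) + ennreal e)"
    proof (cases "x \<in> A")
      case True
      have "(\<integral>\<^sup>+y. g y \<partial>K x) \<le> 1" using g by (intro nn_integral_pmf_le_1) auto
      also have "\<dots> \<le> indicator A x + ((\<integral>\<^sup>+y. g y \<partial>N) + ennreal e)" using True by simp
      finally show ?thesis .
    next
      case False
      then show ?thesis using K[OF x False] g by (simp add: apx_def)
    qed
  qed
  also have "\<dots> = emeasure M A + ((\<integral>\<^sup>+y. g y \<partial>N) + ennreal e)"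
    by (simp add: nn_integral_add)
  also have "\<dots> \<le> ennreal d + ((\<integral>\<^sup>+y. g y \<partial>N) + ennreal e)"
    using M by (intro add_right_mono) (simp add: measure_pmf.emeasure_eq_measure ennreal_leI)
  also have "\<dots> = (\<integral>\<^sup>+y. g y \<partial>N) + ennreal (d + e)"
    using d e by (simp add: ennreal_plus ac_simps)
  finally show "(\<integral>\<^sup>+x. g x \<partial>bind_pmf M K) \<le> (\<integral>\<^sup>+y. g y \<partial>N) + ennreal (d + e)" .
qed

text \<open>Integrating \<open>g\<close> over \<open>K x\<close> gives again a function bounded by
  1, to which the relation between \<open>M\<close> and \<open>N\<close> applies. The kernels need
  be compared only on the support of the ideal law \<open>N\<close>.\<close>

lemma apx_bind:
  assumes M: "apx d M N" and d: "0 \<le> d" and e: "0 \<le> e"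
    and K: "\<And>x. x \<in> set_pmf N \<Longrightarrow> apx e (K x) (L x)"
  shows "apx (d + e) (bind_pmf M K) (bind_pmf N L)"
  unfolding apx_def
proof (intro allI impI)
  fix g :: "'b \<Rightarrow> ennreal" assume g: "\<forall>x. g x \<le> 1"
  have "(\<integral>\<^sup>+x. g x \<partial>bind_pmf M K) = (\<integral>\<^sup>+x. (\<integral>\<^sup>+y. g y \<partial>K x) \<partial>M)" by simp
  also have "\<dots> \<le> (\<integral>\<^sup>+x. (\<integral>\<^sup>+y. g y \<partial>K x) \<partial>N) + ennreal d"
    using M g by (simp add: apx_def nn_integral_pmf_le_1)
  also have "(\<integral>\<^sup>+x. (\<integral>\<^sup>+y. g y \<partial>K x) \<partial>N) \<le> (\<integral>\<^sup>+x. (\<integral>\<^sup>+y. g y \<partial>L x) + ennreal e \<partial>N)"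
    using K g by (intro nn_integral_mono_AE AE_pmfI) (simp add: apx_def)
  also have "\<dots> = (\<integral>\<^sup>+x. (\<integral>\<^sup>+y. g y \<partial>L x) \<partial>N) + ennreal e"
    by (simp add: nn_integral_add)
  finally have "(\<integral>\<^sup>+x. g x \<partial>bind_pmf M K) \<le> (\<integral>\<^sup>+x. (\<integral>\<^sup>+y. g y \<partial>L x) \<partial>N) + ennreal e + ennreal d"
    by (simp add: add_right_mono)
  then show "(\<integral>\<^sup>+x. g x \<partial>bind_pmf M K) \<le> (\<integral>\<^sup>+y. g y \<partial>bind_pmf N L) + ennreal (d + e)"
    using d e by (simp add: ennreal_plus ac_simps)
qed

lemma apx_trans:
  assumes "apx d M N" "apx e N R" "0 \<le> d" "0 \<le> e"
  shows "apx (d + e) M R"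
  unfolding apx_def
proof (intro allI impI)
  fix g :: "'a \<Rightarrow> ennreal" assume g: "\<forall>x. g x \<le> 1"
  have "(\<integral>\<^sup>+x. g x \<partial>M) \<le> (\<integral>\<^sup>+x. g x \<partial>N) + ennreal d" using assms(1) g by (simp add: apx_def)
  also have "\<dots> \<le> (\<integral>\<^sup>+x. g x \<partial>R) + ennreal e + ennreal d"
    using assms(2) g by (intro add_right_mono) (simp add: apx_def)
  finally show "(\<integral>\<^sup>+x. g x \<partial>M) \<le> (\<integral>\<^sup>+x. g x \<partial>R) + ennreal (d + e)"
    using assms(3,4) by (simp add: ac_simps)
qed

lemma apx_return:
  assumes "Pr M {y. y \<noteq> x} \<le> d"
  shows "apx d M (return_pmf x)"
proof -
  have "apx (d + 0) (bind_pmf M return_pmf) (return_pmf x)"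
    by (rule apx_bind_except[OF assms]) (auto simp: apx_refl)
  then show ?thesis by (simp add: bind_return_pmf')
qed

lemma apx_prob:
  assumes "apx d M N" "0 \<le> d"
  shows "Pr M A \<le> Pr N A + d"
proof -
  have "(\<integral>\<^sup>+x. indicator A x \<partial>M) \<le> (\<integral>\<^sup>+x. indicator A x \<partial>N) + ennreal d"
    using assms(1) unfolding apx_def by (auto simp: indicator_def)
  then have "ennreal (Pr M A) \<le> ennreal (Pr N A + d)"
    using assms(2) by (simp add: measure_pmf.emeasure_eq_measure ennreal_plus)
  then show ?thesis using assms(2) by (subst (asm) ennreal_le_iff) auto
qed

section \<open>Programs: composition, local steps and contracting potentials\<close>

lemma apx_exec_append:
  assumes "apx d (exec n b P \<sigma>) (return_pmf \<sigma>')" "apx e (exec n b Q \<sigma>') N" "0 \<le> d" "0 \<le> e"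
  shows "apx (d + e) (exec n b (P @ Q) \<sigma>) N"
  using apx_bind[OF assms(1,3,4), of "exec n b Q" "\<lambda>_. N"] assms(2)
  by (simp add: exec_append bind_return_pmf)

definition loc :: "('s \<Rightarrow> 's) \<Rightarrow> 's rule" where
  "loc f = Local_rule (\<lambda>s. return_pmf (f s))"

lemma config_cong: "(\<And>v. v < n \<Longrightarrow> f v = g v) \<Longrightarrow> config n f = config n g"
  by (auto simp: config_def)

lemma exec_loc [simp]: "exec n b (loc f # P) (config n F) = exec n b P (config n (\<lambda>v. f (F v)))"
proof -
  have "step n b (loc f) (config n F) = return_pmf (config n (\<lambda>v. f (config n F v)))"
    by (simp add: loc_def config_eq_Pi_return)
  also have "config n (\<lambda>v. f (config n F v)) = config n (\<lambda>v. f (F v))"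
    by (rule config_cong) simp
  finally show ?thesis by (simp add: bind_return_pmf)
qed

text \<open>The invariant is indexed by the round because push-sum loses one factor 2 of
  divisibility in each round; broadcasting uses a constant one.\<close>

lemma exec_contract:
  fixes pot :: "(nat \<Rightarrow> 's) \<Rightarrow> real"
  assumes inv: "\<And>j \<sigma> \<sigma>'. j < t \<Longrightarrow> Inv j \<sigma> \<Longrightarrow> \<sigma>' \<in> set_pmf (step n b r \<sigma>) \<Longrightarrow> Inv (Suc j) \<sigma>'"
    and pot: "\<And>j \<sigma>. j < t \<Longrightarrow> Inv j \<sigma> \<Longrightarrow> (\<integral>\<^sup>+\<sigma>'. ennreal (pot \<sigma>') \<partial>step n b r \<sigma>) \<le> ennreal (c * pot \<sigma>)"
    and init: "Inv 0 \<sigma>" and c: "0 \<le> c"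
  shows "(\<integral>\<^sup>+\<sigma>'. ennreal (pot \<sigma>') \<partial>exec n b (replicate t r) \<sigma>) \<le> ennreal (c ^ t * pot \<sigma>)
     \<and> (\<forall>\<sigma>'\<in>set_pmf (exec n b (replicate t r) \<sigma>). Inv t \<sigma>')"
  using inv pot
proof (induction t)
  case 0
  then show ?case using init by simp
next
  case (Suc t)
  have IH: "(\<integral>\<^sup>+\<sigma>'. ennreal (pot \<sigma>') \<partial>exec n b (replicate t r) \<sigma>) \<le> ennreal (c ^ t * pot \<sigma>)"
    "\<And>\<sigma>'. \<sigma>' \<in> set_pmf (exec n b (replicate t r) \<sigma>) \<Longrightarrow> Inv t \<sigma>'"
    using Suc.IH Suc.prems by (meson less_Suc_eq)+
  have ex: "exec n b (replicate (Suc t) r) \<sigma> = bind_pmf (exec n b (replicate t r) \<sigma>) (step n b r)"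
  proof -
    have "exec n b [] = (return_pmf :: (nat \<Rightarrow> 's) \<Rightarrow> _)" by (rule ext) simp
    then have "exec n b [r] = step n b r" by (intro ext) (simp add: bind_return_pmf')
    then show ?thesis by (simp add: exec_append flip: replicate_append_same)
  qed
  have "(\<integral>\<^sup>+\<sigma>'. ennreal (pot \<sigma>') \<partial>exec n b (replicate (Suc t) r) \<sigma>)
      = (\<integral>\<^sup>+\<sigma>'. (\<integral>\<^sup>+\<sigma>''. ennreal (pot \<sigma>'') \<partial>step n b r \<sigma>') \<partial>exec n b (replicate t r) \<sigma>)"
    unfolding ex by simp
  also have "\<dots> \<le> (\<integral>\<^sup>+\<sigma>'. ennreal c * ennreal (pot \<sigma>') \<partial>exec n b (replicate t r) \<sigma>)"
    using Suc.prems(2)[of t] IH(2) c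
    by (intro nn_integral_mono_AE AE_pmfI) (simp add: ennreal_mult')
  also have "\<dots> = ennreal c * (\<integral>\<^sup>+\<sigma>'. ennreal (pot \<sigma>') \<partial>exec n b (replicate t r) \<sigma>)"
    by (simp add: nn_integral_cmult)
  also have "\<dots> \<le> ennreal c * ennreal (c ^ t * pot \<sigma>)"
    by (intro mult_left_mono IH) auto
  also have "\<dots> = ennreal (c ^ Suc t * pot \<sigma>)"
    using c by (simp add: ennreal_mult'[symmetric] mult.assoc)
  finally show ?case
    using Suc.prems(1)[of t] IH(2) unfolding ex by auto
qed

text \<open>Markov's inequality; \<open>ennreal\<close> cuts negative values of \<open>f\<close> off
  at 0.\<close>

lemma prob_ge_le_nn_integral:
  assumes "(\<integral>\<^sup>+x. ennreal (f x) \<partial>measure_pmf M) \<le> ennreal c" "0 < a" "0 \<le> c"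
  shows "Pr M {x. a \<le> f x} \<le> c / a"
proof -
  have "ennreal a * emeasure M {x. a \<le> f x} = (\<integral>\<^sup>+x. ennreal a * indicator {x. a \<le> f x} x \<partial>M)"
    by (simp add: nn_integral_cmult)
  also have "\<dots> \<le> (\<integral>\<^sup>+x. ennreal (f x) \<partial>M)"
    by (intro nn_integral_mono) (auto simp: indicator_def ennreal_leI)
  also have "\<dots> \<le> ennreal c" by fact
  finally have "ennreal (a * Pr M {x. a \<le> f x}) \<le> ennreal c"
    using assms(2) by (simp add: measure_pmf.emeasure_eq_measure ennreal_mult)
  then show ?thesis using assms(2,3) by (simp add: ennreal_le_iff field_simps)
qed

section \<open>Moments of uniform targets\<close>

lemma lessThan_nonempty: "0 < n \<Longrightarrow> {..<n::nat} \<noteq> {}"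
  by (metis lessThan_iff empty_iff)

lemma finite_set_pmf_Pi:
  assumes "finite A" "\<And>x. x \<in> A \<Longrightarrow> finite (set_pmf (p x))"
  shows "finite (set_pmf (Pi_pmf A d p))"
  using assms by (subst set_Pi_pmf) (auto intro!: finite_PiE_dflt)

lemma finite_uniform_targets: "0 < n \<Longrightarrow> finite (set_pmf (uniform_targets n))"
  unfolding uniform_targets_def
  by (intro finite_set_pmf_Pi) (simp_all add: set_pmf_of_set lessThan_nonempty)

lemma integrable_uniform_targets: "0 < n \<Longrightarrow> integrable (measure_pmf (uniform_targets n)) (f :: _ \<Rightarrow> real)"
  by (intro integrable_measure_pmf_finite finite_uniform_targets)

abbreviation (input) "E n \<equiv> expect (uniform_targets n)"

lemma expectation_pmf_of_lessThan:
  "0 < n \<Longrightarrow> expect (pmf_of_set {..<n}) (f :: nat \<Rightarrow> real) = (\<Sum>v<n. f v) / real n"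
  by (subst integral_pmf_of_set) (simp_all add: lessThan_nonempty)

lemma expectation_target:
  assumes "0 < n" "w < n"
  shows "E n (\<lambda>t. f (t w) :: real) = (\<Sum>v<n. f v) / real n"
proof -
  have "E n (\<lambda>t. f (t w)) = expect (map_pmf (\<lambda>t. t w) (uniform_targets n)) f"
    by simp
  also have "map_pmf (\<lambda>t. t w) (uniform_targets n) = pmf_of_set {..<n}"
    unfolding uniform_targets_def using assms by (subst Pi_pmf_component) auto
  finally show ?thesis using assms by (simp add: expectation_pmf_of_lessThan)
qed

text \<open>The product formula of \<open>Pi_pmf\<close> with the constant factor 1 at every other
  coordinate.\<close>

lemma expectation_two_coordinates:
  fixes f g :: "'b \<Rightarrow> real"
  assumes fin: "finite A" "\<And>x. x \<in> A \<Longrightarrow> finite (set_pmf (p x))" and w: "w \<in> A" "w' \<in> A" "w \<noteq> w'"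
    and nn: "\<And>v. 0 \<le> f v" "\<And>v. 0 \<le> g v"
  shows "expect (Pi_pmf A d p) (\<lambda>t. f (t w) * g (t w'))
      = expect (p w) f * expect (p w') g"
proof -
  let ?h = "\<lambda>x v. if x = w then f v else if x = w' then g v else 1"
  have *: "(\<Prod>x\<in>A. F x) = F w * F w'" if "\<And>x. x \<noteq> w \<Longrightarrow> x \<noteq> w' \<Longrightarrow> F x = 1" for F :: "'a \<Rightarrow> real"
  proof -
    have "(\<Prod>x\<in>A. F x) = (\<Prod>x\<in>{w, w'}. F x)"
      using w fin(1) that by (intro prod.mono_neutral_right) auto
    then show ?thesis using w(3) by simp
  qed
  have "expect (Pi_pmf A d p) (\<lambda>t. \<Prod>x\<in>A. ?h x (t x))
      = (\<Prod>x\<in>A. expect (p x) (?h x))"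
    using fin nn by (intro expectation_prod_Pi_pmf integrable_measure_pmf_finite) auto
  then show ?thesis using w(3) by (simp add: *)
qed

lemma expectation_two_targets:
  fixes f g :: "nat \<Rightarrow> real"
  assumes "0 < n" "w < n" "w' < n" "w \<noteq> w'" "\<And>v. 0 \<le> f v" "\<And>v. 0 \<le> g v"
  shows "E n (\<lambda>t. f (t w) * g (t w')) = (\<Sum>v<n. f v) / real n * ((\<Sum>v<n. g v) / real n)"
  unfolding uniform_targets_def using assms
  by (subst expectation_two_coordinates) (auto simp: expectation_pmf_of_lessThan set_pmf_of_set lessThan_nonempty)

lemma nn_integral_eq_expectation:
  assumes "finite (set_pmf M)" "\<And>x. x \<in> set_pmf M \<Longrightarrow> 0 \<le> f x"
  shows "(\<integral>\<^sup>+x. ennreal (f x) \<partial>measure_pmf M) = ennreal (expect M f)"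
  using assms by (intro nn_integral_eq_integral integrable_measure_pmf_finite) (auto simp: AE_measure_pmf_iff)

lemma expectation_mono_pmf:
  fixes f g :: "'a \<Rightarrow> real"
  assumes "finite (set_pmf M)" "\<And>x. x \<in> set_pmf M \<Longrightarrow> f x \<le> g x"
  shows "expect M f \<le> expect M g"
  using assms by (intro integral_mono_AE integrable_measure_pmf_finite) (auto simp: AE_measure_pmf_iff)

lemma expectation_cong_pmf:
  fixes f g :: "'a \<Rightarrow> real"
  assumes "\<And>x. x \<in> set_pmf M \<Longrightarrow> f x = g x"
  shows "expect M f = expect M g"
  using assms by (intro integral_cong_AE) (auto simp: AE_measure_pmf_iff)

text \<open>With \<open>s\<close> informed nodes and \<open>B\<close> newly informed ones, \<open>1 / (s + B)\<close> is bounded by a polynomial of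
  degree two in \<open>B\<close>, so that two moments of \<open>B\<close> suffice.\<close>

lemma expectation_informed:
  assumes n: "0 < n" and I: "I \<subseteq> {..<n}" "I \<noteq> {}"
  shows "E n (\<lambda>t. real n / real (card (I \<union> {v. v < n \<and> t v \<in> I})) - 1) \<le> 2 / 3 * (real n / real (card I) - 1)"
proof -
  define J where "J = {..<n} - I"
  define s where "s = real (card I)"
  define N where "N = real (card J)"
  define B where "B = (\<lambda>t::nat \<Rightarrow> nat. \<Sum>v\<in>J. indicator I (t v) :: real)"
  have finI: "finite I" using I finite_subset by blast
  have finJ: "finite J" by (simp add: J_def)
  have cI: "card I \<noteq> 0" using I finI by simp
  then have s1: "1 \<le> s" by (simp add: s_def)
  have nN: "real n = s + N"
  proof -
    have "card J = n - card I" "card I \<le> n"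
      using I finI card_mono[OF _ I(1)] by (simp_all add: J_def card_Diff_subset)
    then show ?thesis by (simp add: s_def N_def)
  qed
  have N0: "0 \<le> N" by (simp add: N_def)
  have n0: "0 < real n" using n by simp
  have ind: "(\<Sum>v<n. indicator I v :: real) = s"
    using I by (simp add: s_def indicator_def sum.If_cases Int_absorb1)
  have card': "real (card (I \<union> {v. v < n \<and> t v \<in> I})) = s + B t" for t
  proof -
    have "I \<union> {v. v < n \<and> t v \<in> I} = I \<union> {v\<in>J. t v \<in> I}"
      using I by (auto simp: J_def)
    also have "card \<dots> = card I + card {v\<in>J. t v \<in> I}"
      using finI finJ by (intro card_Un_disjoint) (auto simp: J_def)
    finally show ?thesis using finJ
      by (simp add: s_def B_def indicator_def sum.If_cases Int_def)
  qed
  have B0: "0 \<le> B t" for t by (simp add: B_def sum_nonneg)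
  define b where "b = N * s / real n"
  have EB: "E n B = b"
    unfolding B_def using n
    by (subst Bochner_Integration.integral_sum)
       (auto simp: integrable_uniform_targets J_def expectation_target ind b_def N_def)
  have EB2: "E n (\<lambda>t. (B t)\<^sup>2) \<le> b + b\<^sup>2"
  proof -
    have "(B t)\<^sup>2 = (\<Sum>v\<in>J. \<Sum>w\<in>J. indicator I (t v) * indicator I (t w))" for t
      by (simp add: B_def power2_eq_square sum_product)
    then have "E n (\<lambda>t. (B t)\<^sup>2) = (\<Sum>v\<in>J. \<Sum>w\<in>J. E n (\<lambda>t. indicator I (t v) * indicator I (t w)))"
      using n by (simp add: Bochner_Integration.integral_sum integrable_uniform_targets)
    also have "\<dots> \<le> (\<Sum>v\<in>J. \<Sum>w\<in>J. (if v = w then s / real n else 0) + (s / real n)\<^sup>2)"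
    proof (intro sum_mono)
      fix v w assume vw: "v \<in> J" "w \<in> J"
      show "E n (\<lambda>t. indicator I (t v) * indicator I (t w)) \<le> (if v = w then s / real n else 0) + (s / real n)\<^sup>2"
      proof (cases "v = w")
        case True
        have "(\<lambda>t. indicator I (t w) * indicator I (t w) :: real) = (\<lambda>t. indicator I (t w))"
          by (auto simp: indicator_def)
        then show ?thesis using True vw n by (simp add: J_def expectation_target ind)
      next
        case False
        then show ?thesis using vw n
          by (subst expectation_two_targets) (auto simp: J_def ind power2_eq_square)
      qed
    qed
    also have "\<dots> = b + b\<^sup>2"
      using finJ by (simp add: sum.distrib N_def b_def power2_eq_square algebra_simps)
    finally show ?thesis .
  qed
  have bs: "b \<le> s" "0 \<le> b"
    using nN N0 s1 n0 by (auto simp: b_def field_simps)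
  \<comment> \<open>The quadratic agrees with \<open>1 / (s + x)\<close> at \<open>x = 0\<close> and
    touches it at \<open>x = 2 s\<close>; the remainder is written out explicitly.\<close>
  have pt: "real n / (s + B t) - 1 \<le> real n / s - 1 - real n / s * (2 / (3 * s) * B t - (s * B t + (B t)\<^sup>2) / (9 * s\<^sup>2))" for t
  proof -
    let ?x = "B t"
    have x: "0 \<le> ?x" by (rule B0)
    have "1 / s - 1 / s * (2 / (3 * s) * ?x - (s * ?x + ?x\<^sup>2) / (9 * s\<^sup>2)) - 1 / (s + ?x)
        = ?x * (3 * s - (s + ?x))\<^sup>2 / (9 * s ^ 3 * (s + ?x))"
      using s1 x by (simp add: field_simps power2_eq_square power3_eq_cube)
    also have "\<dots> \<ge> 0" using s1 x by simp
    finally have "1 / (s + ?x) \<le> 1 / s - 1 / s * (2 / (3 * s) * ?x - (s * ?x + ?x\<^sup>2) / (9 * s\<^sup>2))" by simp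
    from mult_left_mono[OF this, of "real n"]
    have "real n / (s + ?x) \<le> real n * (1 / s - 1 / s * (2 / (3 * s) * ?x - (s * ?x + ?x\<^sup>2) / (9 * s\<^sup>2)))"
      by simp
    also have "\<dots> = real n / s - real n / s * (2 / (3 * s) * ?x - (s * ?x + ?x\<^sup>2) / (9 * s\<^sup>2))"
      by (simp only: right_diff_distrib mult.assoc[symmetric] mult_1_right times_divide_eq_right)
    finally show ?thesis by simp
  qed
  have "E n (\<lambda>t. real n / real (card (I \<union> {v. v < n \<and> t v \<in> I})) - 1)
     \<le> E n (\<lambda>t. real n / s - 1 - real n / s * (2 / (3 * s) * B t - (s * B t + (B t)\<^sup>2) / (9 * s\<^sup>2)))"
    unfolding card' using n by (intro expectation_mono_pmf finite_uniform_targets pt)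
  also have "\<dots> = real n / s - 1 - real n / s * (2 / (3 * s) * b - (s * b + E n (\<lambda>t. (B t)\<^sup>2)) / (9 * s\<^sup>2))"
    using n by (simp add: integrable_uniform_targets EB)
  \<comment> \<open>Because \<open>1 <= s\<close> and \<open>b <= s\<close>, the second-order term
    eats at most half of the gain \<open>2 b / (3 s)\<close>. What remains is exactly a third of
    \<open>n / s - 1\<close>.\<close>
  also have "\<dots> \<le> real n / s - 1 - real n / s * (b / (3 * s))"
  proof -
    have "s * b + E n (\<lambda>t. (B t)\<^sup>2) \<le> s * b + (b + b\<^sup>2)" using EB2 by simp
    also have "\<dots> \<le> 3 * s * b"
      using bs s1 mult_right_mono[of b s b] mult_right_mono[of 1 s b]
      by (simp add: power2_eq_square mult.commute)
    finally have "(s * b + E n (\<lambda>t. (B t)\<^sup>2)) / (9 * s\<^sup>2) \<le> 3 * s * b / (9 * s\<^sup>2)"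
      by (intro divide_right_mono) auto
    also have "\<dots> = b / (3 * s)" using s1 by (simp add: power2_eq_square)
    finally have "b / (3 * s) \<le> 2 / (3 * s) * b - (s * b + E n (\<lambda>t. (B t)\<^sup>2)) / (9 * s\<^sup>2)" by simp
    then show ?thesis using s1 n0 by (intro diff_left_mono mult_left_mono) auto
  qed
  also have "\<dots> = 2 / 3 * (real n / s - 1)"
  proof -
    have "real n / s * (b / (3 * s)) = N / (3 * s)" using s1 n0 by (simp add: b_def)
    moreover have "real n / s - 1 = N / s" using nN s1 by (simp add: field_simps)
    ultimately show ?thesis by simp
  qed
  finally show ?thesis by (simp add: s_def)
qed

text \<open>Expanding the square gives retained, cross and collision terms. The cross term has mean
  0 because the \<open>z v\<close> sum to 0. Two distinct nodes collide with probability
  \<open>1 / n\<close>, and by the same token these collisions contribute a negative multiple of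
  \<open>Z\<close>, the sum of squares. What is left is a quarter of at most
  \<open>2 * Z\<close>.\<close>

lemma expectation_push_sum:
  fixes z :: "nat \<Rightarrow> real"
  assumes n: "0 < n" and z: "(\<Sum>v<n. z v) = 0"
  shows "E n (\<lambda>t. \<Sum>v<n. (z v / 2 + (\<Sum>w<n. if t w = v then z w / 2 else 0))\<^sup>2) \<le> 1 / 2 * (\<Sum>v<n. (z v)\<^sup>2)"
proof -
  let ?Z = "\<Sum>v<n. (z v)\<^sup>2"
  let ?eq = "\<lambda>t w w'. if t w = t w' then z w * z w' else (0::real)"
  have pt: "(\<Sum>v<n. (z v / 2 + (\<Sum>w<n. if t w = v then z w / 2 else 0))\<^sup>2)
     = 1 / 4 * (?Z + 2 * (\<Sum>w<n. z w * z (t w)) + (\<Sum>w<n. \<Sum>w'<n. ?eq t w w'))"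
    if t: "t \<in> set_pmf (uniform_targets n)" for t
  proof -
    have tn: "t w < n" if "w < n" for w using set_uniform_targets[OF n t that] .
    define S where "S = (\<lambda>v. \<Sum>w<n. if t w = v then z w else 0)"
    have S: "(\<Sum>w<n. if t w = v then z w / 2 else 0) = S v / 2" for v
      by (simp add: S_def sum_divide_distrib if_distrib[of "\<lambda>x. x / 2"] cong: if_cong)
    have 1: "(\<Sum>v<n. z v * S v) = (\<Sum>w<n. z w * z (t w))"
    proof -
      have "(\<Sum>v<n. z v * S v) = (\<Sum>w<n. \<Sum>v<n. if t w = v then z v * z w else 0)"
        unfolding S_def sum_distrib_left by (subst sum.swap) (intro sum.cong refl, simp)
      also have "\<dots> = (\<Sum>w<n. z w * z (t w))" using tn by (intro sum.cong refl) (simp add: mult.commute)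
      finally show ?thesis .
    qed
    have 2: "(\<Sum>v<n. (S v)\<^sup>2) = (\<Sum>w<n. \<Sum>w'<n. ?eq t w w')"
    proof -
      have "(\<Sum>v<n. (S v)\<^sup>2) = (\<Sum>v<n. \<Sum>w<n. \<Sum>w'<n. (if t w = v then z w else 0) * (if t w' = v then z w' else 0))"
        by (simp add: S_def power2_eq_square sum_product)
      also have "\<dots> = (\<Sum>w<n. \<Sum>v<n. \<Sum>w'<n. (if t w = v then z w else 0) * (if t w' = v then z w' else 0))"
        by (rule sum.swap)
      also have "\<dots> = (\<Sum>w<n. \<Sum>w'<n. \<Sum>v<n. (if t w = v then z w else 0) * (if t w' = v then z w' else 0))"
        by (intro sum.cong refl sum.swap)
      also have "\<dots> = (\<Sum>w<n. \<Sum>w'<n. ?eq t w w')"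
      proof (intro sum.cong refl)
        fix w w' assume "w \<in> {..<n}" "w' \<in> {..<n}"
        have "(\<Sum>v<n. (if t w = v then z w else 0) * (if t w' = v then z w' else 0))
           = (\<Sum>v<n. if t w = v then (if t w' = v then z w * z w' else 0) else 0)"
          by (intro sum.cong refl) simp
        also have "\<dots> = ?eq t w w'" using tn \<open>w \<in> {..<n}\<close> by (subst sum.delta') auto
        finally show "(\<Sum>v<n. (if t w = v then z w else 0) * (if t w' = v then z w' else 0)) = ?eq t w w'" .
      qed
      finally show ?thesis .
    qed
    have "(\<Sum>v<n. (z v / 2 + S v / 2)\<^sup>2) = (\<Sum>v<n. 1 / 4 * ((z v)\<^sup>2 + 2 * (z v * S v) + (S v)\<^sup>2))"
      by (intro sum.cong refl) (simp add: power2_eq_square field_simps)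
    also have "\<dots> = 1 / 4 * (?Z + 2 * (\<Sum>v<n. z v * S v) + (\<Sum>v<n. (S v)\<^sup>2))"
      by (simp only: sum_distrib_left[symmetric] sum.distrib)
    finally show ?thesis by (simp add: S 1 2)
  qed
  have Eeq: "E n (\<lambda>t. ?eq t w w') = (if w = w' then (z w)\<^sup>2 else z w * z w' / real n)" if w: "w < n" "w' < n" for w w'
  proof (cases "w = w'")
    case False
    have "E n (\<lambda>t. ?eq t w w') = E n (\<lambda>t. z w * z w' * (\<Sum>u<n. indicator {u} (t w) * indicator {u} (t w')))"
    proof (rule expectation_cong_pmf)
      fix t assume "t \<in> set_pmf (uniform_targets n)"
      then have "t w < n" using set_uniform_targets[OF n] w by blast
      have "(\<Sum>u<n. indicator {u} (t w) * indicator {u} (t w')) = (\<Sum>u<n. if t w = u then indicator {u} (t w') else 0 :: real)"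
        by (intro sum.cong) (auto simp: indicator_def)
      also have "\<dots> = indicator {t w} (t w')" using \<open>t w < n\<close> by (subst sum.delta') auto
      finally have *: "(\<Sum>u<n. indicator {u} (t w) * indicator {u} (t w')) = (indicator {t w} (t w') :: real)" .
      show "?eq t w w' = z w * z w' * (\<Sum>u<n. indicator {u} (t w) * indicator {u} (t w'))"
        unfolding * by (auto simp: indicator_def)
    qed
    also have "\<dots> = z w * z w' * (\<Sum>u<n. E n (\<lambda>t. indicator {u} (t w) * indicator {u} (t w')))"
      using n by (subst integral_mult_right_zero, subst Bochner_Integration.integral_sum)
        (simp_all only: integrable_uniform_targets)
    also have "(\<Sum>u<n. E n (\<lambda>t. indicator {u} (t w) * indicator {u} (t w'))) = (\<Sum>u<n. 1 / real n * (1 / real n))"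
    proof (intro sum.cong refl)
      fix u assume u: "u \<in> {..<n}"
      have "(\<Sum>v<n. indicator {u} v :: real) = 1" using u by (simp add: indicator_def)
      then show "E n (\<lambda>t. indicator {u} (t w) * indicator {u} (t w')) = 1 / real n * (1 / real n)"
        using n w False by (subst expectation_two_targets) auto
    qed
    finally show ?thesis using False n by simp
  qed (simp add: power2_eq_square)
  have "E n (\<lambda>t. \<Sum>v<n. (z v / 2 + (\<Sum>w<n. if t w = v then z w / 2 else 0))\<^sup>2)
     = E n (\<lambda>t. 1 / 4 * (?Z + 2 * (\<Sum>w<n. z w * z (t w)) + (\<Sum>w<n. \<Sum>w'<n. ?eq t w w')))"
    by (rule expectation_cong_pmf) (rule pt)
  also have "\<dots> = 1 / 4 * (?Z + 2 * (\<Sum>w<n. z w * E n (\<lambda>t. z (t w))) + (\<Sum>w<n. \<Sum>w'<n. E n (\<lambda>t. ?eq t w w')))"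
    using n by (simp add: Bochner_Integration.integral_sum integrable_uniform_targets)
  also have "(\<Sum>w<n. z w * E n (\<lambda>t. z (t w))) = 0"
    using n z by (intro sum.neutral) (simp add: expectation_target)
  \<comment> \<open>The diagonal \<open>(z w)^2 / n\<close> is added and subtracted, which completes
    the off-diagonal part to a full double sum; that one vanishes.\<close>
  also have "(\<Sum>w<n. \<Sum>w'<n. E n (\<lambda>t. ?eq t w w')) = (\<Sum>w<n. \<Sum>w'<n. (if w = w' then (z w)\<^sup>2 - (z w)\<^sup>2 / real n else 0) + z w * z w' / real n)"
    by (intro sum.cong refl) (auto simp: Eeq power2_eq_square)
  also have "\<dots> = (\<Sum>w<n. (z w)\<^sup>2 - (z w)\<^sup>2 / real n) + (\<Sum>w<n. z w * (\<Sum>w'<n. z w') / real n)"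
    by (simp add: sum.distrib sum_distrib_left sum_divide_distrib)
  also have "\<dots> = ?Z - ?Z / real n"
    by (simp add: z sum_subtractf sum_divide_distrib)
  finally have "E n (\<lambda>t. \<Sum>v<n. (z v / 2 + (\<Sum>w<n. if t w = v then z w / 2 else 0))\<^sup>2)
     = 1 / 4 * (?Z + 2 * 0 + (?Z - ?Z / real n))" .
  moreover have "0 \<le> ?Z / real n" by (simp add: sum_nonneg)
  moreover have "e \<le> 1 / 2 * Z" if "e = 1 / 4 * (Z + 2 * 0 + (Z - q))" "0 \<le> q" for e Z q :: real
    using that by (simp add: field_simps)
  ultimately show ?thesis by blast
qed

section \<open>Broadcasting a maximum and computing a sum\<close>

text \<open>From here on simp unfolds programs only at local steps, through \<open>exec_loc\<close>;
  communication is left to separate lemmas.\<close>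

declare exec.simps(2) [simp del]

text \<open>\<open>home\<close> holds the copies of values (tokens) kept by the node, \<open>cnt\<close> the number of non-NULL
  nodes, and \<open>outs\<close> the results of the iterations so far, latest first. The remaining fields are
  scratch space: \<open>summ\<close> puts the sum of all \<open>arg\<close> into \<open>tot\<close>, and \<open>spread\<close> the
  maximum of all \<open>key\<close> into \<open>key\<close>.\<close>

record st =
  inp :: "nat option"
  home :: "nat list"
  cnt :: nat
  outs :: "(nat \<times> nat) list"
  arg :: nat
  key :: nat
  mass :: nat
  wgt :: nat
  inbox :: "nat multiset"
  chosen :: nat
  tot :: nat
  saved :: nat

definition spread :: "nat \<Rightarrow> st rule list" where
  "spread t = replicate t (Pull_rule key (\<lambda>s m. s\<lparr>key := max (key s) m\<rparr>))"

lemma prob_mono_support: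
  assumes "\<And>x. x \<in> set_pmf M \<Longrightarrow> x \<in> A \<Longrightarrow> x \<in> B"
  shows "Pr M A \<le> Pr M B"
  using assms by (intro measure_pmf.finite_measure_mono_AE) (auto simp: AE_measure_pmf_iff)

text \<open>The potential is at most \<open>n\<close> at the start and at least \<open>1 / n\<close>
  as long as a node is uninformed, so Markov's inequality yields the factor \<open>n^2\<close>. The
  bound on the keys makes the truncation to \<open>b\<close> bits harmless.\<close>

lemma spread_apx:
  assumes n: "0 < n" and keys: "\<And>v. v < n \<Longrightarrow> key (F v) < 2 ^ b"
  shows "apx ((real n)\<^sup>2 * (2 / 3) ^ t) (exec n b (spread t) (config n F))
     (return_pmf (config n (\<lambda>v. (F v)\<lparr>key := Max ((\<lambda>v. key (F v)) ` {..<n})\<rparr>)))"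
proof -
  define K where "K = Max ((\<lambda>v. key (F v)) ` {..<n})"
  define Inv where "Inv = (\<lambda>(j::nat) \<sigma>. \<exists>\<kappa>. \<sigma> = config n (\<lambda>v. (F v)\<lparr>key := \<kappa> v\<rparr>) \<and> (\<forall>v<n. \<kappa> v \<le> K) \<and> (\<exists>v<n. \<kappa> v = K))"
  define I :: "(nat \<Rightarrow> st) \<Rightarrow> nat set" where "I = (\<lambda>\<sigma>. {v. v < n \<and> key (\<sigma> v) = K})"
  define pot :: "(nat \<Rightarrow> st) \<Rightarrow> real" where "pot = (\<lambda>\<sigma>. real n / real (card (I \<sigma>)) - 1)"
  let ?r = "Pull_rule key (\<lambda>s m. s\<lparr>key := max (key s) m\<rparr>)"
  have Kin: "K \<in> (\<lambda>v. key (F v)) ` {..<n}"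
    unfolding K_def using n by (intro Max_in) (simp_all add: lessThan_nonempty)
  then have Kb: "K < 2 ^ b" using keys by auto
  have init: "Inv 0 (config n F)"
    unfolding Inv_def using Kin
    by (intro exI[of _ "\<lambda>v. key (F v)"]) (auto simp: K_def intro!: config_cong)
  have st: "step n b ?r \<sigma> = map_pmf (\<lambda>t. config n (\<lambda>v. (F v)\<lparr>key := max (\<kappa> v) (\<kappa> (t v))\<rparr>)) (uniform_targets n)"
    if \<sigma>: "\<sigma> = config n (\<lambda>v. (F v)\<lparr>key := \<kappa> v\<rparr>)" and \<kappa>: "\<forall>v<n. \<kappa> v \<le> K" for \<sigma> \<kappa>
    unfolding step.simps
  proof (rule map_pmf_cong[OF refl], rule config_cong)
    fix t v assume t: "t \<in> set_pmf (uniform_targets n)" and v: "v < n"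
    have tv: "t v < n" using set_uniform_targets[OF n t v] .
    then have "take_bit b (\<kappa> (t v)) = \<kappa> (t v)"
      using \<kappa> Kb by (intro take_bit_nat_eq_self) (meson le_less_trans)
    then show "(\<sigma> v)\<lparr>key := max (key (\<sigma> v)) (take_bit b (key (\<sigma> (t v))))\<rparr> = (F v)\<lparr>key := max (\<kappa> v) (\<kappa> (t v))\<rparr>"
      using v tv by (simp add: \<sigma>)
  qed
  have inv: "Inv (Suc j) \<sigma>'" if I: "Inv j \<sigma>" and s': "\<sigma>' \<in> set_pmf (step n b ?r \<sigma>)" for j \<sigma> \<sigma>'
  proof -
    obtain \<kappa> where \<kappa>: "\<sigma> = config n (\<lambda>v. (F v)\<lparr>key := \<kappa> v\<rparr>)" "\<forall>v<n. \<kappa> v \<le> K" "\<exists>v<n. \<kappa> v = K"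
      using I unfolding Inv_def by blast
    obtain t where t: "t \<in> set_pmf (uniform_targets n)" "\<sigma>' = config n (\<lambda>v. (F v)\<lparr>key := max (\<kappa> v) (\<kappa> (t v))\<rparr>)"
      using s' unfolding st[OF \<kappa>(1,2)] by auto
    have tn: "t v < n" if "v < n" for v using set_uniform_targets[OF n t(1) that] .
    obtain v where v: "v < n" "\<kappa> v = K" using \<kappa>(3) by blast
    have "max (\<kappa> v) (\<kappa> (t v)) = K" using v \<kappa>(2) tn by simp
    then show ?thesis unfolding Inv_def using \<kappa>(2) tn v(1)
      by (intro exI[of _ "\<lambda>v. max (\<kappa> v) (\<kappa> (t v))"]) (auto simp: t(2))
  qed
  have pot: "(\<integral>\<^sup>+\<sigma>'. ennreal (pot \<sigma>') \<partial>step n b ?r \<sigma>) \<le> ennreal (2 / 3 * pot \<sigma>)" if I: "Inv j \<sigma>" for j \<sigma>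
  proof -
    obtain \<kappa> where \<kappa>: "\<sigma> = config n (\<lambda>v. (F v)\<lparr>key := \<kappa> v\<rparr>)" "\<forall>v<n. \<kappa> v \<le> K" "\<exists>v<n. \<kappa> v = K"
      using I unfolding Inv_def by blast
    let ?I = "{v. v < n \<and> \<kappa> v = K}"
    have I\<sigma>: "I \<sigma> = ?I" by (auto simp: I_def \<kappa>(1))
    have card_le: "card (?I \<union> {v. v < n \<and> t v \<in> ?I}) \<le> n" for t :: "nat \<Rightarrow> nat"
      using card_mono[of "{..<n}" "?I \<union> {v. v < n \<and> t v \<in> ?I}"] by (auto simp: subset_iff)
    have card_pos: "0 < card (?I \<union> {v. v < n \<and> t v \<in> ?I})" for t :: "nat \<Rightarrow> nat"
      using \<kappa>(3) by (auto simp: card_gt_0_iff)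
    have "(\<integral>\<^sup>+\<sigma>'. ennreal (pot \<sigma>') \<partial>step n b ?r \<sigma>)
      = (\<integral>\<^sup>+t. ennreal (real n / real (card (?I \<union> {v. v < n \<and> t v \<in> ?I})) - 1) \<partial>uniform_targets n)"
      unfolding st[OF \<kappa>(1,2)] nn_integral_map_pmf
    proof (intro nn_integral_cong_AE AE_pmfI)
      fix t assume t: "t \<in> set_pmf (uniform_targets n)"
      have tn: "t v < n" if "v < n" for v using set_uniform_targets[OF n t that] .
      have "I (config n (\<lambda>v. (F v)\<lparr>key := max (\<kappa> v) (\<kappa> (t v))\<rparr>)) = ?I \<union> {v. v < n \<and> t v \<in> ?I}"
      proof -
        have "max (\<kappa> v) (\<kappa> (t v)) = K \<longleftrightarrow> \<kappa> v = K \<or> \<kappa> (t v) = K" if "v < n" for v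
          using \<kappa>(2)[rule_format, OF that] \<kappa>(2)[rule_format, OF tn[OF that]] by linarith
        then show ?thesis using tn by (auto simp: I_def)
      qed
      then show "ennreal (pot (config n (\<lambda>v. (F v)\<lparr>key := max (\<kappa> v) (\<kappa> (t v))\<rparr>)))
         = ennreal (real n / real (card (?I \<union> {v. v < n \<and> t v \<in> ?I})) - 1)"
        by (simp add: pot_def)
    qed
    also have "\<dots> = ennreal (E n (\<lambda>t. real n / real (card (?I \<union> {v. v < n \<and> t v \<in> ?I})) - 1))"
      using n card_le card_pos
      by (intro nn_integral_eq_expectation finite_uniform_targets) (auto simp: le_divide_eq)
    also have "\<dots> \<le> ennreal (2 / 3 * pot \<sigma>)"
      unfolding pot_def I\<sigma> using n \<kappa>(3) by (intro ennreal_leI expectation_informed) auto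
    finally show ?thesis .
  qed
  have main: "(\<integral>\<^sup>+\<sigma>'. ennreal (pot \<sigma>') \<partial>exec n b (spread t) (config n F)) \<le> ennreal ((2 / 3) ^ t * pot (config n F))
     \<and> (\<forall>\<sigma>'\<in>set_pmf (exec n b (spread t) (config n F)). Inv t \<sigma>')"
    unfolding spread_def by (rule exec_contract[where Inv = Inv]) (use inv pot init in auto)
  have pot0: "pot (config n F) \<le> real n"
  proof -
    have "real n / real c \<le> real n" for c
      using mult_left_mono[of 1 "real c" "real n"] by (cases "c = 0") (auto simp: divide_le_eq)
    then show ?thesis unfolding pot_def by (smt (verit))
  qed
  have "Pr (exec n b (spread t) (config n F)) {\<sigma>. 1 / real n \<le> pot \<sigma>}
     \<le> (2 / 3) ^ t * real n / (1 / real n)"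
  proof (rule prob_ge_le_nn_integral)
    show "(\<integral>\<^sup>+\<sigma>'. ennreal (pot \<sigma>') \<partial>exec n b (spread t) (config n F)) \<le> ennreal ((2 / 3) ^ t * real n)"
      using main pot0 by (meson ennreal_leI mult_left_mono order_trans zero_le_divide_iff zero_le_numeral zero_le_power)
  qed (use n in auto)
  also have "\<dots> = (real n)\<^sup>2 * (2 / 3) ^ t" by (simp add: power2_eq_square)
  finally have pr: "Pr (exec n b (spread t) (config n F)) {\<sigma>. 1 / real n \<le> pot \<sigma>} \<le> (real n)\<^sup>2 * (2 / 3) ^ t" .
  have "Pr (exec n b (spread t) (config n F)) {\<sigma>. \<sigma> \<noteq> config n (\<lambda>v. (F v)\<lparr>key := K\<rparr>)}
    \<le> Pr (exec n b (spread t) (config n F)) {\<sigma>. 1 / real n \<le> pot \<sigma>}"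
  proof (rule prob_mono_support, safe)
    fix \<sigma> assume \<sigma>: "\<sigma> \<in> set_pmf (exec n b (spread t) (config n F))" and ne: "\<sigma> \<noteq> config n (\<lambda>v. (F v)\<lparr>key := K\<rparr>)"
    have "Inv t \<sigma>" using main \<sigma> by blast
    then obtain \<kappa> where \<kappa>: "\<sigma> = config n (\<lambda>v. (F v)\<lparr>key := \<kappa> v\<rparr>)" "\<exists>v<n. \<kappa> v = K" unfolding Inv_def by blast
    have "\<exists>v<n. \<kappa> v \<noteq> K"
      using ne config_cong[of n "\<lambda>v. (F v)\<lparr>key := \<kappa> v\<rparr>" "\<lambda>v. (F v)\<lparr>key := K\<rparr>"] unfolding \<kappa>(1) by auto
    then obtain v where v: "v < n" "\<kappa> v \<noteq> K" by blast
    have I\<sigma>: "I \<sigma> = {v. v < n \<and> \<kappa> v = K}" unfolding I_def \<kappa>(1) by (rule Collect_cong) (simp cong: conj_cong)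
    have "I \<sigma> \<subseteq> {..<n} - {v}" using v unfolding I\<sigma> by blast
    then have "card (I \<sigma>) \<le> card ({..<n} - {v})" by (rule card_mono[rotated]) simp
    then have "card (I \<sigma>) < n" using v(1) by simp
    moreover have "finite (I \<sigma>)" "I \<sigma> \<noteq> {}" using \<kappa>(2) unfolding I\<sigma> by auto
    then have "0 < card (I \<sigma>)" by (simp add: card_gt_0_iff)
    ultimately have c: "1 \<le> real n - real (card (I \<sigma>))" "0 < real (card (I \<sigma>))" "real (card (I \<sigma>)) \<le> real n" by auto
    have "1 / real n \<le> 1 / real (card (I \<sigma>))" using c by (intro divide_left_mono) auto
    also have "\<dots> \<le> (real n - real (card (I \<sigma>))) / real (card (I \<sigma>))" using c by (intro divide_right_mono) auto
    also have "\<dots> = pot \<sigma>" using c by (simp add: pot_def field_simps)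
    finally show "1 / real n \<le> pot \<sigma>" .
  qed
  with pr show ?thesis unfolding K_def[symmetric] by (intro apx_return) linarith
qed

text \<open>Masses and weights are scaled by \<open>2 ^ t\<close>, so that the divisions by 2 in \<open>t\<close> rounds are exact.\<close>

definition halve :: "nat \<Rightarrow> st rule" where
  "halve W = Push_rule (\<lambda>s. Some (wgt s div 2 * W + mass s div 2))
     (\<lambda>s M. s\<lparr>mass := mass s div 2 + (\<Sum>m\<in>#M. m mod W), wgt := wgt s div 2 + (\<Sum>m\<in>#M. m div W)\<rparr>)"

text \<open>In the key the weight is the leading digit in base \<open>W\<close>, so the maximum
  belongs to a node of largest weight and carries its mass along. Broadcasting gets
  \<open>2 * t\<close> rounds since \<open>(2/3)^2 <= 1/2\<close>. The scratch fields are reset so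
  that the final configuration is known exactly.\<close>

definition summ :: "nat \<Rightarrow> nat \<Rightarrow> nat \<Rightarrow> st rule list" where
  "summ n W t = loc (\<lambda>s. s\<lparr>mass := arg s * 2 ^ t, wgt := 2 ^ t\<rparr>) # replicate t (halve W)
     @ loc (\<lambda>s. s\<lparr>key := wgt s * W + mass s\<rparr>) # spread (2 * t)
     @ [loc (\<lambda>s. s\<lparr>tot := nat (round (real n * real (key s mod W) / real (key s div W))), mass := 0, wgt := 0, key := 0\<rparr>)]"

lemma sum_mset_sum_set: "sum_mset (sum g A) = (\<Sum>x\<in>A. sum_mset (g x))"
  by (induction A rule: infinite_finite_induct) auto

text \<open>Weight and mass travel as two digits in base \<open>W\<close>;
  \<open>W * W <= 2 ^ b\<close> protects them from truncation.\<close>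

lemma step_halve:
  assumes n: "0 < n" and W: "W * W \<le> 2 ^ b" and \<sigma>: "\<sigma> = config n (\<lambda>v. (F v)\<lparr>mass := x v, wgt := y v\<rparr>)"
    and x: "\<And>v. v < n \<Longrightarrow> x v < W" and y: "\<And>v. v < n \<Longrightarrow> y v < W"
  shows "step n b (halve W) \<sigma> = map_pmf (\<lambda>t. config n (\<lambda>v. (F v)
      \<lparr>mass := x v div 2 + (\<Sum>w<n. if t w = v then x w div 2 else 0),
       wgt := y v div 2 + (\<Sum>w<n. if t w = v then y w div 2 else 0)\<rparr>)) (uniform_targets n)"
  unfolding halve_def step.simps
proof (rule map_pmf_cong[OF refl], rule config_cong)
  fix t v assume v: "v < n"
  let ?m = "\<lambda>w. y w div 2 * W + x w div 2"
  let ?M = "\<Sum>w<n. if t w = v then image_mset (take_bit b)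
                (opt_mset (Some (wgt (\<sigma> w) div 2 * W + mass (\<sigma> w) div 2))) else {#}"
  have M: "?M = (\<Sum>w<n. if t w = v then {#?m w#} else {#})"
  proof (intro sum.cong refl)
    fix w assume w: "w \<in> {..<n}"
    then have xw: "x w < W" "y w < W" using x y by auto
    have "?m w < W * W"
    proof -
      have "?m w < y w div 2 * W + W" using xw by auto
      also have "\<dots> = (y w div 2 + 1) * W" by simp
      also have "\<dots> \<le> W * W" using xw by (intro mult_right_mono) auto
      finally show ?thesis .
    qed
    then have "take_bit b (?m w) = ?m w" using W by (intro take_bit_nat_eq_self) linarith
    then show "(if t w = v then image_mset (take_bit b)
           (opt_mset (Some (wgt (\<sigma> w) div 2 * W + mass (\<sigma> w) div 2))) else {#}) = (if t w = v then {#?m w#} else {#})"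
      using w by (simp add: \<sigma> opt_mset_def)
  qed
  have md: "?m w mod W = x w div 2" "?m w div W = y w div 2" if "w < n" for w
    using x[OF that] by auto
  have "(\<Sum>m\<in>#?M. m mod W) = (\<Sum>w<n. if t w = v then x w div 2 else 0)"
    unfolding M image_mset_sum_set sum_mset_sum_set using md by (intro sum.cong refl) auto
  moreover have "(\<Sum>m\<in>#?M. m div W) = (\<Sum>w<n. if t w = v then y w div 2 else 0)"
    unfolding M image_mset_sum_set sum_mset_sum_set using md by (intro sum.cong refl) auto
  ultimately show "(\<sigma> v)\<lparr>mass := mass (\<sigma> v) div 2 + (\<Sum>m\<in>#?M. m mod W), wgt := wgt (\<sigma> v) div 2 + (\<Sum>m\<in>#?M. m div W)\<rparr>
     = (F v)\<lparr>mass := x v div 2 + (\<Sum>w<n. if t w = v then x w div 2 else 0),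
       wgt := y v div 2 + (\<Sum>w<n. if t w = v then y w div 2 else 0)\<rparr>"
    using v by (simp only:) (simp add: \<sigma>)
qed

lemma sum_targets:
  fixes f :: "nat \<Rightarrow> 'a::comm_monoid_add"
  assumes "\<And>w. w < n \<Longrightarrow> t w < n"
  shows "(\<Sum>v<n. \<Sum>w<n. if t w = v then f w else 0) = (\<Sum>w<n. f w)"
  using assms by (subst sum.swap) (auto intro!: sum.cong)

text \<open>The sums of masses and weights are conserved, so the deviations
  \<open>mass - \<rho> * wgt\<close> add up to 0, as \<open>expectation_push_sum\<close> demands.
  Divisibility by \<open>2 ^ (t - j)\<close> makes \<open>div 2\<close> an exact halving.\<close>

lemma halve_contract:
  assumes n: "0 < n" and W: "W * W \<le> 2 ^ b" "X < W" "n * 2 ^ t < W"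
    and X: "X = (\<Sum>v<n. a v) * 2 ^ t" and \<rho>: "\<rho> = real (\<Sum>v<n. a v) / real n"
    and Inv: "Inv = (\<lambda>j \<sigma>. \<exists>x y. \<sigma> = config n (\<lambda>v. (F v)\<lparr>mass := x v, wgt := y v\<rparr>) \<and> (\<Sum>v<n. x v) = X
      \<and> (\<Sum>v<n. y v) = n * 2 ^ t \<and> (\<forall>v<n. 2 ^ (t - j) dvd x v \<and> 2 ^ (t - j) dvd y v))"
    and pot: "pot = (\<lambda>\<sigma>. \<Sum>v<n. (real (mass (\<sigma> v)) - \<rho> * real (wgt (\<sigma> v)))\<^sup>2)"
    and init: "Inv 0 \<sigma>"
  shows "(\<integral>\<^sup>+\<sigma>'. ennreal (pot \<sigma>') \<partial>exec n b (replicate t (halve W)) \<sigma>) \<le> ennreal ((1 / 2) ^ t * pot \<sigma>)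
     \<and> (\<forall>\<sigma>'\<in>set_pmf (exec n b (replicate t (halve W)) \<sigma>). Inv t \<sigma>')"
proof (rule exec_contract[where Inv = Inv, OF _ _ init])
  fix j \<sigma> assume j: "j < t" and I: "Inv j \<sigma>"
  obtain x y where xy: "\<sigma> = config n (\<lambda>v. (F v)\<lparr>mass := x v, wgt := y v\<rparr>)" "(\<Sum>v<n. x v) = X"
      "(\<Sum>v<n. y v) = n * 2 ^ t" "\<forall>v<n. 2 ^ (t - j) dvd x v \<and> 2 ^ (t - j) dvd y v"
    using I unfolding Inv by blast
  have lt: "x v < W" "y v < W" if "v < n" for v
    using member_le_sum[of v "{..<n}" x] member_le_sum[of v "{..<n}" y] that xy W by auto
  have half: "x v = 2 * (x v div 2) \<and> y v = 2 * (y v div 2) \<and>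
      2 ^ (t - Suc j) dvd x v div 2 \<and> 2 ^ (t - Suc j) dvd y v div 2" if v: "v < n" for v
  proof -
    have *: "2 ^ (t - j) = 2 * 2 ^ (t - Suc j)" using j by (metis Suc_diff_Suc power_Suc)
    have "z = 2 * (z div 2) \<and> 2 ^ (t - Suc j) dvd z div 2" if "2 ^ (t - j) dvd z" for z :: nat
      using that unfolding * by (auto elim!: dvdE)
    then show ?thesis using xy(4) v by blast
  qed
  let ?x = "\<lambda>t v. x v div 2 + (\<Sum>w<n. if t w = v then x w div 2 else 0)"
  let ?y = "\<lambda>t v. y v div 2 + (\<Sum>w<n. if t w = v then y w div 2 else 0)"
  have st: "step n b (halve W) \<sigma> = map_pmf (\<lambda>t. config n (\<lambda>v. (F v)\<lparr>mass := ?x t v, wgt := ?y t v\<rparr>)) (uniform_targets n)"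
    by (rule step_halve[OF n W(1) xy(1)]) (use lt in auto)
  show "Inv (Suc j) \<sigma>'" if s': "\<sigma>' \<in> set_pmf (step n b (halve W) \<sigma>)" for \<sigma>'
  proof -
    obtain u where u: "u \<in> set_pmf (uniform_targets n)" "\<sigma>' = config n (\<lambda>v. (F v)\<lparr>mass := ?x u v, wgt := ?y u v\<rparr>)"
      using s' unfolding st set_map_pmf by blast
    have un: "u w < n" if "w < n" for w using set_uniform_targets[OF n u(1) that] .
    have tw: "(\<Sum>v<n. z v div 2) + (\<Sum>v<n. z v div 2) = (\<Sum>v<n. z v)" if "\<And>v. v < n \<Longrightarrow> z v = 2 * (z v div 2)" for z :: "nat \<Rightarrow> nat"
    proof -
      have "(\<Sum>v<n. z v) = (\<Sum>v<n. 2 * (z v div 2))" using that by (intro sum.cong) auto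
      then show ?thesis by (simp flip: sum_distrib_left)
    qed
    have sx: "(\<Sum>v<n. ?x u v) = X"
      using half un tw[of x] by (simp add: sum.distrib sum_targets xy(2))
    have sy: "(\<Sum>v<n. ?y u v) = n * 2 ^ t"
      using half un tw[of y] by (simp add: sum.distrib sum_targets xy(3))
    have dv: "2 ^ (t - Suc j) dvd ?x u v \<and> 2 ^ (t - Suc j) dvd ?y u v" if "v < n" for v
      using half that by (intro conjI dvd_add dvd_sum) auto
    show ?thesis unfolding Inv using sx sy dv u(2)
      by (intro exI[of _ "?x u"] exI[of _ "?y u"]) auto
  qed
  let ?z = "\<lambda>v. real (x v) - \<rho> * real (y v)"
  have z0: "(\<Sum>v<n. ?z v) = 0"
  proof -
    have "(\<Sum>v<n. ?z v) = real (\<Sum>v<n. x v) - \<rho> * real (\<Sum>v<n. y v)"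
      by (simp add: sum_subtractf sum_distrib_left)
    also have "\<dots> = 0" unfolding xy X \<rho> using n by simp
    finally show ?thesis .
  qed
  have "(\<integral>\<^sup>+\<sigma>'. ennreal (pot \<sigma>') \<partial>step n b (halve W) \<sigma>)
     = (\<integral>\<^sup>+u. ennreal (\<Sum>v<n. (?z v / 2 + (\<Sum>w<n. if u w = v then ?z w / 2 else 0))\<^sup>2) \<partial>uniform_targets n)"
    unfolding st nn_integral_map_pmf
  proof (intro nn_integral_cong arg_cong[where f = ennreal])
    fix u
    have r: "real (x v div 2) = real (x v) / 2" "real (y v div 2) = real (y v) / 2" if "v < n" for v
      using half[OF that] by (metis nonzero_mult_div_cancel_left of_nat_mult of_nat_numeral zero_neq_numeral)+
    have "real (?x u v) - \<rho> * real (?y u v) = ?z v / 2 + (\<Sum>w<n. if u w = v then ?z w / 2 else 0)" if v: "v < n" for v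
    proof -
      have "real (?x u v) - \<rho> * real (?y u v) = real (x v) / 2 - \<rho> * (real (y v) / 2)
         + (\<Sum>w<n. real (if u w = v then x w div 2 else 0) - \<rho> * real (if u w = v then y w div 2 else 0))"
        by (simp only: of_nat_add of_nat_sum r[OF v] sum_subtractf sum_distrib_left[symmetric] distrib_left
              add_diff_add)
      also have "(\<Sum>w<n. real (if u w = v then x w div 2 else 0) - \<rho> * real (if u w = v then y w div 2 else 0))
         = (\<Sum>w<n. if u w = v then ?z w / 2 else 0)"
        using r by (intro sum.cong refl) (auto simp: field_simps)
      finally show ?thesis by (simp add: field_simps)
    qed
    then show "pot (config n (\<lambda>v. (F v)\<lparr>mass := ?x u v, wgt := ?y u v\<rparr>))
       = (\<Sum>v<n. (?z v / 2 + (\<Sum>w<n. if u w = v then ?z w / 2 else 0))\<^sup>2)"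
      unfolding pot by (intro sum.cong refl) simp
  qed
  also have "\<dots> = ennreal (E n (\<lambda>u. \<Sum>v<n. (?z v / 2 + (\<Sum>w<n. if u w = v then ?z w / 2 else 0))\<^sup>2))"
    using n by (intro nn_integral_eq_expectation finite_uniform_targets) (auto intro!: sum_nonneg)
  also have "\<dots> \<le> ennreal (1 / 2 * (\<Sum>v<n. (?z v)\<^sup>2))"
    by (intro ennreal_leI expectation_push_sum[OF n z0])
  also have "(\<Sum>v<n. (?z v)\<^sup>2) = pot \<sigma>"
    unfolding pot xy(1) by (intro sum.cong refl) simp
  finally show "(\<integral>\<^sup>+\<sigma>'. ennreal (pot \<sigma>') \<partial>step n b (halve W) \<sigma>) \<le> ennreal (1 / 2 * pot \<sigma>)" .
qed simp

text \<open>The largest weight is at least the average \<open>2 ^ t\<close>. Hence a deviation below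
  \<open>2 ^ t / (2 n)\<close> is small relative to that weight, and
  \<open>n * mass / weight\<close> lies within \<open>1/2\<close> of \<open>S\<close>.\<close>

lemma ratio_at_max_weight:
  fixes x y :: "nat \<Rightarrow> nat"
  assumes n: "0 < n" and xW: "\<And>v. v < n \<Longrightarrow> x v < W" and sy: "(\<Sum>v<n. y v) = n * 2 ^ t"
    and pot: "(\<Sum>v<n. (real (x v) - real S / real n * real (y v))\<^sup>2) < (2 ^ t / (2 * real n))\<^sup>2"
    and K: "K = Max ((\<lambda>v. y v * W + x v) ` {..<n})"
  shows "nat (round (real n * real (K mod W) / real (K div W))) = S"
proof -
  have "K \<in> (\<lambda>v. y v * W + x v) ` {..<n}"
    unfolding K using n by (intro Max_in) (simp_all add: lessThan_nonempty)
  then obtain v where v: "v < n" "K = y v * W + x v" by auto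
  have KW: "K mod W = x v" "K div W = y v" using xW[OF v(1)] v(2) by auto
  have "y w \<le> y v" if "w < n" for w
  proof -
    have "y w * W + x w \<le> K" unfolding K using that by (intro Max_ge) auto
    then have "(y w * W + x w) div W \<le> K div W" by (rule div_le_mono)
    then show ?thesis using xW[OF that] KW by simp
  qed
  then have "(\<Sum>w<n. y w) \<le> (\<Sum>w<n. y v)" by (intro sum_mono) auto
  then have yv: "2 ^ t \<le> y v" using sy n by simp
  then have yr: "2 ^ t \<le> real (y v)" by (metis of_nat_le_iff of_nat_numeral of_nat_power)
  have "(real (x v) - real S / real n * real (y v))\<^sup>2 \<le> (\<Sum>v<n. (real (x v) - real S / real n * real (y v))\<^sup>2)"
    using v(1) by (intro member_le_sum) auto
  also note pot
  finally have "\<bar>real (x v) - real S / real n * real (y v)\<bar> < 2 ^ t / (2 * real n)"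
    by (metis abs_le_square_iff abs_of_nonneg not_le of_nat_0_le_iff zero_le_divide_iff zero_le_mult_iff zero_le_numeral zero_le_power)
  also have "\<dots> \<le> real (y v) / (2 * real n)" using yr by (intro divide_right_mono) auto
  finally have *: "\<bar>real (x v) - real S / real n * real (y v)\<bar> < real (y v) / (2 * real n)" .
  have y0: "0 < real (y v)" using yr by (meson less_le_trans zero_less_numeral zero_less_power)
  have n0: "0 < real n" using n by simp
  have "real n * real (x v) / real (y v) - real S = (real (x v) - real S / real n * real (y v)) * (real n / real (y v))"
    using y0 n0 by (simp add: field_simps)
  then have "\<bar>real n * real (x v) / real (y v) - real S\<bar> = \<bar>real (x v) - real S / real n * real (y v)\<bar> * (real n / real (y v))"
    using y0 n0 by (simp add: abs_mult)
  also have "\<dots> < real (y v) / (2 * real n) * (real n / real (y v))"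
    using * y0 n0 by (intro mult_strict_right_mono) auto
  also have "\<dots> = 1 / 2" using y0 n0 by simp
  finally have "round (real n * real (x v) / real (y v)) = int S"
    by (intro round_unique') simp
  then show ?thesis by (simp add: KW)
qed

text \<open>The initial potential is at most \<open>n * (2 ^ t * A)^2\<close>, and rounding
  tolerates \<open>(2 ^ t / (2 n))^2\<close>; with the contraction \<open>(1/2)^t\<close> this gives
  \<open>4 n^3 A^2 (1/2)^t\<close>. Broadcasting the key accounts for the fifth unit.\<close>

lemma summ_apx:
  assumes n: "0 < n" and a: "\<And>v. v < n \<Longrightarrow> arg (F v) \<le> A" and A: "1 \<le> A"
    and W: "W * W \<le> 2 ^ b" "n * A * 2 ^ t < W"
  shows "apx (5 * real n ^ 3 * (real A)\<^sup>2 * (1 / 2) ^ t) (exec n b (summ n W t) (config n F))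
     (return_pmf (config n (\<lambda>v. (F v)\<lparr>tot := (\<Sum>w<n. arg (F w)), mass := 0, wgt := 0, key := 0\<rparr>)))"
proof -
  define S where "S = (\<Sum>w<n. arg (F w))"
  define X where "X = S * 2 ^ t"
  define \<rho> where "\<rho> = real S / real n"
  define Inv where "Inv = (\<lambda>j \<sigma>. \<exists>x y. \<sigma> = config n (\<lambda>v. (F v)\<lparr>mass := x v, wgt := y v\<rparr>) \<and> (\<Sum>v<n. x v) = X
      \<and> (\<Sum>v<n. y v) = n * 2 ^ t \<and> (\<forall>v<n. 2 ^ (t - j) dvd x v \<and> 2 ^ (t - j) dvd y v))"
  define pot :: "(nat \<Rightarrow> st) \<Rightarrow> real" where "pot = (\<lambda>\<sigma>. \<Sum>v<n. (real (mass (\<sigma> v)) - \<rho> * real (wgt (\<sigma> v)))\<^sup>2)"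
  let ?\<sigma>0 = "config n (\<lambda>v. (F v)\<lparr>mass := arg (F v) * 2 ^ t, wgt := 2 ^ t\<rparr>)"
  let ?fin = "return_pmf (config n (\<lambda>v. (F v)\<lparr>tot := S, mass := 0, wgt := 0, key := 0\<rparr>))"
  let ?th = "(2 ^ t / (2 * real n))\<^sup>2"
  let ?rest = "loc (\<lambda>s. s\<lparr>key := wgt s * W + mass s\<rparr>) # spread (2 * t)
     @ [loc (\<lambda>s. s\<lparr>tot := nat (round (real n * real (key s mod W) / real (key s div W))), mass := 0, wgt := 0, key := 0\<rparr>)]"
  have SA: "S \<le> n * A" unfolding S_def using sum_mono[of "{..<n}" "\<lambda>v. arg (F v)" "\<lambda>_. A"] a by simp
  have XW: "X < W" unfolding X_def using SA W(2) by (meson le_less_trans mult_le_mono1)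
  have nW: "n * 2 ^ t < W" using W(2) A by (metis le_less_trans mult.right_neutral mult_le_mono1 mult_le_mono2)
  have init: "Inv 0 ?\<sigma>0" unfolding Inv_def
    by (intro exI[of _ "\<lambda>v. arg (F v) * 2 ^ t"] exI[of _ "\<lambda>v. 2 ^ t"]) (auto simp: X_def S_def sum_distrib_right)
  have main: "(\<integral>\<^sup>+\<sigma>'. ennreal (pot \<sigma>') \<partial>exec n b (replicate t (halve W)) ?\<sigma>0) \<le> ennreal ((1 / 2) ^ t * pot ?\<sigma>0)
     \<and> (\<forall>\<sigma>'\<in>set_pmf (exec n b (replicate t (halve W)) ?\<sigma>0). Inv t \<sigma>')"
    by (rule halve_contract[OF n W(1) XW nW X_def[unfolded S_def] \<rho>_def[unfolded S_def] Inv_def pot_def init])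
  have pot0: "pot ?\<sigma>0 \<le> real n * (2 ^ t * real A)\<^sup>2"
  proof -
    have \<rho>A: "0 \<le> \<rho>" "\<rho> \<le> real A"
      using SA n by (simp_all add: \<rho>_def divide_le_eq mult.commute flip: of_nat_mult)
    have "(real (arg (F v) * 2 ^ t) - \<rho> * real (2 ^ t))\<^sup>2 \<le> (2 ^ t * real A)\<^sup>2" if v: "v < n" for v
    proof -
      have "real (arg (F v) * 2 ^ t) - \<rho> * real (2 ^ t) = 2 ^ t * (real (arg (F v)) - \<rho>)" by (simp add: algebra_simps)
      moreover have "\<bar>real (arg (F v)) - \<rho>\<bar> \<le> real A" using a[OF v] \<rho>A by linarith
      ultimately have "\<bar>real (arg (F v) * 2 ^ t) - \<rho> * real (2 ^ t)\<bar> \<le> 2 ^ t * real A" by (simp add: abs_mult)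
      then show ?thesis by (meson abs_ge_zero abs_le_square_iff abs_of_nonneg order_trans power2_le_iff_abs_le)
    qed
    then have "pot ?\<sigma>0 \<le> (\<Sum>v<n. (2 ^ t * real A)\<^sup>2)" unfolding pot_def by (intro sum_mono) simp
    then show ?thesis by simp
  qed
  have "Pr (exec n b (replicate t (halve W)) ?\<sigma>0) {\<sigma>. ?th \<le> pot \<sigma>}
     \<le> (1 / 2) ^ t * (real n * (2 ^ t * real A)\<^sup>2) / ?th"
  proof (rule prob_ge_le_nn_integral)
    have "(1 / 2) ^ t * pot ?\<sigma>0 \<le> (1 / 2) ^ t * (real n * (2 ^ t * real A)\<^sup>2)"
      using pot0 by (intro mult_left_mono) auto
    then show "(\<integral>\<^sup>+\<sigma>'. ennreal (pot \<sigma>') \<partial>exec n b (replicate t (halve W)) ?\<sigma>0)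
        \<le> ennreal ((1 / 2) ^ t * (real n * (2 ^ t * real A)\<^sup>2))"
      using main by (meson ennreal_leI order_trans)
  qed (use n in auto)
  also have "\<dots> = 4 * real n ^ 3 * (real A)\<^sup>2 * (1 / 2) ^ t"
    using n by (simp add: power2_eq_square power3_eq_cube field_simps)
  finally have pr: "Pr (exec n b (replicate t (halve W)) ?\<sigma>0) {\<sigma>. ?th \<le> pot \<sigma>}
     \<le> 4 * real n ^ 3 * (real A)\<^sup>2 * (1 / 2) ^ t" .
  have rest: "apx ((real n)\<^sup>2 * (2 / 3) ^ (2 * t)) (exec n b ?rest \<sigma>) ?fin" if I: "Inv t \<sigma>" and p: "pot \<sigma> < ?th" for \<sigma>
  proof -
    obtain x y where xy: "\<sigma> = config n (\<lambda>v. (F v)\<lparr>mass := x v, wgt := y v\<rparr>)" "(\<Sum>v<n. x v) = X"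
      "(\<Sum>v<n. y v) = n * 2 ^ t"
      using I unfolding Inv_def by blast
    have lt: "x v < W" "y v < W" if "v < n" for v
      using member_le_sum[of v "{..<n}" x] member_le_sum[of v "{..<n}" y] that xy XW nW by auto
    define K where "K = Max ((\<lambda>v. y v * W + x v) ` {..<n})"
    have kb: "y v * W + x v < 2 ^ b" if v: "v < n" for v
    proof -
      have "y v * W + x v < (y v + 1) * W" using lt(1)[OF v] by simp
      also have "\<dots> \<le> W * W" using lt(2)[OF v] by (intro mult_right_mono) auto
      finally show ?thesis using W(1) by linarith
    qed
    have rt: "nat (round (real n * real (K mod W) / real (K div W))) = S"
    proof (rule ratio_at_max_weight[OF n lt(1) xy(3) _ K_def])
      have "pot \<sigma> = (\<Sum>v<n. (real (x v) - real S / real n * real (y v))\<^sup>2)"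
        unfolding pot_def xy(1) \<rho>_def by (intro sum.cong refl) simp
      then show "(\<Sum>v<n. (real (x v) - real S / real n * real (y v))\<^sup>2) < ?th" using p by simp
    qed auto
    let ?G = "\<lambda>v. (F v)\<lparr>mass := x v, wgt := y v, key := y v * W + x v\<rparr>"
    have "apx ((real n)\<^sup>2 * (2 / 3) ^ (2 * t) + 0) (exec n b (spread (2 * t)
     @ [loc (\<lambda>s. s\<lparr>tot := nat (round (real n * real (key s mod W) / real (key s div W))), mass := 0, wgt := 0, key := 0\<rparr>)]) (config n ?G)) ?fin"
    proof (rule apx_exec_append)
      show "apx ((real n)\<^sup>2 * (2 / 3) ^ (2 * t)) (exec n b (spread (2 * t)) (config n ?G))
        (return_pmf (config n (\<lambda>v. (?G v)\<lparr>key := Max ((\<lambda>v. key (?G v)) ` {..<n})\<rparr>)))"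
        by (rule spread_apx[OF n]) (simp add: kb)
    qed (simp_all add: K_def[symmetric] rt apx_refl)
    then show ?thesis by (simp add: xy(1))
  qed
  have h1: "apx (4 * real n ^ 3 * (real A)\<^sup>2 * (1 / 2) ^ t + (real n)\<^sup>2 * (2 / 3) ^ (2 * t))
     (bind_pmf (exec n b (replicate t (halve W)) ?\<sigma>0) (exec n b ?rest)) ?fin"
    by (rule apx_bind_except[OF pr]) (use main rest in auto)
  have h2: "exec n b (summ n W t) (config n F) = bind_pmf (exec n b (replicate t (halve W)) ?\<sigma>0) (exec n b ?rest)"
    unfolding summ_def by (simp only: exec_loc exec_append)
  have h3: "4 * real n ^ 3 * (real A)\<^sup>2 * (1 / 2) ^ t + (real n)\<^sup>2 * (2 / 3) ^ (2 * t) \<le> 5 * real n ^ 3 * (real A)\<^sup>2 * (1 / 2) ^ t"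
  proof -
    have "((2::real) / 3) ^ (2 * t) = (4 / 9) ^ t" by (simp add: power_mult power2_eq_square)
    also have "\<dots> \<le> (1 / 2) ^ t" by (intro power_mono) auto
    finally have 1: "((2::real) / 3) ^ (2 * t) \<le> (1 / 2) ^ t" .
    have "(real n)\<^sup>2 \<le> real n ^ 3 * (real A)\<^sup>2"
    proof -
      have "(real n)\<^sup>2 * 1 \<le> (real n)\<^sup>2 * (real n * (real A)\<^sup>2)"
        using n A by (intro mult_left_mono mult_ge1_I) (auto simp: one_le_power)
      then show ?thesis by (simp add: power2_eq_square power3_eq_cube)
    qed
    with 1 have "(real n)\<^sup>2 * (2 / 3) ^ (2 * t) \<le> real n ^ 3 * (real A)\<^sup>2 * (1 / 2) ^ t"
      by (intro mult_mono) auto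
    then show ?thesis by linarith
  qed
  show ?thesis unfolding h2 S_def[symmetric] by (rule apx_mono[OF h1 h3])
qed

section \<open>Throwing tokens\<close>

text \<open>The tag \<open>l\<close> keeps the blocks apart within a single inbox.\<close>

definition throw_rule :: "(st \<Rightarrow> nat option) \<Rightarrow> nat \<Rightarrow> st rule" where
  "throw_rule f l = Push_rule f (\<lambda>s M. s\<lparr>inbox := inbox s + image_mset (\<lambda>x. prod_encode (l, x)) M\<rparr>)"

text \<open>A node pushes only one message per round, so its tokens leave one slot after the
  other.\<close>

definition throw :: "(nat \<Rightarrow> st \<Rightarrow> nat option) \<Rightarrow> nat \<Rightarrow> nat \<Rightarrow> st rule list" where
  "throw sl l Q = concat (map (\<lambda>s. [throw_rule (sl s) l]) [0..<Q])"

definition targets_seq :: "nat \<Rightarrow> nat \<Rightarrow> (nat \<Rightarrow> nat \<Rightarrow> nat) pmf" where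
  "targets_seq n Q = Pi_pmf {..<Q} undefined (\<lambda>_. uniform_targets n)"

definition received :: "nat \<Rightarrow> (nat \<Rightarrow> nat \<Rightarrow> nat option) \<Rightarrow> nat \<Rightarrow> (nat \<Rightarrow> nat \<Rightarrow> nat) \<Rightarrow> nat \<Rightarrow> nat multiset" where
  "received n tok Q \<tau> v = (\<Sum>s<Q. \<Sum>w<n. if \<tau> s w = v then opt_mset (tok s w) else {#})"

text \<open>For phases whose only effect is to add an independent increment to an accumulator. It is
  used twice: for the rounds of a block and for the blocks of a sample.\<close>

lemma exec_accumulate:
  fixes cf :: "(nat \<Rightarrow> nat multiset) \<Rightarrow> nat \<Rightarrow> 's"
  assumes step: "\<And>j acc. j < m \<Longrightarrow> exec n b (P j) (cf acc) = map_pmf (\<lambda>\<omega>. cf (\<lambda>v. acc v + inc j \<omega> v)) D"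
  shows "exec n b (concat (map P [0..<m])) (cf acc)
    = map_pmf (\<lambda>\<omega>. cf (\<lambda>v. acc v + (\<Sum>j<m. inc j (\<omega> j) v))) (Pi_pmf {..<m} undefined (\<lambda>_. D))"
  using step
proof (induction m)
  case 0
  then show ?case by simp
next
  case (Suc m)
  let ?P = "Pi_pmf {..<m} undefined (\<lambda>_. D)"
  have "exec n b (concat (map P [0..<Suc m])) (cf acc)
     = bind_pmf (exec n b (concat (map P [0..<m])) (cf acc)) (exec n b (P m))"
    by (simp add: exec_append)
  also have "\<dots> = bind_pmf ?P (\<lambda>\<omega>. map_pmf (\<lambda>y. cf (\<lambda>v. acc v + (\<Sum>j<m. inc j (\<omega> j) v) + inc m y v)) D)"
    using Suc.IH Suc.prems by (simp add: bind_map_pmf)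
  also have "\<dots> = bind_pmf D (\<lambda>y. map_pmf (\<lambda>\<omega>. cf (\<lambda>v. acc v + (\<Sum>j<m. inc j (\<omega> j) v) + inc m y v)) ?P)"
    unfolding map_pmf_def by (rule bind_commute_pmf)
  also have "\<dots> = map_pmf (\<lambda>\<omega>. cf (\<lambda>v. acc v + (\<Sum>j<Suc m. inc j (\<omega> j) v))) (Pi_pmf {..<Suc m} undefined (\<lambda>_. D))"
  proof -
    have "(\<Sum>j<m. inc j (fun_upd \<omega> m y j) v) = (\<Sum>j<m. inc j (\<omega> j) v)" for \<omega> y v
      by (intro sum.cong) auto
    then show ?thesis
      by (simp add: lessThan_Suc Pi_pmf_insert' map_bind_pmf add.assoc add.commute[of "inc m _ _"])
         (simp add: map_pmf_def bind_assoc_pmf bind_return_pmf add.commute add.left_commute)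
  qed
  finally show ?case .
qed

text \<open>The slots do not read the inbox, so what is thrown is fixed before the first
  round.\<close>

lemma exec_throw:
  assumes sl: "\<And>s st M. sl s (st\<lparr>inbox := M\<rparr>) = sl s st"
    and bd: "\<And>s w x. s < Q \<Longrightarrow> w < n \<Longrightarrow> sl s (F w) = Some x \<Longrightarrow> x < 2 ^ b"
  shows "exec n b (throw sl l Q) (config n (\<lambda>v. (F v)\<lparr>inbox := acc v\<rparr>))
     = map_pmf (\<lambda>\<tau>. config n (\<lambda>v. (F v)\<lparr>inbox := acc v +
         image_mset (\<lambda>x. prod_encode (l, x)) (received n (\<lambda>s w. sl s (F w)) Q \<tau> v)\<rparr>)) (targets_seq n Q)"
proof -
  define inc :: "nat \<Rightarrow> (nat \<Rightarrow> nat) \<Rightarrow> nat \<Rightarrow> nat multiset" where "inc = (\<lambda>s t v. \<Sum>w<n. if t w = v then image_mset (\<lambda>x. prod_encode (l, x)) (opt_mset (sl s (F w))) else {#})"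
  define cf where "cf = (\<lambda>acc. config n (\<lambda>v. (F v)\<lparr>inbox := acc v\<rparr>))"
  have step: "exec n b [throw_rule (sl s) l] (cf acc) = map_pmf (\<lambda>t. cf (\<lambda>v. acc v + inc s t v)) (uniform_targets n)"
    if s: "s < Q" for s acc
  proof -
    have "exec n b [] = (return_pmf :: (nat \<Rightarrow> st) \<Rightarrow> _)" by (rule ext) simp
    then have "exec n b [throw_rule (sl s) l] (cf acc) = step n b (throw_rule (sl s) l) (cf acc)"
      by (simp add: exec.simps(2) bind_return_pmf')
    also have "\<dots> = map_pmf (\<lambda>t. cf (\<lambda>v. acc v + inc s t v)) (uniform_targets n)"
      unfolding throw_rule_def step.simps cf_def
    proof (rule map_pmf_cong[OF refl], rule config_cong)
      fix t v assume v: "v < n"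
      have "image_mset (\<lambda>x. prod_encode (l, x)) (\<Sum>w<n. if t w = v then image_mset (take_bit b)
           (opt_mset (sl s (config n (\<lambda>v. (F v)\<lparr>inbox := acc v\<rparr>) w))) else {#}) = inc s t v"
        unfolding image_mset_sum_set inc_def
      proof (intro sum.cong refl)
        fix w assume w: "w \<in> {..<n}"
        show "image_mset (\<lambda>x. prod_encode (l, x)) (if t w = v then image_mset (take_bit b)
           (opt_mset (sl s (config n (\<lambda>v. (F v)\<lparr>inbox := acc v\<rparr>) w))) else {#})
          = (if t w = v then image_mset (\<lambda>x. prod_encode (l, x)) (opt_mset (sl s (F w))) else {#})"
          using w bd[OF s, of w] by (cases "sl s (F w)") (auto simp: sl opt_mset_def take_bit_nat_eq_self)
      qed
      then show "config n (\<lambda>v. (F v)\<lparr>inbox := acc v\<rparr>) v\<lparr>inbox := inbox (config n (\<lambda>v. (F v)\<lparr>inbox := acc v\<rparr>) v)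
        + image_mset (\<lambda>x. prod_encode (l, x)) (\<Sum>w<n. if t w = v then image_mset (take_bit b)
           (opt_mset (sl s (config n (\<lambda>v. (F v)\<lparr>inbox := acc v\<rparr>) w))) else {#})\<rparr> = (F v)\<lparr>inbox := acc v + inc s t v\<rparr>"
        using v by simp
    qed
    finally show ?thesis .
  qed
  have "(\<Sum>s<Q. inc s (\<tau> s) v) = image_mset (\<lambda>x. prod_encode (l, x)) (received n (\<lambda>s w. sl s (F w)) Q \<tau> v)" for \<tau> v
    unfolding received_def image_mset_sum_set inc_def by (intro sum.cong refl) auto
  then show ?thesis
    using exec_accumulate[where P = "\<lambda>s. [throw_rule (sl s) l]" and cf = cf and m = Q, OF step]
    by (simp add: throw_def cf_def targets_seq_def)
qed

lemma exec_throw_blocks: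
  assumes sl: "\<And>s st M. sl s (st\<lparr>inbox := M\<rparr>) = sl s st"
    and bd: "\<And>s w x. s < Q \<Longrightarrow> w < n \<Longrightarrow> sl s (F w) = Some x \<Longrightarrow> x < 2 ^ b"
  shows "exec n b (concat (map (\<lambda>l. throw sl l Q) [0..<k])) (config n (\<lambda>v. (F v)\<lparr>inbox := acc v\<rparr>))
     = map_pmf (\<lambda>\<beta>. config n (\<lambda>v. (F v)\<lparr>inbox := acc v +
         (\<Sum>l<k. image_mset (\<lambda>x. prod_encode (l, x)) (received n (\<lambda>s w. sl s (F w)) Q (\<beta> l) v))\<rparr>))
       (Pi_pmf {..<k} undefined (\<lambda>_. targets_seq n Q))"
  by (rule exec_accumulate[where cf = "\<lambda>acc. config n (\<lambda>v. (F v)\<lparr>inbox := acc v\<rparr>)"])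
     (rule exec_throw[OF sl bd])

lemma set_targets_seq:
  assumes "0 < n" "\<tau> \<in> set_pmf (targets_seq n Q)" "s < Q" "w < n"
  shows "\<tau> s w < n"
proof -
  have "\<tau> s \<in> set_pmf (uniform_targets n)"
    using assms(2,3) unfolding targets_seq_def by (auto simp: set_Pi_pmf PiE_dflt_def)
  then show ?thesis using set_uniform_targets[OF assms(1) _ assms(4)] by blast
qed

lemma finite_targets_seq: "0 < n \<Longrightarrow> finite (set_pmf (targets_seq n Q))"
  unfolding targets_seq_def by (intro finite_set_pmf_Pi) (auto simp: finite_uniform_targets)

lemma sum_received:
  assumes "0 < n" "\<tau> \<in> set_pmf (targets_seq n Q)"
  shows "(\<Sum>v<n. received n tok Q \<tau> v) = (\<Sum>s<Q. \<Sum>w<n. opt_mset (tok s w))"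
proof -
  have "(\<Sum>v<n. received n tok Q \<tau> v) = (\<Sum>s<Q. \<Sum>v<n. \<Sum>w<n. if \<tau> s w = v then opt_mset (tok s w) else {#})"
    unfolding received_def by (rule sum.swap)
  also have "\<dots> = (\<Sum>s<Q. \<Sum>w<n. opt_mset (tok s w))"
    using set_targets_seq[OF assms] by (intro sum.cong refl sum_targets) auto
  finally show ?thesis .
qed

lemma size_sum_set: "size (sum g A) = (\<Sum>x\<in>A. size (g x))" for g :: "'a \<Rightarrow> 'b multiset"
  by (induction A rule: infinite_finite_induct) auto

text \<open>An exponential moment in base 2: each token doubles \<open>2 ^ load\<close> with
  probability \<open>1 / n\<close>, so at most \<open>n\<close> tokens give
  \<open>(1 + 1/n)^n <= e <= 3\<close>, and Markov's inequality applies.\<close>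

lemma load_bound:
  assumes n: "0 < n" and v: "v < n" and act: "(\<Sum>s<Q. \<Sum>w<n. size (opt_mset (tok s w))) \<le> n"
  shows "Pr (targets_seq n Q) {\<tau>. g < size (received n tok Q \<tau> v)} \<le> 3 * (1 / 2) ^ g"
proof -
  define c where "c = (\<lambda>s w. size (opt_mset (tok s w)))"
  have c01: "c s w = 0 \<or> c s w = 1" for s w by (auto simp: c_def opt_mset_def split: option.split)
  define f where "f = (\<lambda>s w x. if x = v then 2 ^ c s w else 1 :: real)"
  have size: "2 ^ size (received n tok Q \<tau> v) = (\<Prod>s<Q. \<Prod>w<n. f s w (\<tau> s w))" for \<tau>
  proof -
    have "size (received n tok Q \<tau> v) = (\<Sum>s<Q. \<Sum>w<n. if \<tau> s w = v then c s w else 0)"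
      unfolding received_def size_sum_set c_def by (intro sum.cong refl) auto
    then show ?thesis by (simp add: power_sum f_def if_distrib[of "\<lambda>x. 2 ^ x"] cong: if_cong)
  qed
  have one: "(\<integral>\<^sup>+x. ennreal (f s w x) \<partial>pmf_of_set {..<n}) = ennreal ((1 + 1 / real n) ^ c s w)" for s w
  proof -
    have "(\<integral>\<^sup>+x. ennreal (f s w x) \<partial>pmf_of_set {..<n}) = ennreal (expect (pmf_of_set {..<n}) (f s w))"
      using n by (intro nn_integral_eq_expectation) (auto simp: set_pmf_of_set lessThan_nonempty f_def)
    also have "expect (pmf_of_set {..<n}) (f s w) = (\<Sum>x<n. f s w x) / real n"
      using n by (rule expectation_pmf_of_lessThan)
    also have "(\<Sum>x<n. f s w x) = (\<Sum>x<n. 1 + (if x = v then 2 ^ c s w - 1 else 0))"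
      by (intro sum.cong) (auto simp: f_def)
    also have "\<dots> = real n + (2 ^ c s w - 1)" using v by (simp add: sum.distrib)
    also have "\<dots> / real n = (1 + 1 / real n) ^ c s w" using c01[of s w] n by (auto simp: field_simps)
    finally show ?thesis .
  qed
  have "(\<integral>\<^sup>+\<tau>. ennreal (2 ^ size (received n tok Q \<tau> v)) \<partial>targets_seq n Q)
      = (\<integral>\<^sup>+\<tau>. (\<Prod>s<Q. \<Prod>w<n. ennreal (f s w (\<tau> s w))) \<partial>targets_seq n Q)"
    unfolding size by (simp add: prod_ennreal f_def prod_nonneg)
  also have "\<dots> = (\<Prod>s<Q. \<Prod>w<n. \<integral>\<^sup>+x. ennreal (f s w x) \<partial>pmf_of_set {..<n})"
    unfolding targets_seq_def uniform_targets_def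
    by (subst nn_integral_prod_Pi_pmf, simp) (intro prod.cong refl nn_integral_prod_Pi_pmf, simp)
  also have "\<dots> = (\<Prod>s<Q. \<Prod>w<n. ennreal ((1 + 1 / real n) ^ c s w))"
    by (simp only: one)
  also have "\<dots> = ennreal ((1 + 1 / real n) ^ (\<Sum>s<Q. \<Sum>w<n. c s w))"
    by (simp add: prod_ennreal power_sum prod_nonneg)
  also have "\<dots> \<le> ennreal 3"
  proof (rule ennreal_leI)
    have "(1 + 1 / real n) ^ (\<Sum>s<Q. \<Sum>w<n. c s w) \<le> (1 + 1 / real n) ^ n"
      using act unfolding c_def by (intro power_increasing) auto
    also have "\<dots> \<le> exp (1 / real n) ^ n"
      by (intro power_mono exp_ge_add_one_self) auto
    also have "\<dots> = exp 1" using n by (simp flip: exp_of_nat_mult)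
    finally show "(1 + 1 / real n) ^ (\<Sum>s<Q. \<Sum>w<n. c s w) \<le> 3" using exp_le by linarith
  qed
  finally have "Pr (targets_seq n Q) {\<tau>. 2 ^ g \<le> (2::real) ^ size (received n tok Q \<tau> v)} \<le> 3 / 2 ^ g"
    by (rule prob_ge_le_nn_integral) auto
  moreover have "Pr (targets_seq n Q) {\<tau>. g < size (received n tok Q \<tau> v)}
     \<le> Pr (targets_seq n Q) {\<tau>. 2 ^ g \<le> (2::real) ^ size (received n tok Q \<tau> v)}"
    by (intro measure_pmf.finite_measure_mono) (auto intro: power_increasing)
  ultimately have "Pr (targets_seq n Q) {\<tau>. g < size (received n tok Q \<tau> v)} \<le> 3 / 2 ^ g"
    by linarith
  then show ?thesis by (simp add: power_one_over)
qed

section \<open>Replicating the values\<close>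

primrec copies :: "nat \<Rightarrow> nat \<Rightarrow> nat \<Rightarrow> nat" where
  "copies n m 0 = 1"
| "copies n m (Suc j) = (if 2 * copies n m j * m \<le> n then 2 * copies n m j else copies n m j)"

lemma copies_le: "m \<le> n \<Longrightarrow> copies n m j * m \<le> n"
  by (induction j) auto

text \<open>Either no doubling was refused and the count is \<open>2 ^ j\<close>, or one was
  refused, after which the count stays put.\<close>

lemma copies_gt:
  assumes "0 < m" "n < 2 * 2 ^ j"
  shows "n < 2 * copies n m j * m"
proof -
  have "copies n m j = 2 ^ j \<or> n < 2 * copies n m j * m" by (induction j) auto
  moreover have "2 * 2 ^ j \<le> 2 * 2 ^ j * m" using assms(1) by simp
  ultimately show ?thesis using assms(2) by (metis less_le_trans)
qed

text \<open>Slots \<open>2 i\<close> and \<open>2 i + 1\<close> both carry the token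
  \<open>home ! i\<close>; the original is discarded, so both copies land on random nodes.\<close>

definition dbl_slot :: "nat \<Rightarrow> nat \<Rightarrow> nat \<Rightarrow> st \<Rightarrow> nat option" where
  "dbl_slot n j s q = (if 2 * copies n (cnt q) j * cnt q \<le> n \<and> s div 2 < length (home q) then Some (home q ! (s div 2)) else None)"

definition dbl_phase :: "nat \<Rightarrow> nat \<Rightarrow> nat \<Rightarrow> st rule list" where
  "dbl_phase n g j = throw (dbl_slot n j) 0 (2 * g) @ [loc (\<lambda>s. s\<lparr>
      home := if 2 * copies n (cnt s) j * cnt s \<le> n
        then map (\<lambda>x. snd (prod_decode x)) (sorted_list_of_multiset (inbox s)) else home s, inbox := {#}\<rparr>)]"

text \<open>The resting state between phases: all scratch fields are cleared, so that a
  configuration is determined by the data listed here.\<close>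

definition st0 :: "nat option \<Rightarrow> nat list \<Rightarrow> nat \<Rightarrow> (nat \<times> nat) list \<Rightarrow> st" where
  "st0 i h m z = \<lparr>inp = i, home = h, cnt = m, outs = z, arg = 0, key = 0, mass = 0, wgt = 0, inbox = {#}, chosen = 0, tot = 0, saved = 0\<rparr>"

abbreviation (input) base :: "nat \<Rightarrow> (nat \<Rightarrow> nat option) \<Rightarrow> (nat \<Rightarrow> nat list) \<Rightarrow> nat \<Rightarrow> (nat \<times> nat) list \<Rightarrow> nat \<Rightarrow> st" where
  "base n val h m z \<equiv> config n (\<lambda>v. st0 (val v) (h v) m z)"

definition tokens :: "nat \<Rightarrow> (nat \<Rightarrow> nat option) \<Rightarrow> nat multiset" where
  "tokens n val = (\<Sum>v<n. opt_mset (val v))"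

text \<open>The bound \<open>g\<close> on the load matters because a node has slots for only
  \<open>g\<close> of its tokens.\<close>

definition spread_out :: "nat \<Rightarrow> nat \<Rightarrow> nat \<Rightarrow> (nat \<Rightarrow> nat option) \<Rightarrow> (nat \<Rightarrow> nat list) \<Rightarrow> bool" where
  "spread_out n g r val h \<longleftrightarrow> (\<Sum>v<n. mset (h v)) = repeat_mset r (tokens n val) \<and> (\<forall>v<n. length (h v) \<le> g)"

lemma in_repeat_mset: "x \<in># repeat_mset r M \<Longrightarrow> x \<in># M"
  by (induction r) auto

lemma size_tokens: "size (repeat_mset r M) = r * size M"
  by (induction r) auto

lemma sum_slots:
  assumes "length xs \<le> g"
  shows "(\<Sum>s<g. opt_mset (if s < length xs then Some (xs ! s) else None)) = mset xs"
proof -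
  have "(\<Sum>s<g. opt_mset (if s < length xs then Some (xs ! s) else None))
     = (\<Sum>s<length xs. opt_mset (if s < length xs then Some (xs ! s) else None))"
    using assms by (intro sum.mono_neutral_right) (auto simp: opt_mset_def)
  also have "\<dots> = (\<Sum>s<length xs. {#xs ! s#})" by (intro sum.cong) (auto simp: opt_mset_def)
  also have "\<dots> = mset xs"
    by (induction xs rule: rev_induct) (auto simp: nth_append)
  finally show ?thesis .
qed

lemma sum_half: "(\<Sum>s<2 * g. f (s div 2)) = (\<Sum>s<g. f s + f s)" for f :: "nat \<Rightarrow> 'a::comm_monoid_add"
  by (induction g) (auto simp: add.assoc)

lemma mset_decode_sorted:
  "mset (map (\<lambda>x. snd (prod_decode x)) (sorted_list_of_multiset (image_mset (\<lambda>x. prod_encode (l, x)) M))) = M"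
  by (simp add: image_mset.compositionality comp_def)

text \<open>While doubling goes on, at most \<open>n\<close> tokens are in flight, so
  \<open>load_bound\<close> and a union bound over the nodes apply. Once it has stopped, nothing is
  thrown and the phase leaves the configuration as it is.\<close>

lemma dbl_phase_prob:
  assumes n: "0 < n" and h: "spread_out n g (copies n m j) val h" and m: "m = size (tokens n val)"
    and bd: "\<And>x. x \<in># tokens n val \<Longrightarrow> x < 2 ^ b"
  shows "Pr (exec n b (dbl_phase n g j) (base n val h m z))
     {\<sigma>. \<not> (\<exists>h'. spread_out n g (copies n m (Suc j)) val h' \<and> \<sigma> = base n val h' m z)}
     \<le> real n * (3 * (1 / 2) ^ g)"
proof -
  let ?D = "2 * copies n m j * m \<le> n"
  let ?F = "\<lambda>v. st0 (val v) (h v) m z"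
  let ?tok = "\<lambda>s w. dbl_slot n j s (?F w)"
  define h' where "h' = (\<lambda>\<tau> v. if ?D then map (\<lambda>x. snd (prod_decode x))
     (sorted_list_of_multiset (image_mset (\<lambda>x. prod_encode (0, x)) (received n ?tok (2 * g) \<tau> v))) else h v)"
  have inh: "x \<in># tokens n val" if "w < n" "x \<in> set (h w)" for x w
  proof -
    have "x \<in># (\<Sum>v<n. mset (h v))" using that by (auto simp: set_mset_sum)
    then show ?thesis using h by (auto simp: spread_out_def dest: in_repeat_mset)
  qed
  have F: "?F v = (?F v)\<lparr>inbox := (\<lambda>_. {#}) v\<rparr>" for v by (simp add: st0_def)
  have ex: "exec n b (dbl_phase n g j) (config n ?F) = map_pmf (\<lambda>\<tau>. config n (\<lambda>v. st0 (val v) (h' \<tau> v) m z)) (targets_seq n (2 * g))"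
  proof -
    define upd where "upd = (\<lambda>s::st. s\<lparr>home := if 2 * copies n (cnt s) j * cnt s \<le> n
        then map (\<lambda>x. snd (prod_decode x)) (sorted_list_of_multiset (inbox s)) else home s, inbox := {#}\<rparr>)"
    have "exec n b (throw (dbl_slot n j) 0 (2 * g)) (config n ?F)
       = map_pmf (\<lambda>\<tau>. config n (\<lambda>v. (?F v)\<lparr>inbox := {#} + image_mset (\<lambda>x. prod_encode (0, x))
           (received n ?tok (2 * g) \<tau> v)\<rparr>)) (targets_seq n (2 * g))"
    proof (subst F, rule exec_throw)
      fix s w x assume "s < 2 * g" "w < n" "dbl_slot n j s (?F w) = Some x"
      then have "x \<in> set (h w)" by (auto simp: dbl_slot_def st0_def split: if_splits)
      then show "x < 2 ^ b" using bd inh \<open>w < n\<close> by blast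
    qed (simp add: dbl_slot_def)
    then have "exec n b (dbl_phase n g j) (config n ?F) = map_pmf (\<lambda>\<tau>. config n (\<lambda>v. upd ((?F v)\<lparr>inbox := {#} +
        image_mset (\<lambda>x. prod_encode (0, x)) (received n ?tok (2 * g) \<tau> v)\<rparr>))) (targets_seq n (2 * g))"
      unfolding dbl_phase_def upd_def[symmetric] exec_append by (simp add: map_pmf_def bind_assoc_pmf bind_return_pmf)
    also have "\<dots> = map_pmf (\<lambda>\<tau>. config n (\<lambda>v. st0 (val v) (h' \<tau> v) m z)) (targets_seq n (2 * g))"
      by (intro map_pmf_cong refl config_cong) (cases ?D; simp add: upd_def st0_def h'_def)
    finally show ?thesis .
  qed
  have tok: "(\<Sum>s<2 * g. \<Sum>w<n. opt_mset (?tok s w)) = repeat_mset (2 * copies n m j) (tokens n val)" if D: ?D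
  proof -
    have "(\<Sum>s<2 * g. \<Sum>w<n. opt_mset (?tok s w))
       = (\<Sum>w<n. \<Sum>s<2 * g. opt_mset (if s div 2 < length (h w) then Some (h w ! (s div 2)) else None))"
      using D by (subst sum.swap) (simp add: dbl_slot_def st0_def cong: if_cong)
    also have "\<dots> = (\<Sum>w<n. mset (h w) + mset (h w))"
      using h by (intro sum.cong refl, subst sum_half[of "\<lambda>s. opt_mset (if s < length (h _) then Some (h _ ! s) else None)"])
        (simp add: sum.distrib sum_slots spread_out_def)
    also have "\<dots> = repeat_mset (2 * copies n m j) (tokens n val)"
      using h by (simp add: sum.distrib spread_out_def mult_2)
    finally show ?thesis .
  qed
  have good: "spread_out n g (copies n m (Suc j)) val (h' \<tau>)"
    if \<tau>: "\<tau> \<in> set_pmf (targets_seq n (2 * g))" and ld: "\<And>v. v < n \<Longrightarrow> size (received n ?tok (2 * g) \<tau> v) \<le> g" for \<tau>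
  proof (cases ?D)
    case True
    then have "mset (h' \<tau> v) = received n ?tok (2 * g) \<tau> v" for v
      unfolding h'_def by (simp only: if_True mset_decode_sorted)
    moreover from this have "length (h' \<tau> v) = size (received n ?tok (2 * g) \<tau> v)" for v
      by (metis size_mset)
    ultimately show ?thesis
      using True ld sum_received[OF n \<tau>, of ?tok] tok by (simp add: spread_out_def)
  next
    case False
    then show ?thesis using h by (simp add: h'_def)
  qed
  have "Pr (exec n b (dbl_phase n g j) (config n ?F))
     {\<sigma>. \<not> (\<exists>h'. spread_out n g (copies n m (Suc j)) val h' \<and> \<sigma> = base n val h' m z)}
     = Pr (targets_seq n (2 * g)) {\<tau>. \<not> (\<exists>h''. spread_out n g (copies n m (Suc j)) val h''
         \<and> config n (\<lambda>v. st0 (val v) (h' \<tau> v) m z) = base n val h'' m z)}"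
    unfolding ex by (simp add: vimage_def)
  also have "\<dots> \<le> real n * (3 * (1 / 2) ^ g)"
  proof (cases ?D)
    case True
    have act: "(\<Sum>s<2 * g. \<Sum>w<n. size (opt_mset (?tok s w))) \<le> n"
    proof -
      have "(\<Sum>s<2 * g. \<Sum>w<n. size (opt_mset (?tok s w))) = size (\<Sum>s<2 * g. \<Sum>w<n. opt_mset (?tok s w))"
        by (simp add: size_sum_set)
      also have "\<dots> = 2 * copies n m j * m" unfolding tok[OF True] by (simp only: size_tokens m)
      finally show ?thesis using True by simp
    qed
    have "Pr (targets_seq n (2 * g)) {\<tau>. \<not> (\<exists>h''. spread_out n g (copies n m (Suc j)) val h''
         \<and> config n (\<lambda>v. st0 (val v) (h' \<tau> v) m z) = base n val h'' m z)}
      \<le> Pr (targets_seq n (2 * g)) (\<Union>v<n. {\<tau>. g < size (received n ?tok (2 * g) \<tau> v)})"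
    proof (rule prob_mono_support)
      fix \<tau> assume \<tau>: "\<tau> \<in> set_pmf (targets_seq n (2 * g))"
        and bad: "\<tau> \<in> {\<tau>. \<not> (\<exists>h''. spread_out n g (copies n m (Suc j)) val h''
         \<and> config n (\<lambda>v. st0 (val v) (h' \<tau> v) m z) = base n val h'' m z)}"
      show "\<tau> \<in> (\<Union>v<n. {\<tau>. g < size (received n ?tok (2 * g) \<tau> v)})"
        using good[OF \<tau>] bad by (force simp: not_less)
    qed
    also have "\<dots> \<le> (\<Sum>v<n. Pr (targets_seq n (2 * g)) {\<tau>. g < size (received n ?tok (2 * g) \<tau> v)})"
      by (rule measure_pmf.finite_measure_subadditive_finite) auto
    also have "\<dots> \<le> (\<Sum>v<n. 3 * (1 / 2) ^ g)"
      by (intro sum_mono load_bound n act) auto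
    finally show ?thesis by simp
  next
    case False
    then have "spread_out n g (copies n m (Suc j)) val (h' \<tau>)" for \<tau>
      using h by (simp add: h'_def)
    then have "{\<tau>. \<not> (\<exists>h''. spread_out n g (copies n m (Suc j)) val h''
         \<and> config n (\<lambda>v. st0 (val v) (h' \<tau> v) m z) = base n val h'' m z)} = {}" by blast
    then show ?thesis by simp
  qed
  finally show ?thesis .
qed

lemma prob_bind_le:
  assumes M: "Pr M A \<le> d" and e: "0 \<le> e"
    and K: "\<And>x. x \<in> set_pmf M \<Longrightarrow> x \<notin> A \<Longrightarrow> Pr (K x) B \<le> e"
  shows "Pr (bind_pmf M K) B \<le> d + e"
proof -
  have d: "0 \<le> d" using M measure_nonneg[of M A] by linarith
  have "emeasure (bind_pmf M K) B = (\<integral>\<^sup>+x. emeasure (K x) B \<partial>M)"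
    by (simp flip: nn_integral_indicator)
  also have "\<dots> \<le> (\<integral>\<^sup>+x. indicator A x + ennreal e \<partial>M)"
  proof (intro nn_integral_mono_AE AE_pmfI)
    fix x assume x: "x \<in> set_pmf M"
    show "emeasure (K x) B \<le> indicator A x + ennreal e"
    proof (cases "x \<in> A")
      case True
      have "emeasure (K x) B \<le> 1" by (rule measure_pmf.emeasure_le_1)
      then show ?thesis using True by (simp add: add_increasing2)
    next
      case False
      then show ?thesis using K[OF x False] by (simp add: measure_pmf.emeasure_eq_measure ennreal_leI)
    qed
  qed
  also have "\<dots> = emeasure M A + ennreal e" by (simp add: nn_integral_add)
  also have "\<dots> \<le> ennreal (d + e)"
    using M d e by (simp add: measure_pmf.emeasure_eq_measure ennreal_plus ennreal_leI)
  finally have "ennreal (Pr (bind_pmf M K) B) \<le> ennreal (d + e)"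
    by (simp only: measure_pmf.emeasure_eq_measure)
  then show ?thesis using d e by (subst (asm) ennreal_le_iff) auto
qed

definition doubling :: "nat \<Rightarrow> nat \<Rightarrow> nat \<Rightarrow> st rule list" where
  "doubling n g J = concat (map (dbl_phase n g) [0..<J])"

lemma doubling_prob:
  assumes n: "0 < n" and h: "spread_out n g 1 val h" and m: "m = size (tokens n val)"
    and bd: "\<And>x. x \<in># tokens n val \<Longrightarrow> x < 2 ^ b"
  shows "Pr (exec n b (doubling n g J) (base n val h m z))
     {\<sigma>. \<not> (\<exists>h'. spread_out n g (copies n m J) val h' \<and> \<sigma> = base n val h' m z)}
     \<le> real J * (real n * (3 * (1 / 2) ^ g))"
proof (induction J)
  case 0
  then show ?case using h by (auto simp: doubling_def indicator_def)
next
  case (Suc J)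
  have "Pr (bind_pmf (exec n b (doubling n g J) (base n val h m z)) (exec n b (dbl_phase n g J)))
     {\<sigma>. \<not> (\<exists>h'. spread_out n g (copies n m (Suc J)) val h' \<and> \<sigma> = base n val h' m z)}
     \<le> real J * (real n * (3 * (1 / 2) ^ g)) + real n * (3 * (1 / 2) ^ g)"
  proof (rule prob_bind_le[OF Suc])
    fix \<sigma> assume "\<sigma> \<notin> {\<sigma>. \<not> (\<exists>h'. spread_out n g (copies n m J) val h' \<and> \<sigma> = base n val h' m z)}"
    then obtain h' where "spread_out n g (copies n m J) val h'" "\<sigma> = base n val h' m z" by blast
    then show "Pr (exec n b (dbl_phase n g J) \<sigma>)
     {\<sigma>. \<not> (\<exists>h'. spread_out n g (copies n m (Suc J)) val h' \<and> \<sigma> = base n val h' m z)}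
        \<le> real n * (3 * (1 / 2) ^ g)"
      using dbl_phase_prob[OF n _ m bd] by simp
  qed simp
  moreover have "exec n b (doubling n g (Suc J)) (base n val h m z)
     = bind_pmf (exec n b (doubling n g J) (base n val h m z)) (exec n b (dbl_phase n g J))"
    by (simp add: doubling_def exec_append)
  ultimately show ?case by (simp add: algebra_simps)
qed

section \<open>Weighted random selection\<close>

text \<open>Mean value bounds for a power over a unit step, here from below and in the next lemma
  from above.\<close>

lemma power_Suc_diff_ge:
  fixes x :: real
  assumes "0 \<le> x"
  shows "x ^ Suc y + real (Suc y) * x ^ y \<le> (x + 1) ^ Suc y"
proof (induction y)
  case (Suc y)
  have "x ^ Suc (Suc y) + real (Suc (Suc y)) * x ^ Suc y \<le> (x ^ Suc y + real (Suc y) * x ^ y) * (x + 1)"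
    using assms by (simp add: algebra_simps)
  also have "\<dots> \<le> (x + 1) ^ Suc y * (x + 1)"
    using Suc assms by (intro mult_right_mono) auto
  finally show ?case by (simp add: mult.commute)
qed simp

lemma power_Suc_diff_le:
  fixes x :: real
  assumes "0 \<le> x"
  shows "(x + 1) ^ Suc y \<le> x ^ Suc y + real (Suc y) * (x + 1) ^ y"
proof (induction y)
  case (Suc y)
  have "(x + 1) ^ Suc (Suc y) = (x + 1) ^ Suc y * (x + 1)" by simp
  also have "\<dots> \<le> (x ^ Suc y + real (Suc y) * (x + 1) ^ y) * (x + 1)"
    using Suc assms by (intro mult_right_mono) auto
  also have "\<dots> = x ^ Suc (Suc y) + x ^ Suc y + real (Suc y) * (x + 1) ^ Suc y"
    by (simp add: algebra_simps)
  also have "\<dots> \<le> x ^ Suc (Suc y) + (x + 1) ^ Suc y + real (Suc y) * (x + 1) ^ Suc y"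
  proof -
    have "x ^ Suc y \<le> (x + 1) ^ Suc y" using assms by (intro power_mono) auto
    then show ?thesis by linarith
  qed
  also have "\<dots> = x ^ Suc (Suc y) + real (Suc (Suc y)) * (x + 1) ^ Suc y"
    by (simp add: algebra_simps)
  finally show ?case .
qed simp

text \<open>A Riemann sum for the integral of \<open>x ^ (Y - 1)\<close> over \<open>[0, 1]\<close>,
  which is \<open>1 / Y\<close>. Telescoping loses one step of length \<open>1 / Q\<close>, and
  Bernoulli's inequality turns this into the factor \<open>1 - Y / Q\<close>.\<close>

lemma sum_powers_ge:
  assumes "0 < Y" "0 < Q"
  shows "(1 - real Y / real Q) / real Y \<le> (\<Sum>r<Q. real r ^ (Y - 1)) / real Q ^ Y"
proof -
  obtain y where y: "Y = Suc y" using assms by (cases Y) auto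
  have tel: "real Q' ^ Y \<le> real Y * (\<Sum>r<Suc Q'. real r ^ (Y - 1))" for Q'
  proof (induction Q')
    case (Suc Q')
    have "real (Suc Q') ^ Y \<le> real Q' ^ Y + real Y * real (Suc Q') ^ y"
      using power_Suc_diff_le[of "real Q'" y] unfolding y by (simp add: add.commute)
    also have "\<dots> \<le> real Y * (\<Sum>r<Suc Q'. real r ^ (Y - 1)) + real Y * real (Suc Q') ^ y"
      using Suc by simp
    also have "\<dots> = real Y * (\<Sum>r<Suc (Suc Q'). real r ^ (Y - 1))"
      by (simp add: y algebra_simps)
    finally show ?case .
  qed (simp add: y)
  obtain Q' where Q': "Q = Suc Q'" using assms by (cases Q) auto
  have "1 - real Y / real Q \<le> (1 - 1 / real Q) ^ Y"
  proof -
    have "1 + real Y * (- 1 / real Q) \<le> (1 + (- 1 / real Q)) ^ Y"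
      using assms by (intro Bernoulli_inequality) auto
    then show ?thesis by simp
  qed
  also have "(1 - 1 / real Q) ^ Y = real Q' ^ Y / real Q ^ Y"
    using Q' by (simp add: field_simps flip: power_divide)
  also have "\<dots> \<le> real Y * (\<Sum>r<Q. real r ^ (Y - 1)) / real Q ^ Y"
    using tel[of Q'] Q' by (intro divide_right_mono) auto
  finally show ?thesis using assms by (simp add: field_simps)
qed

text \<open>A node of weight \<open>y\<close> takes part in the selection with the maximum of \<open>y\<close> independent
  priorities. It then wins with probability proportional to \<open>y\<close>, up to ties.\<close>

definition max_prio :: "nat \<Rightarrow> nat \<Rightarrow> nat pmf" where
  "max_prio Q y = map_pmf (\<lambda>f. Max (f ` {..<y})) (Pi_pmf {..<y} 0 (\<lambda>_. pmf_of_set {..<Q}))"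

lemma prob_max_prio_less:
  assumes "0 < y" "r \<le> Q" "0 < Q"
  shows "Pr (max_prio Q y) {x. x < r} = (real r / real Q) ^ y"
proof -
  have "Pr (max_prio Q y) {x. x < r}
    = Pr (Pi_pmf {..<y} 0 (\<lambda>_. pmf_of_set {..<Q})) (Pi {..<y} (\<lambda>_. {..<r}))"
    unfolding max_prio_def using assms(1)
    by (auto simp: Max_less_iff lessThan_nonempty Pi_def intro!: arg_cong[where f = "Pr _"])
  also have "\<dots> = (\<Prod>j<y. Pr (pmf_of_set {..<Q}) {..<r})"
    by (rule measure_Pi_pmf_Pi) simp
  also have "Pr (pmf_of_set {..<Q}) {..<r} = real r / real Q"
    using assms by (subst measure_pmf_of_set) (auto simp: lessThan_nonempty Int_absorb1)
  finally show ?thesis by simp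
qed

text \<open>A difference of two values of the distribution function \<open>(r / Q) ^ y\<close>,
  bounded by the unit-step estimate.\<close>

lemma pmf_max_prio_ge:
  assumes "0 < y" "r < Q"
  shows "real y * real r ^ (y - 1) / real Q ^ y \<le> pmf (max_prio Q y) r"
proof -
  obtain y' where y': "y = Suc y'" using assms by (cases y) auto
  have "{x. x < Suc r} = insert r {x. x < r}" by auto
  then have "Pr (max_prio Q y) {x. x < Suc r} = pmf (max_prio Q y) r + Pr (max_prio Q y) {x. x < r}"
    by (simp add: measure_pmf_single measure_pmf.finite_measure_Union[of "{r}", simplified])
  then have "pmf (max_prio Q y) r = (real (Suc r) / real Q) ^ y - (real r / real Q) ^ y"
    using assms by (simp add: prob_max_prio_less)
  also have "\<dots> = ((real r + 1) ^ y - real r ^ y) / real Q ^ y"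
    by (simp add: power_divide diff_divide_distrib add.commute)
  also have "\<dots> \<ge> real y * real r ^ (y - 1) / real Q ^ y"
    using power_Suc_diff_ge[of "real r" y'] unfolding y' by (intro divide_right_mono) auto
  finally show ?thesis .
qed

text \<open>Uniform choice among all hits, of which only the value is kept; this realizes the
  weights without normalization.\<close>

definition wchoice :: "nat \<Rightarrow> (nat \<Rightarrow> nat) \<Rightarrow> nat pmf" where
  "wchoice N y = map_pmf fst (pmf_of_set (SIGMA i:{1..N}. {..<y i}))"

lemma wchoice_set_nonempty:
  fixes y :: "nat \<Rightarrow> nat"
  assumes "0 < (\<Sum>i=1..N. y i)"
  shows "(SIGMA i:{1..N}. {..<y i}) \<noteq> {}"
proof -
  have "card (SIGMA i:{1..N}. {..<y i}) = (\<Sum>i=1..N. y i)" by simp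
  then show ?thesis using assms by (metis card.empty less_irrefl)
qed

lemma pmf_wchoice:
  assumes pos: "0 < (\<Sum>i=1..N. y i)"
  shows "pmf (wchoice N y) i = (if i \<in> {1..N} then real (y i) / real (\<Sum>i=1..N. y i) else 0)"
proof -
  let ?S = "SIGMA i:{1..N}. {..<y i}"
  have "pmf (wchoice N y) i = Pr (pmf_of_set ?S) (fst -` {i})"
    unfolding wchoice_def by (simp add: pmf_map)
  also have "\<dots> = real (card (?S \<inter> fst -` {i})) / real (card ?S)"
    using wchoice_set_nonempty[OF pos] by (subst measure_pmf_of_set) auto
  also have "?S \<inter> fst -` {i} = (if i \<in> {1..N} then {i} \<times> {..<y i} else {})" by auto
  finally show ?thesis by auto
qed

lemma set_wchoice: "0 < (\<Sum>i=1..N. y i) \<Longrightarrow> set_pmf (wchoice N y) \<subseteq> {1..N}"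
  by (auto simp: set_pmf_eq pmf_wchoice split: if_splits)

lemma expectation_wchoice:
  assumes pos: "0 < (\<Sum>i=1..N. y i)"
  shows "expect (wchoice N y) f = (\<Sum>i=1..N. real (y i) * f i) / real (\<Sum>i=1..N. y i)"
proof -
  have "expect (wchoice N y) f = (\<Sum>i=1..N. f i * pmf (wchoice N y) i)"
    by (rule integral_measure_pmf_real) (use set_wchoice[OF pos] in auto)
  also have "\<dots> = (\<Sum>i=1..N. real (y i) * f i / real (\<Sum>i=1..N. y i))"
    by (intro sum.cong refl) (subst pmf_wchoice[OF pos], simp)
  finally show ?thesis by (simp add: sum_divide_distrib)
qed

text \<open>Priority and value are the two digits of the key in base \<open>W\<close>. Values start
  at 1, so the key 0 of a node without hits decodes to no value.\<close>

definition key_law :: "nat \<Rightarrow> nat \<Rightarrow> nat \<Rightarrow> (nat \<Rightarrow> nat) \<Rightarrow> nat pmf" where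
  "key_law N W Q y = (if (\<Sum>i=1..N. y i) = 0 then return_pmf 0
     else map_pmf (\<lambda>(r, i). r * W + i) (pair_pmf (max_prio Q (\<Sum>i=1..N. y i)) (wchoice N y)))"

lemma set_max_prio:
  assumes "0 < Q" "0 < y" "r \<in> set_pmf (max_prio Q y)"
  shows "r < Q"
proof -
  obtain f where f: "f \<in> set_pmf (Pi_pmf {..<y} 0 (\<lambda>_. pmf_of_set {..<Q}))" "r = Max (f ` {..<y})"
    using assms(3) unfolding max_prio_def by auto
  have "r \<in> f ` {..<y}" unfolding f(2) using assms(2) by (intro Max_in) (simp_all add: lessThan_nonempty)
  moreover have "f j < Q" if "j < y" for j
    using f(1) that assms(1) by (auto simp: set_Pi_pmf PiE_dflt_def set_pmf_of_set lessThan_nonempty)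
  ultimately show ?thesis by auto
qed

lemma set_key_law:
  assumes "0 < Q" "N < W" "x \<in> set_pmf (key_law N W Q y)"
  shows "x < Q * W"
proof (cases "(\<Sum>i=1..N. y i) = 0")
  case True
  then have "x = 0" using assms(3) by (simp add: key_law_def)
  then show ?thesis using assms by simp
next
  case False
  then obtain r i where ri: "r \<in> set_pmf (max_prio Q (\<Sum>i=1..N. y i))" "i \<in> set_pmf (wchoice N y)" "x = r * W + i"
    using assms(3) unfolding key_law_def if_not_P[OF False] by auto
  have pos: "0 < (\<Sum>i=1..N. y i)" using False by (simp only: neq0_conv)
  have "r < Q" by (rule set_max_prio[OF assms(1) pos ri(1)])
  moreover have "i < W" using set_wchoice[OF pos] ri(2) assms(2) by fastforce
  ultimately have "x < Suc r * W" "Suc r \<le> Q" using ri(3) by auto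
  then show ?thesis using mult_right_mono[of "Suc r" Q W] by linarith
qed

text \<open>Only outcomes are counted in which node \<open>v\<close> draws value \<open>i\<close>
  with priority \<open>r\<close> and every other priority is smaller; ties are given away. These
  events are disjoint, and each has probability at least \<open>y v i * r^(Y-1) / Q^Y\<close>,
  because the exponents of the other nodes add up to \<open>Y\<close> minus the weight of
  \<open>v\<close>. The sum over \<open>r\<close> is \<open>sum_powers_ge\<close>.\<close>

lemma prob_select_ge:
  fixes n :: nat
  assumes Q: "0 < Q" and W: "N < W" and i: "i \<in> {1..N}" and Y: "Y = (\<Sum>v<n. \<Sum>i=1..N. y v i)" "0 < Y"
  shows "real (\<Sum>v<n. y v i) / real Y * (1 - real Y / real Q)
    \<le> Pr (Pi_pmf {..<n} 0 (\<lambda>v. key_law N W Q (y v))) {\<kappa>. Max (\<kappa> ` {..<n}) mod W = i}"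
proof -
  let ?P = "Pi_pmf {..<n} 0 (\<lambda>v. key_law N W Q (y v))"
  define Yv where "Yv = (\<lambda>v. \<Sum>i=1..N. y v i)"
  \<comment> \<open>The key 0 is added for nodes without hits, which must be beaten even if
    \<open>r = 0\<close>.\<close>
  define L where "L = (\<lambda>r. {x. x < r * W} \<union> {0::nat})"
  define A where "A = (\<lambda>(v, r). Pi {..<n} (\<lambda>w. if w = v then {r * W + i} else L r))"
  have i0: "0 < i" "i < W" using i W by auto
  have kl: "key_law N W Q (y w) = map_pmf (\<lambda>(r, i). r * W + i) (pair_pmf (max_prio Q (Yv w)) (wchoice N (y w)))"
    if "Yv w \<noteq> 0" for w
    using that unfolding Yv_def key_law_def by (simp only: if_False)
  have L: "(real r / real Q) ^ Yv w \<le> Pr (key_law N W Q (y w)) (L r)" if r: "r < Q" for r w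
  proof (cases "Yv w = 0")
    case True
    then show ?thesis by (simp add: key_law_def Yv_def L_def)
  next
    case False
    have "(real r / real Q) ^ Yv w = Pr (max_prio Q (Yv w)) {x. x < r}"
      using False r Q by (subst prob_max_prio_less) auto
    also have "\<dots> = Pr (map_pmf fst (pair_pmf (max_prio Q (Yv w)) (wchoice N (y w)))) {x. x < r}"
      by (simp only: map_fst_pair_pmf)
    also have "\<dots> = Pr (pair_pmf (max_prio Q (Yv w)) (wchoice N (y w))) (fst -` {x. x < r})"
      by simp
    also have "\<dots> \<le> Pr (pair_pmf (max_prio Q (Yv w)) (wchoice N (y w))) ((\<lambda>(r, i). r * W + i) -` L r)"
    proof (rule prob_mono_support)
      fix x assume x: "x \<in> set_pmf (pair_pmf (max_prio Q (Yv w)) (wchoice N (y w)))" "x \<in> fst -` {x. x < r}"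
      obtain r' j where rj: "x = (r', j)" by (cases x)
      have "j < W" using x(1) rj set_wchoice[of "y w" N] False W unfolding Yv_def by fastforce
      then have "r' * W + j < Suc r' * W" by simp
      also have "\<dots> \<le> r * W" using x(2) rj by (intro mult_right_mono) auto
      finally show "x \<in> (\<lambda>(r, i). r * W + i) -` L r" by (simp add: rj L_def)
    qed
    also have "\<dots> = Pr (key_law N W Q (y w)) (L r)"
      unfolding kl[OF False] by simp
    finally show ?thesis .
  qed
  have K: "real (y v i) * real r ^ (Yv v - 1) / real Q ^ Yv v \<le> Pr (key_law N W Q (y v)) {r * W + i}"
    if r: "r < Q" for r v
  proof (cases "Yv v = 0")
    case True
    then have "y v i = 0" using i by (simp add: Yv_def)
    then show ?thesis by simp
  next
    case False
    then have pos: "0 < (\<Sum>i=1..N. y v i)" unfolding Yv_def by (simp only: neq0_conv)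
    have "real (y v i) * real r ^ (Yv v - 1) / real Q ^ Yv v
        = real (Yv v) * real r ^ (Yv v - 1) / real Q ^ Yv v * (real (y v i) / real (Yv v))"
      using False by simp
    also have "\<dots> \<le> pmf (max_prio Q (Yv v)) r * (real (y v i) / real (Yv v))"
      using False r by (intro mult_right_mono pmf_max_prio_ge) auto
    also have "\<dots> = pmf (pair_pmf (max_prio Q (Yv v)) (wchoice N (y v))) (r, i)"
      using i pos by (simp add: pmf_pair pmf_wchoice Yv_def)
    also have "\<dots> = Pr (pair_pmf (max_prio Q (Yv v)) (wchoice N (y v))) {(r, i)}"
      by (simp add: measure_pmf_single)
    also have "\<dots> \<le> Pr (pair_pmf (max_prio Q (Yv v)) (wchoice N (y v))) ((\<lambda>(r, i). r * W + i) -` {r * W + i})"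
      by (intro measure_pmf.finite_measure_mono) auto
    also have "\<dots> = Pr (key_law N W Q (y v)) {r * W + i}"
      unfolding kl[OF False] by simp
    finally show ?thesis .
  qed
  have disj: "disjoint_family_on A ({..<n} \<times> {..<Q})"
    unfolding disjoint_family_on_def
  proof (intro ballI impI)
    fix a b assume ab: "a \<in> {..<n} \<times> {..<Q}" "b \<in> {..<n} \<times> {..<Q}" "a \<noteq> b"
    obtain v r w r' where vr: "a = (v, r)" "b = (w, r')" by (cases a, cases b)
    \<comment> \<open>Membership in two events with different winners would make each priority
      smaller than the other.\<close>
    have nW: "r' < r" if "\<kappa> \<in> A (v, r)" "\<kappa> w = r' * W + i" "w < n" "w \<noteq> v" for \<kappa> v r w r'
    proof -
      have "r' * W + i \<in> L r" using Pi_mem[OF that(1)[unfolded A_def prod.case], of w] that(2-4) by simp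
      then have "r' * W + i < r * W" using i0 by (simp add: L_def)
      then have "r' * W < r * W" by linarith
      then show ?thesis by simp
    qed
    show "A a \<inter> A b = {}"
    proof (rule ccontr)
      assume "A a \<inter> A b \<noteq> {}"
      then obtain \<kappa> where \<kappa>: "\<kappa> \<in> A (v, r)" "\<kappa> \<in> A (w, r')" using vr by blast
      have kv: "\<kappa> v = r * W + i" "\<kappa> w = r' * W + i"
        using \<kappa> ab(1,2) vr by (auto simp: A_def Pi_def)
      show False
      proof (cases "v = w")
        case True
        then show False using kv ab(3) vr i0 by simp
      next
        case False
        then show False
          using nW[OF \<kappa>(1) kv(2)] nW[OF \<kappa>(2) kv(1)] ab(1,2) vr by auto
      qed
    qed
  qed
  have probA: "real (y v i) * real r ^ (Y - 1) / real Q ^ Y \<le> Pr ?P (A (v, r))"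
    if v: "v < n" and r: "r < Q" for v r
  proof (cases "y v i = 0")
    case False
    then have Yv0: "0 < Yv v" unfolding Yv_def using i by (intro sum_pos2[of _ i]) auto
    have Ysum: "Y = Yv v + (\<Sum>w\<in>{..<n} - {v}. Yv w)"
      unfolding Y(1) Yv_def[symmetric] by (rule sum.remove) (use v in simp_all)
    have "real (y v i) * real r ^ (Y - 1) / real Q ^ Y
       = real (y v i) * real r ^ (Yv v - 1) / real Q ^ Yv v * (\<Prod>w\<in>{..<n} - {v}. (real r / real Q) ^ Yv w)"
    proof -
      have "Y - 1 = (Yv v - 1) + (\<Sum>w\<in>{..<n} - {v}. Yv w)" using Ysum Yv0 by linarith
      moreover have "(\<Prod>w\<in>{..<n} - {v}. (real r / real Q) ^ Yv w) = real r ^ (\<Sum>w\<in>{..<n} - {v}. Yv w) / real Q ^ (\<Sum>w\<in>{..<n} - {v}. Yv w)"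
        by (simp add: power_sum power_divide prod_dividef)
      ultimately show ?thesis by (subst Ysum) (simp add: power_add)
    qed
    also have "\<dots> \<le> Pr (key_law N W Q (y v)) {r * W + i} * (\<Prod>w\<in>{..<n} - {v}. Pr (key_law N W Q (y w)) (L r))"
      by (intro mult_mono K L r prod_mono prod_nonneg) (auto intro: L[OF r])
    also have "\<dots> = (\<Prod>w<n. Pr (key_law N W Q (y w)) (if w = v then {r * W + i} else L r))"
      using v by (subst prod.remove[of _ v]) (auto intro!: prod.cong)
    also have "\<dots> = Pr ?P (A (v, r))"
      unfolding A_def prod.case by (rule measure_Pi_pmf_Pi[symmetric]) simp
    finally show ?thesis .
  qed simp
  have subset: "A (v, r) \<subseteq> {\<kappa>. Max (\<kappa> ` {..<n}) mod W = i}" if v: "v < n" for v r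
  proof
    fix \<kappa> assume \<kappa>: "\<kappa> \<in> A (v, r)"
    have "Max (\<kappa> ` {..<n}) = r * W + i"
    proof (rule Max_eqI)
      show "r * W + i \<in> \<kappa> ` {..<n}" using \<kappa> v by (force simp: A_def Pi_def)
      fix x assume "x \<in> \<kappa> ` {..<n}"
      then obtain w where w: "w < n" "x = \<kappa> w" by auto
      then have "x \<in> (if w = v then {r * W + i} else L r)" using \<kappa> by (auto simp: A_def Pi_def)
      then show "x \<le> r * W + i" by (auto simp: L_def split: if_splits)
    qed simp
    then show "\<kappa> \<in> {\<kappa>. Max (\<kappa> ` {..<n}) mod W = i}" using i0 by simp
  qed
  have "real (\<Sum>v<n. y v i) / real Y * (1 - real Y / real Q)
     = real (\<Sum>v<n. y v i) * ((1 - real Y / real Q) / real Y)" by simp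
  also have "\<dots> \<le> real (\<Sum>v<n. y v i) * ((\<Sum>r<Q. real r ^ (Y - 1)) / real Q ^ Y)"
    by (intro mult_left_mono sum_powers_ge Y Q of_nat_0_le_iff)
  also have "\<dots> = (\<Sum>v<n. \<Sum>r<Q. real (y v i) * real r ^ (Y - 1) / real Q ^ Y)"
    by (simp add: sum_product sum_divide_distrib)
  also have "\<dots> = (\<Sum>a\<in>{..<n} \<times> {..<Q}. real (y (fst a) i) * real (snd a) ^ (Y - 1) / real Q ^ Y)"
    by (simp add: sum.cartesian_product case_prod_beta)
  also have "\<dots> \<le> (\<Sum>a\<in>{..<n} \<times> {..<Q}. Pr ?P (A a))"
    using probA by (intro sum_mono) auto
  also have "\<dots> = Pr ?P (\<Union>a\<in>{..<n} \<times> {..<Q}. A a)"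
    using disj by (intro measure_pmf.finite_measure_finite_Union[symmetric]) auto
  also have "\<dots> \<le> Pr ?P {\<kappa>. Max (\<kappa> ` {..<n}) mod W = i}"
    using subset by (intro measure_pmf.finite_measure_mono) auto
  finally show ?thesis .
qed

text \<open>Pointwise lower bounds suffice: integrating \<open>1 - g\<close> instead of
  \<open>g\<close> turns them into an upper bound for \<open>g\<close>.\<close>

lemma apx_of_pmf_ge:
  assumes \<delta>: "0 \<le> \<delta>" and le: "\<And>x. x \<in> set_pmf N \<Longrightarrow> (1 - \<delta>) * pmf N x \<le> pmf M x"
  shows "apx \<delta> M N"
  unfolding apx_def
proof (intro allI impI)
  fix g :: "'a \<Rightarrow> ennreal" assume g: "\<forall>x. g x \<le> 1"
  define f where "f = (\<lambda>x. enn2real (g x))"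
  have gf: "g x = ennreal (f x)" for x
    unfolding f_def using g by (metis ennreal_enn2real ennreal_one_less_top le_less_trans)
  have f01: "0 \<le> f x" "f x \<le> 1" for x
    using g gf[of x] by (auto simp: f_def enn2real_leI)
  have int: "integrable (measure_pmf R) f" for R
    by (rule measure_pmf.integrable_const_bound[of _ 1]) (auto simp: f01)
  have E: "(\<integral>\<^sup>+x. g x \<partial>R) = ennreal (expect R f)" for R :: "'a pmf"
    unfolding gf by (intro nn_integral_eq_integral int) (auto simp: f01)
  have "expect M f \<le> expect N f + \<delta>"
  proof (cases "\<delta> \<le> 1")
    case True
    have "ennreal (1 - \<delta>) * (\<integral>\<^sup>+x. ennreal (1 - f x) \<partial>N) = (\<integral>\<^sup>+x. ennreal (1 - \<delta>) * (ennreal (pmf N x) * ennreal (1 - f x)) \<partial>count_space UNIV)"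
      by (simp add: nn_integral_measure_pmf nn_integral_cmult)
    also have "\<dots> \<le> (\<integral>\<^sup>+x. ennreal (pmf M x) * ennreal (1 - f x) \<partial>count_space UNIV)"
    proof (intro nn_integral_mono)
      fix x
      have "(1 - \<delta>) * pmf N x \<le> pmf M x" using le[of x] by (cases "x \<in> set_pmf N") (auto simp: set_pmf_iff)
      then have "(1 - \<delta>) * (pmf N x * (1 - f x)) \<le> pmf M x * (1 - f x)"
        using f01[of x] by (simp add: mult_right_mono flip: mult.assoc)
      then show "ennreal (1 - \<delta>) * (ennreal (pmf N x) * ennreal (1 - f x)) \<le> ennreal (pmf M x) * ennreal (1 - f x)"
        using True f01[of x] by (simp add: ennreal_leI flip: ennreal_mult)
    qed
    also have "\<dots> = (\<integral>\<^sup>+x. ennreal (1 - f x) \<partial>M)" by (simp add: nn_integral_measure_pmf)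
    finally have "ennreal ((1 - \<delta>) * expect N (\<lambda>x. 1 - f x)) \<le> ennreal (expect M (\<lambda>x. 1 - f x))"
      using True int f01 by (simp add: nn_integral_eq_integral ennreal_mult')
    then have "(1 - \<delta>) * expect N (\<lambda>x. 1 - f x) \<le> expect M (\<lambda>x. 1 - f x)"
      using f01 by (subst (asm) ennreal_le_iff) (auto intro!: Bochner_Integration.integral_nonneg)
    then have "(1 - \<delta>) * (1 - expect N f) \<le> 1 - expect M f"
      using int by simp
    moreover have "0 \<le> \<delta> * expect N f"
      using \<delta> f01 by (simp add: Bochner_Integration.integral_nonneg)
    ultimately show ?thesis by (simp add: algebra_simps)
  next
    case False
    have "expect M f \<le> expect M (\<lambda>_. 1)"
      using int f01 by (intro integral_mono) auto
    moreover have "0 \<le> expect N f" using f01 by (simp add: Bochner_Integration.integral_nonneg)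
    ultimately show ?thesis using False by simp
  qed
  then show "(\<integral>\<^sup>+x. g x \<partial>M) \<le> (\<integral>\<^sup>+x. g x \<partial>N) + ennreal \<delta>"
    unfolding E using \<delta> f01 by (simp add: ennreal_leI Bochner_Integration.integral_nonneg flip: ennreal_plus)
qed

lemma select_apx:
  fixes n :: nat
  assumes Q: "0 < Q" and W: "N < W" and Y: "Y = (\<Sum>v<n. \<Sum>i=1..N. y v i)" "0 < Y" "real Y / real Q \<le> \<delta>"
  shows "apx \<delta> (map_pmf (\<lambda>\<kappa>. Max (\<kappa> ` {..<n}) mod W) (Pi_pmf {..<n} 0 (\<lambda>v. key_law N W Q (y v))))
     (wchoice N (\<lambda>i. \<Sum>v<n. y v i))"
proof (rule apx_mono[OF apx_of_pmf_ge Y(3)])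
  have Y': "Y = (\<Sum>i=1..N. \<Sum>v<n. y v i)" unfolding Y(1) by (rule sum.swap)
  fix i assume "i \<in> set_pmf (wchoice N (\<lambda>i. \<Sum>v<n. y v i))"
  then have i: "i \<in> {1..N}" using set_wchoice[of "\<lambda>i. \<Sum>v<n. y v i" N] Y(2) unfolding Y' by blast
  have "(1 - real Y / real Q) * pmf (wchoice N (\<lambda>i. \<Sum>v<n. y v i)) i = real (\<Sum>v<n. y v i) / real Y * (1 - real Y / real Q)"
    using i Y(2) unfolding Y' by (subst pmf_wchoice) auto
  also have "\<dots> \<le> Pr (Pi_pmf {..<n} 0 (\<lambda>v. key_law N W Q (y v))) {\<kappa>. Max (\<kappa> ` {..<n}) mod W = i}"
    by (rule prob_select_ge[OF Q W i Y(1,2)])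
  also have "\<dots> = pmf (map_pmf (\<lambda>\<kappa>. Max (\<kappa> ` {..<n}) mod W) (Pi_pmf {..<n} 0 (\<lambda>v. key_law N W Q (y v)))) i"
    by (simp add: pmf_map vimage_def)
  finally show "(1 - real Y / real Q) * pmf (wchoice N (\<lambda>i. \<Sum>v<n. y v i)) i
     \<le> pmf (map_pmf (\<lambda>\<kappa>. Max (\<kappa> ` {..<n}) mod W) (Pi_pmf {..<n} 0 (\<lambda>v. key_law N W Q (y v)))) i" .
qed simp

section \<open>One sample of the estimator\<close>

definition samp_slot :: "nat \<Rightarrow> st \<Rightarrow> nat option" where
  "samp_slot s q = (if s < length (home q) then Some (home q ! s) else None)"

definition tok :: "(nat \<Rightarrow> nat list) \<Rightarrow> nat \<Rightarrow> nat \<Rightarrow> nat option" where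
  "tok h s w = (if s < length (h w) then Some (h w ! s) else None)"

text \<open>The contribution of one node and one value to \<open>Y\<close>: the choices of one token
  of value \<open>i\<close> from each block.\<close>

definition local_hits :: "nat \<Rightarrow> st \<Rightarrow> nat \<Rightarrow> nat" where
  "local_hits k q i = (\<Prod>l<k. count (inbox q) (prod_encode (l, i)))"

definition hits :: "nat \<Rightarrow> (nat \<Rightarrow> nat list) \<Rightarrow> nat \<Rightarrow> nat \<Rightarrow> (nat \<Rightarrow> nat \<Rightarrow> nat \<Rightarrow> nat) \<Rightarrow> nat \<Rightarrow> nat \<Rightarrow> nat" where
  "hits n h g k \<beta> v i = (\<Prod>l<k. count (received n (tok h) g (\<beta> l) v) i)"

text \<open>\<open>saved\<close> keeps \<open>Y\<close> while \<open>tot\<close> is reused for the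
  frequency of the drawn value.\<close>

definition sample_tail :: "nat \<Rightarrow> nat \<Rightarrow> nat \<Rightarrow> nat \<Rightarrow> nat \<Rightarrow> st rule list" where
  "sample_tail n N k t W = spread (2 * t)
     @ loc (\<lambda>q. q\<lparr>chosen := key q mod W, key := 0, arg := (\<Sum>i=1..N. local_hits k q i), inbox := {#}\<rparr>)
     # summ n W t
     @ loc (\<lambda>q. q\<lparr>saved := tot q, arg := (if inp q = Some (chosen q) then 1 else 0)\<rparr>)
     # summ n W t
     @ [loc (\<lambda>q. q\<lparr>outs := (saved q, tot q) # outs q, arg := 0, tot := 0, saved := 0, chosen := 0\<rparr>)]"

definition select_rule :: "nat \<Rightarrow> nat \<Rightarrow> nat \<Rightarrow> nat \<Rightarrow> st rule" where
  "select_rule N k W Q = Local_rule (\<lambda>q. map_pmf (\<lambda>x. q\<lparr>key := x\<rparr>) (key_law N W Q (local_hits k q)))"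

definition sample_iter :: "nat \<Rightarrow> nat \<Rightarrow> nat \<Rightarrow> nat \<Rightarrow> nat \<Rightarrow> nat \<Rightarrow> nat \<Rightarrow> st rule list" where
  "sample_iter n N k g t W Q = concat (map (\<lambda>l. throw samp_slot l g) [0..<k])
     @ select_rule N k W Q # sample_tail n N k t W"

definition block_targets :: "nat \<Rightarrow> nat \<Rightarrow> nat \<Rightarrow> (nat \<Rightarrow> nat \<Rightarrow> nat \<Rightarrow> nat) pmf" where
  "block_targets n g k = Pi_pmf {..<k} undefined (\<lambda>_. targets_seq n g)"

text \<open>Without hits there is nothing to draw; the pair \<open>(0, 0)\<close> then yields the
  estimate 0. Only integers are stored, and the power and the scaling are left to the final
  result.\<close>

definition choice_law :: "nat \<Rightarrow> nat \<Rightarrow> (nat \<Rightarrow> nat option) \<Rightarrow> (nat \<Rightarrow> nat) \<Rightarrow> (nat \<times> nat) pmf" where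
  "choice_law n N val y = (if (\<Sum>i=1..N. y i) = 0 then return_pmf (0, 0)
     else map_pmf (\<lambda>i. (\<Sum>i=1..N. y i, freq n val i)) (wchoice N y))"

definition sample_law :: "nat \<Rightarrow> nat \<Rightarrow> nat \<Rightarrow> nat \<Rightarrow> (nat \<Rightarrow> nat option) \<Rightarrow> (nat \<Rightarrow> nat list) \<Rightarrow> (nat \<times> nat) pmf" where
  "sample_law n N k g val h = bind_pmf (block_targets n g k)
     (\<lambda>\<beta>. choice_law n N val (\<lambda>i. \<Sum>v<n. hits n h g k \<beta> v i))"

lemma apx_map: "apx d M N \<Longrightarrow> apx d (map_pmf f M) (map_pmf f N)"
  by (simp add: apx_def)

lemma Pi_pmf_map_config:
  "Pi_pmf {..<n} undefined (\<lambda>v. map_pmf (f v) (p v)) = map_pmf (\<lambda>\<kappa>. config n (\<lambda>v. f v (\<kappa> v))) (Pi_pmf {..<n} d p)"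
proof -
  have "Pi_pmf {..<n} undefined (\<lambda>v. map_pmf (f v) (p v))
     = Pi_pmf {..<n} undefined (\<lambda>v. bind_pmf (p v) (\<lambda>x. return_pmf (f v x)))"
    by (simp add: map_pmf_def)
  also have "\<dots> = bind_pmf (Pi_pmf {..<n} d p) (\<lambda>\<kappa>. Pi_pmf {..<n} undefined (\<lambda>v. return_pmf (f v (\<kappa> v))))"
    by (rule Pi_pmf_bind) simp
  also have "\<dots> = map_pmf (\<lambda>\<kappa>. config n (\<lambda>v. f v (\<kappa> v))) (Pi_pmf {..<n} d p)"
    by (simp add: map_pmf_def flip: config_eq_Pi_return)
  finally show ?thesis .
qed

lemma freq_eq_sum: "freq n val i = (\<Sum>w<n. if val w = Some i then 1 else 0)"
proof -
  have "{v. v < n \<and> val v = Some i} = {..<n} \<inter> {v. val v = Some i}" by auto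
  then show ?thesis by (simp add: freq_def sum.If_cases)
qed

lemma received_total:
  assumes n: "0 < n" and h: "spread_out n g r val h" and \<tau>: "\<tau> \<in> set_pmf (targets_seq n g)"
  shows "(\<Sum>v<n. received n (tok h) g \<tau> v) = repeat_mset r (tokens n val)"
proof -
  have "(\<Sum>v<n. received n (tok h) g \<tau> v) = (\<Sum>w<n. \<Sum>s<g. opt_mset (tok h s w))"
    unfolding sum_received[OF n \<tau>] by (rule sum.swap)
  also have "\<dots> = (\<Sum>w<n. mset (h w))"
    using h unfolding tok_def spread_out_def by (intro sum.cong refl sum_slots) auto
  finally show ?thesis using h by (simp add: spread_out_def)
qed

lemma size_received_le:
  assumes n: "0 < n" and h: "spread_out n g r val h" and \<tau>: "\<tau> \<in> set_pmf (targets_seq n g)"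
    and r: "r * size (tokens n val) \<le> n" and v: "v < n"
  shows "size (received n (tok h) g \<tau> v) \<le> n"
proof -
  have "size (received n (tok h) g \<tau> v) \<le> (\<Sum>v<n. size (received n (tok h) g \<tau> v))"
    using v by (intro member_le_sum) auto
  also have "\<dots> = r * size (tokens n val)"
    by (simp only: size_sum_set[symmetric] received_total[OF n h \<tau>] size_tokens)
  finally show ?thesis using r by linarith
qed

lemma sum_count_le_size: "finite A \<Longrightarrow> (\<Sum>i\<in>A. count M i) \<le> size M"
proof (induction M)
  case (add x M)
  have "(\<Sum>i\<in>A. count (add_mset x M) i) = (\<Sum>i\<in>A. count M i + (if i = x then 1 else 0))"
    by (intro sum.cong) auto
  also have "\<dots> \<le> (\<Sum>i\<in>A. count M i) + 1" using add.prems by (simp add: sum.distrib)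
  finally show ?case using add by simp
qed simp

lemma sum_prod_le_prod_sum:
  fixes c :: "nat \<Rightarrow> 'a \<Rightarrow> nat"
  assumes "finite A" "0 < k"
  shows "(\<Sum>i\<in>A. \<Prod>l<k. c l i) \<le> (\<Prod>l<k. \<Sum>i\<in>A. c l i)"
  using assms(2)
proof (induction k rule: nat_induct_non_zero)
  case (Suc k)
  have "(\<Sum>i\<in>A. \<Prod>l<Suc k. c l i) \<le> (\<Sum>i\<in>A. (\<Prod>l<k. c l i) * (\<Sum>i\<in>A. c k i))"
    using assms(1) by (auto intro!: sum_mono mult_left_mono member_le_sum)
  also have "\<dots> \<le> (\<Prod>l<k. \<Sum>i\<in>A. c l i) * (\<Sum>i\<in>A. c k i)"
    using Suc.IH by (simp flip: sum_distrib_right)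
  finally show ?case by simp
qed simp

lemma set_block_targets: "\<beta> \<in> set_pmf (block_targets n g k) \<Longrightarrow> l < k \<Longrightarrow> \<beta> l \<in> set_pmf (targets_seq n g)"
  by (auto simp: block_targets_def set_Pi_pmf PiE_dflt_def)

text \<open>A crude bound, sufficient for the word size, the error of the exact sums and the range
  of the priorities.\<close>

lemma sum_hits_le:
  assumes n: "0 < n" and h: "spread_out n g r val h" and \<beta>: "\<beta> \<in> set_pmf (block_targets n g k)"
    and r: "r * size (tokens n val) \<le> n" and v: "v < n" and k: "0 < k"
  shows "(\<Sum>i=1..N. hits n h g k \<beta> v i) \<le> n ^ k"
proof -
  have "(\<Sum>i=1..N. hits n h g k \<beta> v i) \<le> (\<Prod>l<k. \<Sum>i=1..N. count (received n (tok h) g (\<beta> l) v) i)"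
    unfolding hits_def by (rule sum_prod_le_prod_sum[OF _ k]) simp
  also have "\<dots> \<le> (\<Prod>l<k. n)"
  proof (intro prod_mono conjI)
    fix l assume "l \<in> {..<k}"
    then have "\<beta> l \<in> set_pmf (targets_seq n g)" using set_block_targets[OF \<beta>] by simp
    then have "size (received n (tok h) g (\<beta> l) v) \<le> n" by (rule size_received_le[OF n h _ r v])
    then show "(\<Sum>i=1..N. count (received n (tok h) g (\<beta> l) v) i) \<le> n"
      using sum_count_le_size[of "{1..N}" "received n (tok h) g (\<beta> l) v"] by simp
  qed simp
  finally show ?thesis by simp
qed

lemma inj_prod_encode_Pair: "inj (\<lambda>x. prod_encode (l, x))"
  by (auto simp: inj_def)

lemma count_image_mset_inj_eq: "inj f \<Longrightarrow> count (image_mset f M) (f x) = count M x"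
  by (induction M) (auto simp: inj_eq)

lemma count_sum_set: "count (sum f A) x = (\<Sum>a\<in>A. count (f a) x)"
  by (induction A rule: infinite_finite_induct) auto

lemma local_hits_eq:
  assumes "inbox q = (\<Sum>l<k. image_mset (\<lambda>x. prod_encode (l, x)) (M l))"
  shows "local_hits k q i = (\<Prod>l<k. count (M l) i)"
  unfolding local_hits_def
proof (intro prod.cong refl)
  fix l assume l: "l \<in> {..<k}"
  have "count (inbox q) (prod_encode (l, i)) = (\<Sum>l'<k. if l' = l then count (M l) i else 0)"
    unfolding assms count_sum_set
  proof (intro sum.cong refl)
    fix l' assume "l' \<in> {..<k}"
    show "count (image_mset (\<lambda>x. prod_encode (l', x)) (M l')) (prod_encode (l, i)) = (if l' = l then count (M l) i else 0)"
    proof (cases "l' = l")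
      case True
      then show ?thesis using count_image_mset_inj_eq[OF inj_prod_encode_Pair, of l "M l" i] by simp
    next
      case False
      then have "prod_encode (l, i) \<notin># image_mset (\<lambda>x. prod_encode (l', x)) (M l')" by auto
      then show ?thesis using False by (auto simp: count_eq_zero_iff)
    qed
  qed
  then show "count (inbox q) (prod_encode (l, i)) = count (M l) i" using l by simp
qed

lemma val_in_tokens: "x \<in># tokens n val \<longleftrightarrow> (\<exists>v<n. val v = Some x)"
  by (auto simp: tokens_def set_mset_sum opt_mset_def split: option.splits)

lemma home_in_tokens:
  assumes "spread_out n g r val h" "w < n" "x \<in> set (h w)"
  shows "x \<in># tokens n val"
proof -
  have "x \<in># (\<Sum>v<n. mset (h v))" using assms(2,3) by (auto simp: set_mset_sum)
  then show ?thesis using assms(1) by (auto simp: spread_out_def dest: in_repeat_mset)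
qed

text \<open>Once the keys are drawn, only broadcasts and sums remain, so the ideal outcome is a
  single configuration. The assumption on \<open>G\<close> says that a node is at rest up to its key
  and its inbox.\<close>

lemma tail_apx:
  assumes n: "0 < n" and W: "W * W \<le> 2 ^ b" "n * n ^ k * 2 ^ t < W" and key: "\<And>v. v < n \<Longrightarrow> \<kappa> v < 2 ^ b"
    and y: "\<And>v. v < n \<Longrightarrow> (\<Sum>i=1..N. local_hits k (G v) i) \<le> n ^ k"
    and G: "\<And>v. (G v)\<lparr>key := 0, inbox := {#}\<rparr> = st0 (val v) (h v) m z"
    and c: "c = Max (\<kappa> ` {..<n}) mod W"
  shows "apx ((real n)\<^sup>2 * (2 / 3) ^ (2 * t) + 2 * (5 * real n ^ 3 * (real (n ^ k))\<^sup>2 * (1 / 2) ^ t))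
    (exec n b (sample_tail n N k t W)
      (config n (\<lambda>v. (G v)\<lparr>key := \<kappa> v\<rparr>)))
    (return_pmf (config n (\<lambda>v. st0 (val v) (h v) m ((\<Sum>v<n. \<Sum>i=1..N. local_hits k (G v) i, freq n val c) # z))))"
proof -
  let ?e = "5 * real n ^ 3 * (real (n ^ k))\<^sup>2 * (1 / 2) ^ t"
  define Yv where "Yv = (\<lambda>v. \<Sum>i=1..N. local_hits k (G v) i)"
  define Y where "Y = (\<Sum>v<n. Yv v)"
  let ?s = "\<lambda>v. st0 (val v) (h v) m z"
  let ?C = "[loc (\<lambda>q::st. q\<lparr>outs := (saved q, tot q) # outs q, arg := 0, tot := 0, saved := 0, chosen := 0\<rparr>)]"
  let ?S1 = "\<lambda>v. (?s v)\<lparr>chosen := c, arg := Yv v\<rparr>"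
  let ?S2 = "\<lambda>v. (?s v)\<lparr>chosen := c, arg := (if val v = Some c then 1 else 0), tot := Y, saved := Y\<rparr>"
  have nk: "1 \<le> n ^ k" using n by simp
  have lh: "local_hits k (q\<lparr>key := x\<rparr>) = local_hits k q" for q :: st and x by (simp add: local_hits_def fun_eq_iff)
  have p3: "apx (?e + 0) (exec n b (summ n W t @ ?C) (config n ?S2))
      (return_pmf (base n val h m ((Y, freq n val c) # z)))"
  proof (rule apx_exec_append)
    show "apx ?e (exec n b (summ n W t) (config n ?S2))
      (return_pmf (config n (\<lambda>v. (?S2 v)\<lparr>tot := (\<Sum>w<n. arg (?S2 w)), mass := 0, wgt := 0, key := 0\<rparr>)))"
      by (rule summ_apx[OF n _ nk W]) (use nk in auto)
    have "(\<Sum>w<n. arg (?S2 w)) = freq n val c" by (simp add: freq_eq_sum)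
    then show "apx 0 (exec n b ?C (config n (\<lambda>v. (?S2 v)\<lparr>tot := (\<Sum>w<n. arg (?S2 w)), mass := 0, wgt := 0, key := 0\<rparr>)))
       (return_pmf (base n val h m ((Y, freq n val c) # z)))"
      by (simp add: st0_def apx_refl)
  qed auto
  let ?B = "loc (\<lambda>q::st. q\<lparr>saved := tot q, arg := (if inp q = Some (chosen q) then 1 else 0)\<rparr>) # summ n W t @ ?C"
  have p2: "apx (?e + (?e + 0)) (exec n b (summ n W t @ ?B) (config n ?S1))
      (return_pmf (base n val h m ((Y, freq n val c) # z)))"
  proof (rule apx_exec_append)
    show "apx ?e (exec n b (summ n W t) (config n ?S1))
      (return_pmf (config n (\<lambda>v. (?S1 v)\<lparr>tot := (\<Sum>w<n. arg (?S1 w)), mass := 0, wgt := 0, key := 0\<rparr>)))"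
      by (rule summ_apx[OF n _ nk W]) (use y in \<open>auto simp: Yv_def\<close>)
    have "(\<lambda>v. (\<lambda>q. q\<lparr>saved := tot q, arg := (if inp q = Some (chosen q) then 1 else 0)\<rparr>)
        ((?S1 v)\<lparr>tot := (\<Sum>w<n. arg (?S1 w)), mass := 0, wgt := 0, key := 0\<rparr>)) = ?S2"
      by (simp add: st0_def Y_def cong: if_cong)
    then show "apx (?e + 0) (exec n b ?B (config n (\<lambda>v. (?S1 v)\<lparr>tot := (\<Sum>w<n. arg (?S1 w)), mass := 0, wgt := 0, key := 0\<rparr>)))
      (return_pmf (base n val h m ((Y, freq n val c) # z)))"
      using p3 by (simp only: exec_loc)
  qed auto
  have "apx ((real n)\<^sup>2 * (2 / 3) ^ (2 * t) + (?e + (?e + 0))) (exec n b (spread (2 * t)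
     @ loc (\<lambda>q. q\<lparr>chosen := key q mod W, key := 0, arg := (\<Sum>i=1..N. local_hits k q i), inbox := {#}\<rparr>)
     # summ n W t @ ?B) (config n (\<lambda>v. (G v)\<lparr>key := \<kappa> v\<rparr>)))
      (return_pmf (base n val h m ((Y, freq n val c) # z)))"
  proof (rule apx_exec_append)
    let ?H = "\<lambda>v. (G v)\<lparr>key := \<kappa> v\<rparr>"
    show "apx ((real n)\<^sup>2 * (2 / 3) ^ (2 * t)) (exec n b (spread (2 * t)) (config n ?H))
       (return_pmf (config n (\<lambda>v. (?H v)\<lparr>key := Max ((\<lambda>v. key (?H v)) ` {..<n})\<rparr>)))"
      by (rule spread_apx[OF n]) (simp add: key)
    have "(\<lambda>v. (\<lambda>q. q\<lparr>chosen := key q mod W, key := 0, arg := (\<Sum>i=1..N. local_hits k q i), inbox := {#}\<rparr>)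
       ((?H v)\<lparr>key := Max ((\<lambda>v. key (?H v)) ` {..<n})\<rparr>)) = ?S1"
    proof
      fix v
      have "(\<lambda>q. q\<lparr>chosen := key q mod W, key := 0, arg := (\<Sum>i=1..N. local_hits k q i), inbox := {#}\<rparr>)
         ((?H v)\<lparr>key := Max ((\<lambda>v. key (?H v)) ` {..<n})\<rparr>) = ((G v)\<lparr>key := 0, inbox := {#}\<rparr>)\<lparr>chosen := c, arg := Yv v\<rparr>"
        by (simp add: lh c Yv_def)
      then show "(\<lambda>q. q\<lparr>chosen := key q mod W, key := 0, arg := (\<Sum>i=1..N. local_hits k q i), inbox := {#}\<rparr>)
         ((?H v)\<lparr>key := Max ((\<lambda>v. key (?H v)) ` {..<n})\<rparr>) = ?S1 v"
        by (simp only: G)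
    qed
    then show "apx (?e + (?e + 0)) (exec n b (loc (\<lambda>q. q\<lparr>chosen := key q mod W, key := 0, arg := (\<Sum>i=1..N. local_hits k q i), inbox := {#}\<rparr>)
     # summ n W t @ ?B) (config n (\<lambda>v. (?H v)\<lparr>key := Max ((\<lambda>v. key (?H v)) ` {..<n})\<rparr>)))
      (return_pmf (base n val h m ((Y, freq n val c) # z)))"
      using p2 by (simp only: exec_loc)
  qed auto
  moreover have "(real n)\<^sup>2 * (2 / 3) ^ (2 * t) + (?e + (?e + 0)) = (real n)\<^sup>2 * (2 / 3) ^ (2 * t) + 2 * ?e" by simp
  ultimately show ?thesis unfolding sample_tail_def Y_def Yv_def by (simp only:)
qed

text \<open>There are three sources of error: ties among priorities (\<open>Y / Q\<close>, with
  \<open>Y <= n^(k+1)\<close>), the broadcast of the winning key, and two sums.\<close>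

lemma sample_iter_apx:
  assumes n: "0 < n" and k: "0 < k" and h: "spread_out n g r val h" and r: "r * size (tokens n val) \<le> n"
    and val: "valid_input n N val" and N: "N < W" and Q: "0 < Q" "Q * W \<le> 2 ^ b"
    and W: "W * W \<le> 2 ^ b" "n * n ^ k * 2 ^ t < W"
  shows "apx (real n ^ Suc k / real Q + ((real n)\<^sup>2 * (2 / 3) ^ (2 * t) + 2 * (5 * real n ^ 3 * (real (n ^ k))\<^sup>2 * (1 / 2) ^ t)))
    (exec n b (sample_iter n N k g t W Q) (base n val h m z))
    (map_pmf (\<lambda>x. base n val h m (x # z)) (sample_law n N k g val h))"
proof -
  let ?F = "\<lambda>v. st0 (val v) (h v) m z"
  let ?e = "(real n)\<^sup>2 * (2 / 3) ^ (2 * t) + 2 * (5 * real n ^ 3 * (real (n ^ k))\<^sup>2 * (1 / 2) ^ t)"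
  let ?d = "real n ^ Suc k / real Q"
  let ?tail = "sample_tail n N k t W" and ?sel = "select_rule N k W Q"
  let ?fin = "\<lambda>x. base n val h m (x # z)"
  define G where "G = (\<lambda>\<beta> v. (?F v)\<lparr>inbox := {#} + (\<Sum>l<k. image_mset (\<lambda>x. prod_encode (l, x)) (received n (tok h) g (\<beta> l) v))\<rparr>)"
  have W1: "0 < W" using N by simp
  have valN: "1 \<le> x \<and> x \<le> N" if "x \<in># tokens n val" for x
    using that val unfolding val_in_tokens valid_input_def by fastforce
  have Wb: "W \<le> 2 ^ b" using W(1) W1 by (metis le_trans mult_le_mono1 nat_mult_1 Suc_leI One_nat_def)
  have F: "?F v = (?F v)\<lparr>inbox := (\<lambda>_. {#}) v\<rparr>" for v by (simp add: st0_def)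
  have tk: "(\<lambda>s w. samp_slot s (?F w)) = tok h" by (simp add: fun_eq_iff samp_slot_def tok_def st0_def)
  have ex1: "exec n b (concat (map (\<lambda>l. throw samp_slot l g) [0..<k])) (config n ?F)
     = map_pmf (\<lambda>\<beta>. config n (G \<beta>)) (block_targets n g k)"
  proof -
    have "exec n b (concat (map (\<lambda>l. throw samp_slot l g) [0..<k])) (config n (\<lambda>v. (?F v)\<lparr>inbox := (\<lambda>_. {#}) v\<rparr>))
     = map_pmf (\<lambda>\<beta>. config n (\<lambda>v. (?F v)\<lparr>inbox := (\<lambda>_. {#}) v +
         (\<Sum>l<k. image_mset (\<lambda>x. prod_encode (l, x)) (received n (\<lambda>s w. samp_slot s (?F w)) g (\<beta> l) v))\<rparr>))
       (Pi_pmf {..<k} undefined (\<lambda>_. targets_seq n g))"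
    proof (rule exec_throw_blocks)
      fix s w x assume "s < g" "w < n" "samp_slot s (?F w) = Some x"
      then have "x \<in> set (h w)" by (auto simp: samp_slot_def st0_def split: if_splits)
      then have "x \<le> N" using home_in_tokens[OF h \<open>w < n\<close>] valN by blast
      then show "x < 2 ^ b" using N Wb by linarith
    qed (simp add: samp_slot_def)
    then show ?thesis unfolding tk F[symmetric] by (simp add: G_def block_targets_def)
  qed
  have lh: "local_hits k (G \<beta> v) = hits n h g k \<beta> v" for \<beta> v
    by (rule ext) (simp add: hits_def G_def local_hits_eq[where M = "\<lambda>l. received n (tok h) g (\<beta> l) v"])
  have f0: "freq n val 0 = 0"
    using val by (auto simp: freq_def valid_input_def)
  have rest: "apx (?d + ?e) (exec n b (?sel # ?tail) (config n (G \<beta>)))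
     (map_pmf ?fin (choice_law n N val (\<lambda>i. \<Sum>v<n. hits n h g k \<beta> v i)))"
    if \<beta>: "\<beta> \<in> set_pmf (block_targets n g k)" for \<beta>
  proof -
    let ?P = "Pi_pmf {..<n} 0 (\<lambda>v. key_law N W Q (hits n h g k \<beta> v))"
    define Y where "Y = (\<Sum>v<n. \<Sum>i=1..N. hits n h g k \<beta> v i)"
    have Y': "(\<Sum>i=1..N. \<Sum>v<n. hits n h g k \<beta> v i) = Y" unfolding Y_def by (rule sum.swap)
    have Yle: "Y \<le> n ^ Suc k"
    proof -
      have "Y \<le> (\<Sum>v<n. n ^ k)" unfolding Y_def by (intro sum_mono sum_hits_le[OF n h \<beta> r _ k]) auto
      then show ?thesis by simp
    qed
    have "step n b ?sel (config n (G \<beta>))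
       = Pi_pmf {..<n} undefined (\<lambda>v. map_pmf (\<lambda>x. (G \<beta> v)\<lparr>key := x\<rparr>) (key_law N W Q (hits n h g k \<beta> v)))"
      unfolding select_rule_def step.simps by (intro Pi_pmf_cong) (auto simp: lh)
    also have "\<dots> = map_pmf (\<lambda>\<kappa>. config n (\<lambda>v. (G \<beta> v)\<lparr>key := \<kappa> v\<rparr>)) ?P"
      by (rule Pi_pmf_map_config)
    finally have ex2: "exec n b (?sel # ?tail) (config n (G \<beta>))
       = bind_pmf ?P (\<lambda>\<kappa>. exec n b ?tail (config n (\<lambda>v. (G \<beta> v)\<lparr>key := \<kappa> v\<rparr>)))"
      by (simp add: exec.simps(2) bind_map_pmf)
    have tl: "apx ?e (exec n b ?tail (config n (\<lambda>v. (G \<beta> v)\<lparr>key := \<kappa> v\<rparr>)))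
        (return_pmf (?fin (Y, freq n val (Max (\<kappa> ` {..<n}) mod W))))" if \<kappa>: "\<kappa> \<in> set_pmf ?P" for \<kappa>
    proof -
      have kb: "\<kappa> v < 2 ^ b" if "v < n" for v
      proof -
        have "\<kappa> v \<in> set_pmf (key_law N W Q (hits n h g k \<beta> v))"
          using \<kappa> that by (auto simp: set_Pi_pmf PiE_dflt_def)
        then show ?thesis using set_key_law[OF Q(1) N] Q(2) by (meson less_le_trans)
      qed
      show ?thesis unfolding Y_def lh[symmetric]
        by (rule tail_apx[OF n W kb])
           (use sum_hits_le[OF n h \<beta> r _ k] in \<open>auto simp: lh\<close>, simp add: G_def st0_def)
    qed
    have b1: "apx (0 + ?e) (bind_pmf ?P (\<lambda>\<kappa>. exec n b ?tail (config n (\<lambda>v. (G \<beta> v)\<lparr>key := \<kappa> v\<rparr>))))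
        (bind_pmf ?P (\<lambda>\<kappa>. return_pmf (?fin (Y, freq n val (Max (\<kappa> ` {..<n}) mod W)))))"
      by (rule apx_bind[OF apx_refl]) (use tl in auto)
    have b2: "apx ?d (bind_pmf ?P (\<lambda>\<kappa>. return_pmf (?fin (Y, freq n val (Max (\<kappa> ` {..<n}) mod W)))))
       (map_pmf ?fin (choice_law n N val (\<lambda>i. \<Sum>v<n. hits n h g k \<beta> v i)))"
    proof (cases "Y = 0")
      \<comment> \<open>Without hits all keys are 0, so the decoded value is 0, which no node holds;
        this agrees with the default \<open>(0, 0)\<close> of \<open>choice_law\<close>.\<close>
      case True
      have "(\<Sum>i=1..N. hits n h g k \<beta> v i) = 0" if "v < n" for v
        using True that unfolding Y_def by auto
      then have "?P = Pi_pmf {..<n} 0 (\<lambda>v. return_pmf 0)"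
        by (intro Pi_pmf_cong) (simp_all add: key_law_def)
      then have P: "?P = return_pmf (\<lambda>_. 0)" by simp
      have "Max ((\<lambda>_. 0::nat) ` {..<n}) = 0" using lessThan_nonempty[OF n] by (simp add: image_constant_conv)
      moreover have "choice_law n N val (\<lambda>i. \<Sum>v<n. hits n h g k \<beta> v i) = return_pmf (0, 0)"
        unfolding choice_law_def Y' using True by simp
      ultimately have "bind_pmf ?P (\<lambda>\<kappa>. return_pmf (?fin (Y, freq n val (Max (\<kappa> ` {..<n}) mod W))))
         = map_pmf ?fin (choice_law n N val (\<lambda>i. \<Sum>v<n. hits n h g k \<beta> v i))"
        unfolding P by (simp add: bind_return_pmf True f0)
      then show ?thesis by (simp only:) (rule apx_mono[OF apx_refl], simp)
    next
      case False
      have "real Y \<le> real (n ^ Suc k)" using Yle by (simp only: of_nat_le_iff)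
      then have "real Y / real Q \<le> ?d" by (intro divide_right_mono) auto
      then have "apx ?d (map_pmf (\<lambda>\<kappa>. Max (\<kappa> ` {..<n}) mod W) ?P) (wchoice N (\<lambda>i. \<Sum>v<n. hits n h g k \<beta> v i))"
        by (intro select_apx[OF Q(1) N Y_def]) (use False in auto)
      from apx_map[OF this, of "\<lambda>i. ?fin (Y, freq n val i)"]
      show ?thesis using False unfolding choice_law_def Y' by (simp add: pmf.map_comp comp_def map_pmf_def bind_assoc_pmf bind_return_pmf)
    qed
    have "apx (0 + ?e + ?d) (bind_pmf ?P (\<lambda>\<kappa>. exec n b ?tail (config n (\<lambda>v. (G \<beta> v)\<lparr>key := \<kappa> v\<rparr>))))
       (map_pmf ?fin (choice_law n N val (\<lambda>i. \<Sum>v<n. hits n h g k \<beta> v i)))"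
      by (rule apx_trans[OF b1 b2]) auto
    moreover have "0 + ?e + ?d = ?d + ?e" by simp
    ultimately show ?thesis unfolding ex2 by (simp only:)
  qed
  have "apx (0 + (?d + ?e)) (bind_pmf (block_targets n g k) (\<lambda>\<beta>. exec n b (?sel # ?tail) (config n (G \<beta>))))
     (bind_pmf (block_targets n g k) (\<lambda>\<beta>. map_pmf ?fin (choice_law n N val (\<lambda>i. \<Sum>v<n. hits n h g k \<beta> v i))))"
    by (rule apx_bind[OF apx_refl]) (use rest in auto)
  then show ?thesis
    unfolding sample_iter_def exec_append ex1 bind_map_pmf sample_law_def map_bind_pmf by simp
qed

section \<open>Moments of the estimator\<close>

lemma expectation_bind_nonneg:
  fixes f :: "'b \<Rightarrow> real"
  assumes M: "finite (set_pmf M)" and K: "\<And>x. x \<in> set_pmf M \<Longrightarrow> finite (set_pmf (K x))" and f: "\<And>x. 0 \<le> f x"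
  shows "expect (bind_pmf M K) f = expect M (\<lambda>x. expect (K x) f)"
proof -
  have nn: "0 \<le> expect R f" for R by (simp add: f Bochner_Integration.integral_nonneg)
  have "ennreal (expect (bind_pmf M K) f) = (\<integral>\<^sup>+x. ennreal (f x) \<partial>bind_pmf M K)"
    using M K f by (intro nn_integral_eq_expectation[symmetric]) auto
  also have "\<dots> = (\<integral>\<^sup>+x. (\<integral>\<^sup>+y. ennreal (f y) \<partial>K x) \<partial>M)" by simp
  also have "\<dots> = (\<integral>\<^sup>+x. ennreal (expect (K x) f) \<partial>M)"
    using K f by (intro nn_integral_cong_AE AE_pmfI nn_integral_eq_expectation) auto
  also have "\<dots> = ennreal (expect M (\<lambda>x. expect (K x) f))"
    using M nn by (intro nn_integral_eq_expectation) auto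
  finally show ?thesis using nn by (simp add: Bochner_Integration.integral_nonneg)
qed

lemma expectation_targets_seq_coordinate:
  fixes f :: "(nat \<Rightarrow> nat) \<Rightarrow> real"
  assumes "s < g"
  shows "expect (targets_seq n g) (\<lambda>\<tau>. f (\<tau> s)) = E n f"
proof -
  have "expect (targets_seq n g) (\<lambda>\<tau>. f (\<tau> s)) = expect (map_pmf (\<lambda>\<tau>. \<tau> s) (targets_seq n g)) f"
    by simp
  also have "map_pmf (\<lambda>\<tau>. \<tau> s) (targets_seq n g) = uniform_targets n"
    unfolding targets_seq_def using assms by (subst Pi_pmf_component) auto
  finally show ?thesis .
qed

lemma sum_indicator_single: "v < n \<Longrightarrow> (\<Sum>u<n. indicator {v} u :: real) = 1" for v n :: nat
  by (simp add: indicator_def of_bool_def)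

lemma expectation_hit:
  assumes "0 < n" "s < g" "w < n" "v < n"
  shows "expect (targets_seq n g) (\<lambda>\<tau>. indicator {v} (\<tau> s w)) = 1 / real n"
  using assms by (subst expectation_targets_seq_coordinate[where f = "\<lambda>t. indicator {v} (t w)"])
    (simp_all add: expectation_target sum_indicator_single)

text \<open>Two slots in the same round are two coordinates of one target vector; slots in different
  rounds belong to two independent vectors.\<close>

lemma expectation_two_hits:
  assumes n: "0 < n" and s: "s < g" "s' < g" and w: "w < n" "w' < n" and v: "v < n" "v' < n" and ne: "(s, w) \<noteq> (s', w')"
  shows "expect (targets_seq n g) (\<lambda>\<tau>. indicator {v} (\<tau> s w) * indicator {v'} (\<tau> s' w')) = 1 / (real n)\<^sup>2"
proof (cases "s = s'")
  case True
  then have "w \<noteq> w'" using ne by simp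
  then have "E n (\<lambda>t. indicator {v} (t w) * indicator {v'} (t w')) = 1 / (real n)\<^sup>2"
    using n w v by (subst expectation_two_targets) (auto simp: sum_indicator_single power2_eq_square)
  then show ?thesis
    using expectation_targets_seq_coordinate[OF s(1), where f = "\<lambda>t. indicator {v} (t w) * indicator {v'} (t w')"] True by simp
next
  case False
  have "expect (targets_seq n g) (\<lambda>\<tau>. indicator {v} (\<tau> s w) * indicator {v'} (\<tau> s' w'))
    = E n (\<lambda>t. indicator {v} (t w) :: real) * E n (\<lambda>t. indicator {v'} (t w'))"
    unfolding targets_seq_def using False s n
    by (intro expectation_two_coordinates[where f = "\<lambda>t. indicator {v} (t w)" and g = "\<lambda>t. indicator {v'} (t w')"])
       (auto simp: finite_uniform_targets)
  also have "\<dots> = 1 / real n * (1 / real n)"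
    using n w v by (simp add: expectation_target sum_indicator_single)
  finally show ?thesis by (simp add: power2_eq_square)
qed

text \<open>A token of value \<open>i\<close> is identified by the round in which and the node from
  which it is thrown.\<close>

definition slots :: "nat \<Rightarrow> (nat \<Rightarrow> nat list) \<Rightarrow> nat \<Rightarrow> nat \<Rightarrow> (nat \<times> nat) set" where
  "slots n h g i = {(s, w). s < g \<and> w < n \<and> tok h s w = Some i}"

lemma finite_slots: "finite (slots n h g i)"
  by (rule finite_subset[of _ "{..<g} \<times> {..<n}"]) (auto simp: slots_def)

lemma count_received:
  "real (count (received n (tok h) g \<tau> v) i) = (\<Sum>(s, w)\<in>slots n h g i. indicator {v} (\<tau> s w))"
proof -
  have "real (count (received n (tok h) g \<tau> v) i)
     = (\<Sum>s<g. \<Sum>w<n. if tok h s w = Some i then indicator {v} (\<tau> s w) else 0)"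
    unfolding received_def count_sum_set of_nat_sum
    by (intro sum.cong refl) (auto simp: opt_mset_def split: option.split)
  also have "\<dots> = (\<Sum>(s, w)\<in>{..<g} \<times> {..<n}. if tok h s w = Some i then indicator {v} (\<tau> s w) else 0)"
    by (simp add: sum.cartesian_product)
  also have "\<dots> = (\<Sum>(s, w)\<in>slots n h g i. indicator {v} (\<tau> s w))"
    by (rule sum.mono_neutral_cong_right) (auto simp: slots_def split: if_splits)
  finally show ?thesis .
qed

lemma count_tokens: "count (tokens n val) i = freq n val i"
  unfolding tokens_def count_sum_set freq_eq_sum
  by (intro sum.cong refl) (auto simp: opt_mset_def split: option.split)

lemma card_slots:
  assumes "spread_out n g r val h"
  shows "card (slots n h g i) = r * freq n val i"
proof -
  have "card (slots n h g i) = (\<Sum>(s, w)\<in>{..<g} \<times> {..<n}. count (opt_mset (tok h s w)) i)"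
  proof -
    have "slots n h g i = ({..<g} \<times> {..<n}) \<inter> {x. tok h (fst x) (snd x) = Some i}"
      by (auto simp: slots_def)
    then have "card (slots n h g i) = (\<Sum>x\<in>{..<g} \<times> {..<n}. if tok h (fst x) (snd x) = Some i then 1 else 0)"
      by (simp add: sum.If_cases)
    also have "\<dots> = (\<Sum>(s, w)\<in>{..<g} \<times> {..<n}. count (opt_mset (tok h s w)) i)"
      by (intro sum.cong refl) (auto simp: opt_mset_def split: option.split)
    finally show ?thesis .
  qed
  also have "\<dots> = count (\<Sum>w<n. \<Sum>s<g. opt_mset (tok h s w)) i"
    unfolding count_sum_set by (subst sum.swap) (simp add: sum.cartesian_product)
  also have "(\<Sum>w<n. \<Sum>s<g. opt_mset (tok h s w)) = (\<Sum>w<n. mset (h w))"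
    using assms unfolding tok_def spread_out_def by (intro sum.cong refl sum_slots) auto
  also have "\<dots> = repeat_mset r (tokens n val)" using assms by (simp add: spread_out_def)
  finally show ?thesis by (simp add: count_tokens)
qed

lemma slots_disjoint: "i \<noteq> i' \<Longrightarrow> slots n h g i \<inter> slots n h g i' = {}"
  by (auto simp: slots_def)

abbreviation (input) rcv :: "nat \<Rightarrow> (nat \<Rightarrow> nat list) \<Rightarrow> nat \<Rightarrow> (nat \<Rightarrow> nat \<Rightarrow> nat) \<Rightarrow> nat \<Rightarrow> nat \<Rightarrow> real" where
  "rcv n h g \<tau> v i \<equiv> real (count (received n (tok h) g \<tau> v) i)"

lemma expectation_count:
  assumes "0 < n" "v < n"
  shows "expect (targets_seq n g) (\<lambda>\<tau>. rcv n h g \<tau> v i) = real (card (slots n h g i)) / real n"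
proof -
  have "expect (targets_seq n g) (\<lambda>\<tau>. rcv n h g \<tau> v i)
    = (\<Sum>x\<in>slots n h g i. expect (targets_seq n g) (\<lambda>\<tau>. indicator {v} (\<tau> (fst x) (snd x))))"
    unfolding count_received case_prod_beta using assms
    by (intro Bochner_Integration.integral_sum integrable_measure_pmf_finite finite_targets_seq)
  also have "\<dots> = (\<Sum>x\<in>slots n h g i. 1 / real n)"
    using assms by (intro sum.cong refl expectation_hit) (auto simp: slots_def)
  finally show ?thesis by simp
qed

text \<open>Distinct slots hit independently. A slot is shared by both counts only if the values
  agree, and it hits both nodes only if these are equal.\<close>

lemma expectation_count_product:
  assumes n: "0 < n" and v: "v < n" "v' < n"
  shows "expect (targets_seq n g) (\<lambda>\<tau>. rcv n h g \<tau> v i * rcv n h g \<tau> v' i')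
    \<le> real (card (slots n h g i)) * real (card (slots n h g i')) / (real n)\<^sup>2
      + (if v = v' \<and> i = i' then real (card (slots n h g i)) / real n else 0)"
proof -
  let ?E = "expect (targets_seq n g)"
  let ?S = "slots n h g"
  let ?I = "\<lambda>\<tau> x y. indicator {v} (\<tau> (fst x) (snd x)) * indicator {v'} (\<tau> (fst y) (snd y)) :: real"
  have "?E (\<lambda>\<tau>. rcv n h g \<tau> v i * rcv n h g \<tau> v' i') = (\<Sum>x\<in>?S i. \<Sum>y\<in>?S i'. ?E (\<lambda>\<tau>. ?I \<tau> x y))"
    unfolding count_received case_prod_beta sum_product using n
    by (simp add: Bochner_Integration.integral_sum integrable_measure_pmf_finite finite_targets_seq)
  also have "\<dots> \<le> (\<Sum>x\<in>?S i. \<Sum>y\<in>?S i'. 1 / (real n)\<^sup>2 + (if x = y \<and> v = v' then 1 / real n else 0))"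
  proof (intro sum_mono)
    fix x y assume xy: "x \<in> ?S i" "y \<in> ?S i'"
    show "?E (\<lambda>\<tau>. ?I \<tau> x y) \<le> 1 / (real n)\<^sup>2 + (if x = y \<and> v = v' then 1 / real n else 0)"
    proof (cases "x = y")
      case True
      show ?thesis
      proof (cases "v = v'")
        case True
        have "(\<lambda>\<tau>. ?I \<tau> x y) = (\<lambda>\<tau>. indicator {v} (\<tau> (fst x) (snd x)))"
          using \<open>x = y\<close> True by (auto simp: indicator_def)
        then have "?E (\<lambda>\<tau>. ?I \<tau> x y) = 1 / real n"
          using xy n v by (simp only:) (intro expectation_hit, auto simp: slots_def)
        then show ?thesis using \<open>x = y\<close> True by simp
      next
        case False
        then have "(\<lambda>\<tau>. ?I \<tau> x y) = (\<lambda>_. 0)" using \<open>x = y\<close> by (auto simp: indicator_def)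
        then show ?thesis using False by simp
      qed
    next
      case False
      have "?E (\<lambda>\<tau>. ?I \<tau> x y) = 1 / (real n)\<^sup>2"
        using xy n v False by (intro expectation_two_hits) (auto simp: slots_def)
      then show ?thesis using False by simp
    qed
  qed
  also have "\<dots> = real (card (?S i)) * real (card (?S i')) / (real n)\<^sup>2
      + (\<Sum>x\<in>?S i. \<Sum>y\<in>?S i'. if x = y \<and> v = v' then 1 / real n else 0)"
    by (simp add: sum.distrib)
  also have "(\<Sum>x\<in>?S i. \<Sum>y\<in>?S i'. if x = y \<and> v = v' then 1 / real n else 0)
    = (if v = v' \<and> i = i' then real (card (?S i)) / real n else 0)"
  proof (cases "v = v' \<and> i = i'")
    case True
    then show ?thesis by (simp add: finite_slots)
  next
    case False
    then have "\<not> (x = y \<and> v = v')" if "x \<in> ?S i" "y \<in> ?S i'" for x y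
      using that slots_disjoint[of i i' n h g] by auto
    then have "(\<Sum>x\<in>?S i. \<Sum>y\<in>?S i'. if x = y \<and> v = v' then 1 / real n else 0) = (\<Sum>x\<in>?S i. \<Sum>y\<in>?S i'. 0::real)"
      by (intro sum.cong refl) auto
    then show ?thesis using False by auto
  qed
  finally show ?thesis .
qed

lemma expectation_blocks:
  fixes f :: "(nat \<Rightarrow> nat \<Rightarrow> nat) \<Rightarrow> real"
  assumes "0 < n" "\<And>\<tau>. 0 \<le> f \<tau>"
  shows "expect (block_targets n g k) (\<lambda>\<beta>. \<Prod>l<k. f (\<beta> l)) = expect (targets_seq n g) f ^ k"
  unfolding block_targets_def using assms
  by (subst expectation_prod_Pi_pmf) (auto intro!: integrable_measure_pmf_finite finite_targets_seq)

lemma finite_block_targets: "0 < n \<Longrightarrow> finite (set_pmf (block_targets n g k))"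
  unfolding block_targets_def by (intro finite_set_pmf_Pi finite_targets_seq) auto

lemma expectation_hits:
  assumes n: "0 < n" and v: "v < n"
  shows "expect (block_targets n g k) (\<lambda>\<beta>. real (hits n h g k \<beta> v i)) = (real (card (slots n h g i)) / real n) ^ k"
  unfolding hits_def of_nat_prod
  using expectation_blocks[OF n, of "\<lambda>\<tau>. rcv n h g \<tau> v i" g k] n v by (simp add: expectation_count)

text \<open>Independent blocks turn the expectation into a \<open>k\<close>-th power. On the
  diagonal, \<open>card (slots n h g i) <= n\<close> bounds both summands by the same quantity,
  whence the factor 2 under the power.\<close>

lemma expectation_hits_product:
  assumes n: "0 < n" and v: "v < n" "v' < n" and c: "card (slots n h g i) \<le> n"
  shows "expect (block_targets n g k) (\<lambda>\<beta>. real (hits n h g k \<beta> v i) * real (hits n h g k \<beta> v' i'))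
    \<le> (real (card (slots n h g i)) * real (card (slots n h g i')) / (real n)\<^sup>2) ^ k
      + (if v = v' \<and> i = i' then (2 * real (card (slots n h g i)) / real n) ^ k else 0)"
proof -
  let ?c = "real (card (slots n h g i))" and ?c' = "real (card (slots n h g i'))"
  let ?e = "expect (targets_seq n g) (\<lambda>\<tau>. rcv n h g \<tau> v i * rcv n h g \<tau> v' i')"
  have "expect (block_targets n g k) (\<lambda>\<beta>. real (hits n h g k \<beta> v i) * real (hits n h g k \<beta> v' i')) = ?e ^ k"
    unfolding hits_def of_nat_prod prod.distrib[symmetric]
    using expectation_blocks[OF n, of "\<lambda>\<tau>. rcv n h g \<tau> v i * rcv n h g \<tau> v' i'" g k] by simp
  also have "\<dots> \<le> (?c * ?c' / (real n)\<^sup>2 + (if v = v' \<and> i = i' then ?c / real n else 0)) ^ k"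
    by (intro power_mono expectation_count_product n v) (simp add: Bochner_Integration.integral_nonneg)
  also have "\<dots> \<le> (?c * ?c' / (real n)\<^sup>2) ^ k + (if v = v' \<and> i = i' then (2 * ?c / real n) ^ k else 0)"
  proof (cases "v = v' \<and> i = i'")
    case True
    then have [simp]: "v' = v" "i' = i" by auto
    have "?c * ?c / (real n)\<^sup>2 \<le> ?c * real n / (real n)\<^sup>2"
      using c by (intro divide_right_mono mult_left_mono) auto
    also have "\<dots> = ?c / real n" using n by (simp add: power2_eq_square)
    finally have "(?c * ?c / (real n)\<^sup>2 + ?c / real n) ^ k \<le> (2 * ?c / real n) ^ k"
      by (intro power_mono) auto
    from add_increasing[OF _ this, of "(?c * ?c / (real n)\<^sup>2) ^ k"] show ?thesis by simp
  next
    case False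
    then show ?thesis by auto
  qed
  finally show ?thesis .
qed

definition est :: "real \<Rightarrow> nat \<times> nat \<Rightarrow> real" where
  "est q x = real (fst x) * real (snd x) powr q"

lemma expectation_choice_law:
  assumes F: "F (0, 0) = 0"
  shows "expect (choice_law n N val y) F
     = (if (\<Sum>i=1..N. y i) = 0 then 0 else (\<Sum>i=1..N. real (y i) * F (\<Sum>i=1..N. y i, freq n val i)) / real (\<Sum>i=1..N. y i))"
proof (cases "(\<Sum>i=1..N. y i) = 0")
  case True
  then show ?thesis unfolding choice_law_def by (simp only: if_True F) (simp add: F)
next
  case False
  then have pos: "0 < (\<Sum>i=1..N. y i)" by (simp only: neq0_conv)
  show ?thesis unfolding choice_law_def if_not_P[OF False]
    by (simp only: integral_map_pmf expectation_wchoice[OF pos])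
qed

lemma finite_choice_law: "finite (set_pmf (choice_law n N val y))"
proof (cases "(\<Sum>i=1..N. y i) = 0")
  case True
  then show ?thesis unfolding choice_law_def by (simp only: if_True) simp
next
  case False
  then have pos: "0 < (\<Sum>i=1..N. y i)" by (simp only: neq0_conv)
  show ?thesis unfolding choice_law_def if_not_P[OF False]
    using finite_subset[OF set_wchoice[OF pos]] by simp
qed

lemma finite_sample_law: "0 < n \<Longrightarrow> finite (set_pmf (sample_law n N k g val h))"
  unfolding sample_law_def by (simp add: finite_block_targets finite_choice_law)

text \<open>Given the throws, the factor \<open>Y\<close> of the estimate cancels the denominator of
  the choice probability, and what remains is linear in the hits.\<close>

lemma sample_mean:
  assumes n: "0 < n" and h: "spread_out n g r val h"
  shows "expect (sample_law n N k g val h) (est q)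
    = real n * (\<Sum>i=1..N. (real (r * freq n val i) / real n) ^ k * real (freq n val i) powr q)"
proof -
  let ?B = "block_targets n g k"
  let ?y = "\<lambda>\<beta> i. \<Sum>v<n. hits n h g k \<beta> v i"
  have "expect (sample_law n N k g val h) (est q)
     = expect ?B (\<lambda>\<beta>. expect (choice_law n N val (?y \<beta>)) (est q))"
    unfolding sample_law_def using n
    by (intro expectation_bind_nonneg finite_block_targets finite_choice_law) (auto simp: est_def)
  also have "(\<lambda>\<beta>. expect (choice_law n N val (?y \<beta>)) (est q))
     = (\<lambda>\<beta>. \<Sum>i=1..N. \<Sum>v<n. real (hits n h g k \<beta> v i) * real (freq n val i) powr q)"
  proof
    fix \<beta>
    let ?Y = "\<Sum>i=1..N. ?y \<beta> i"
    have "expect (choice_law n N val (?y \<beta>)) (est q)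
      = (if ?Y = 0 then 0 else (\<Sum>i=1..N. real (?y \<beta> i) * est q (?Y, freq n val i)) / real ?Y)"
      by (rule expectation_choice_law) (simp add: est_def)
    also have "\<dots> = (\<Sum>i=1..N. real (?y \<beta> i) * real (freq n val i) powr q)"
    proof (cases "?Y = 0")
      case True
      then have "?y \<beta> i = 0" if "i \<in> {1..N}" for i using that by (metis (no_types, lifting) finite_atLeastAtMost sum_eq_0_iff)
      then have "(\<Sum>i=1..N. real (?y \<beta> i) * real (freq n val i) powr q) = 0" by (intro sum.neutral ballI) (simp only: of_nat_0 mult_zero_left)
      then show ?thesis unfolding if_P[OF True] by (rule sym)
    next
      case False
      have eq: "(\<Sum>i=1..N. real (?y \<beta> i) * est q (?Y, freq n val i)) = real ?Y * (\<Sum>i=1..N. real (?y \<beta> i) * real (freq n val i) powr q)"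
        by (simp only: est_def fst_conv snd_conv sum_distrib_left) (intro sum.cong refl, simp only: mult_ac)
      have ne: "real ?Y \<noteq> 0" using False by (simp only: of_nat_eq_0_iff not_False_eq_True)
      show ?thesis unfolding if_not_P[OF False] eq by (rule nonzero_mult_div_cancel_left[OF ne])
    qed
    finally show "expect (choice_law n N val (?y \<beta>)) (est q)
      = (\<Sum>i=1..N. \<Sum>v<n. real (hits n h g k \<beta> v i) * real (freq n val i) powr q)"
      by (simp add: sum_distrib_right)
  qed
  also have "expect ?B (\<lambda>\<beta>. \<Sum>i=1..N. \<Sum>v<n. real (hits n h g k \<beta> v i) * real (freq n val i) powr q)
     = (\<Sum>i=1..N. \<Sum>v<n. expect ?B (\<lambda>\<beta>. real (hits n h g k \<beta> v i)) * real (freq n val i) powr q)"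
    using n by (simp add: Bochner_Integration.integral_sum integrable_measure_pmf_finite finite_block_targets)
  also have "\<dots> = (\<Sum>i=1..N. \<Sum>v<n. (real (r * freq n val i) / real n) ^ k * real (freq n val i) powr q)"
    using n by (intro sum.cong refl) (simp add: expectation_hits card_slots[OF h])
  finally show ?thesis by (simp add: sum_distrib_left mult.assoc)
qed

text \<open>One of the two factors \<open>Y\<close> cancels as for the mean, leaving a sum over
  pairs of hits. The first summand comes from all pairs, the second from those in the same node with
  the same value.\<close>

lemma sample_second_moment:
  assumes n: "0 < n" and h: "spread_out n g r val h" and c: "\<And>i. r * freq n val i \<le> n"
  shows "expect (sample_law n N k g val h) (\<lambda>x. (est q x)\<^sup>2)
    \<le> (real n)\<^sup>2 * (\<Sum>i=1..N. (real (r * freq n val i) / real n) ^ k) * (\<Sum>i=1..N. (real (r * freq n val i) / real n) ^ k * (real (freq n val i) powr q)\<^sup>2)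
      + real n * 2 ^ k * (\<Sum>i=1..N. (real (r * freq n val i) / real n) ^ k * (real (freq n val i) powr q)\<^sup>2)"
proof -
  let ?B = "block_targets n g k"
  let ?y = "\<lambda>\<beta> i. \<Sum>v<n. hits n h g k \<beta> v i"
  let ?w = "\<lambda>i. (real (freq n val i) powr q)\<^sup>2"
  let ?a = "\<lambda>i. (real (r * freq n val i) / real n) ^ k"
  have "expect (sample_law n N k g val h) (\<lambda>x. (est q x)\<^sup>2)
     = expect ?B (\<lambda>\<beta>. expect (choice_law n N val (?y \<beta>)) (\<lambda>x. (est q x)\<^sup>2))"
    unfolding sample_law_def using n
    by (intro expectation_bind_nonneg finite_block_targets finite_choice_law) auto
  also have "(\<lambda>\<beta>. expect (choice_law n N val (?y \<beta>)) (\<lambda>x. (est q x)\<^sup>2))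
     = (\<lambda>\<beta>. \<Sum>i=1..N. \<Sum>v<n. \<Sum>i'=1..N. \<Sum>v'<n. real (hits n h g k \<beta> v i) * real (hits n h g k \<beta> v' i') * ?w i)"
  proof
    fix \<beta>
    let ?Y = "\<Sum>i=1..N. ?y \<beta> i"
    have "expect (choice_law n N val (?y \<beta>)) (\<lambda>x. (est q x)\<^sup>2)
      = (if ?Y = 0 then 0 else (\<Sum>i=1..N. real (?y \<beta> i) * (est q (?Y, freq n val i))\<^sup>2) / real ?Y)"
      by (rule expectation_choice_law) (simp add: est_def)
    also have "\<dots> = (\<Sum>i=1..N. real (?y \<beta> i) * real ?Y * ?w i)"
    proof (cases "?Y = 0")
      case True
      then show ?thesis unfolding if_P[OF True] by (simp only: True of_nat_0 mult_zero_right mult_zero_left sum.neutral_const)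
    next
      case False
      have eq: "(\<Sum>i=1..N. real (?y \<beta> i) * (est q (?Y, freq n val i))\<^sup>2) = real ?Y * (\<Sum>i=1..N. real (?y \<beta> i) * real ?Y * ?w i)"
        by (simp only: est_def fst_conv snd_conv sum_distrib_left power2_eq_square) (intro sum.cong refl, simp only: mult_ac)
      have ne: "real ?Y \<noteq> 0" using False by (simp only: of_nat_eq_0_iff not_False_eq_True)
      show ?thesis unfolding if_not_P[OF False] eq by (rule nonzero_mult_div_cancel_left[OF ne])
    qed
    also have "\<dots> = (\<Sum>i=1..N. \<Sum>v<n. \<Sum>i'=1..N. \<Sum>v'<n. real (hits n h g k \<beta> v i) * real (hits n h g k \<beta> v' i') * ?w i)"
    proof -
      have 1: "real (?y \<beta> i) * c * d = (\<Sum>v<n. real (hits n h g k \<beta> v i) * c * d)" for i c d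
        by (simp only: of_nat_sum sum_distrib_right)
      have 2: "c * real ?Y * d = (\<Sum>i'=1..N. \<Sum>v'<n. c * real (hits n h g k \<beta> v' i') * d)" for c d
        by (simp only: of_nat_sum sum_distrib_left sum_distrib_right)
      have "(\<Sum>i=1..N. real (?y \<beta> i) * real ?Y * ?w i) = (\<Sum>i=1..N. \<Sum>v<n. real (hits n h g k \<beta> v i) * real ?Y * ?w i)"
        by (intro sum.cong refl 1)
      also have "\<dots> = (\<Sum>i=1..N. \<Sum>v<n. \<Sum>i'=1..N. \<Sum>v'<n. real (hits n h g k \<beta> v i) * real (hits n h g k \<beta> v' i') * ?w i)"
        by (intro sum.cong refl 2)
      finally show ?thesis .
    qed
    finally show "expect (choice_law n N val (?y \<beta>)) (\<lambda>x. (est q x)\<^sup>2)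
      = (\<Sum>i=1..N. \<Sum>v<n. \<Sum>i'=1..N. \<Sum>v'<n. real (hits n h g k \<beta> v i) * real (hits n h g k \<beta> v' i') * ?w i)" .
  qed
  also have "expect ?B (\<lambda>\<beta>. \<Sum>i=1..N. \<Sum>v<n. \<Sum>i'=1..N. \<Sum>v'<n. real (hits n h g k \<beta> v i) * real (hits n h g k \<beta> v' i') * ?w i)
     = (\<Sum>i=1..N. \<Sum>v<n. \<Sum>i'=1..N. \<Sum>v'<n. expect ?B (\<lambda>\<beta>. real (hits n h g k \<beta> v i) * real (hits n h g k \<beta> v' i')) * ?w i)"
    using n by (simp add: Bochner_Integration.integral_sum integrable_measure_pmf_finite finite_block_targets)
  also have "\<dots> \<le> (\<Sum>i=1..N. \<Sum>v<n. \<Sum>i'=1..N. \<Sum>v'<n. (?a i * ?a i' + (if v = v' then if i = i' then 2 ^ k * ?a i else 0 else 0)) * ?w i)"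
  proof (intro sum_mono mult_right_mono)
    fix i v i' v' assume "v \<in> {..<n}" "v' \<in> {..<n}"
    then have "expect ?B (\<lambda>\<beta>. real (hits n h g k \<beta> v i) * real (hits n h g k \<beta> v' i'))
       \<le> (real (r * freq n val i) * real (r * freq n val i') / (real n)\<^sup>2) ^ k
         + (if v = v' \<and> i = i' then (2 * real (r * freq n val i) / real n) ^ k else 0)"
      using expectation_hits_product[OF n, of v v' h g i k i'] c[of i] by (simp only: card_slots[OF h]) simp
    also have "\<dots> = ?a i * ?a i' + (if v = v' then if i = i' then 2 ^ k * ?a i else 0 else 0)"
      by (simp add: power_mult_distrib power_divide power2_eq_square)
    finally show "expect ?B (\<lambda>\<beta>. real (hits n h g k \<beta> v i) * real (hits n h g k \<beta> v' i'))
       \<le> ?a i * ?a i' + (if v = v' then if i = i' then 2 ^ k * ?a i else 0 else 0)" .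
  qed simp
  also have "\<dots> = (\<Sum>i=1..N. \<Sum>v<n. (real n * (\<Sum>i'=1..N. ?a i')) * (?a i * ?w i) + 2 ^ k * (?a i * ?w i))"
  proof (intro sum.cong refl)
    fix i v assume i: "i \<in> {1..N}" and v: "v \<in> {..<n}"
    have "(\<Sum>i'=1..N. \<Sum>v'<n. (?a i * ?a i' + (if v = v' then if i = i' then 2 ^ k * ?a i else 0 else 0)) * ?w i)
       = (\<Sum>i'=1..N. \<Sum>v'<n. ?a i * ?a i' + (if v = v' then if i = i' then 2 ^ k * ?a i else 0 else 0)) * ?w i"
      by (simp only: sum_distrib_right)
    also have "(\<Sum>i'=1..N. \<Sum>v'<n. ?a i * ?a i' + (if v = v' then if i = i' then 2 ^ k * ?a i else 0 else 0))
       = (\<Sum>i'=1..N. real n * (?a i * ?a i') + (if i = i' then 2 ^ k * ?a i else 0))"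
      using v by (intro sum.cong refl) (simp add: sum.distrib)
    also have "\<dots> = real n * (\<Sum>i'=1..N. ?a i') * ?a i + 2 ^ k * ?a i"
      using i by (simp add: sum.distrib sum_distrib_left sum_distrib_right mult_ac)
    finally show "(\<Sum>i'=1..N. \<Sum>v'<n. (?a i * ?a i' + (if v = v' then if i = i' then 2 ^ k * ?a i else 0 else 0)) * ?w i)
       = (real n * (\<Sum>i'=1..N. ?a i')) * (?a i * ?w i) + 2 ^ k * (?a i * ?w i)"
      by (simp only: distrib_right mult.assoc)
  qed
  also have "\<dots> = (\<Sum>i=1..N. (real n * real n * (\<Sum>i'=1..N. ?a i') + real n * 2 ^ k) * (?a i * ?w i))"
    by (intro sum.cong refl) (simp add: algebra_simps)
  also have "\<dots> = (real n)\<^sup>2 * (\<Sum>i=1..N. ?a i) * (\<Sum>i=1..N. ?a i * ?w i) + real n * 2 ^ k * (\<Sum>i=1..N. ?a i * ?w i)"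
    by (simp only: distrib_right sum.distrib sum_distrib_left[symmetric] power2_eq_square)
  finally show ?thesis .
qed

text \<open>Weaker than the power mean inequality by a factor \<open>2 ^ k\<close>. It follows from
  \<open>\<theta> ^ (k - 1) * (x - \<theta>) \<le> x ^ k\<close>.\<close>

lemma power_sum_lower:
  fixes f :: "'a \<Rightarrow> real"
  assumes V: "finite V" "V \<noteq> {}" and f: "\<And>i. i \<in> V \<Longrightarrow> 0 \<le> f i" and k: "0 < k"
  shows "((\<Sum>i\<in>V. f i) / 2) ^ k \<le> real (card V) ^ (k - 1) * (\<Sum>i\<in>V. f i ^ k)"
proof -
  define m where "m = (\<Sum>i\<in>V. f i)"
  define c where "c = real (card V)"
  define \<theta> where "\<theta> = m / (2 * c)"
  have c: "0 < c" using V by (simp add: c_def card_gt_0_iff)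
  have m: "0 \<le> m" using f by (simp add: m_def sum_nonneg)
  have \<theta>: "0 \<le> \<theta>" using c m by (simp add: \<theta>_def)
  obtain k' where k': "k = Suc k'" using k by (cases k) auto
  have pt: "\<theta> ^ k' * (f i - \<theta>) \<le> f i ^ k" if i: "i \<in> V" for i
  proof (cases "f i \<le> \<theta>")
    case True
    then have "\<theta> ^ k' * (f i - \<theta>) \<le> 0" using \<theta> by (intro mult_nonneg_nonpos) auto
    also have "0 \<le> f i ^ k" using f[OF i] by simp
    finally show ?thesis .
  next
    case False
    then have "\<theta> ^ k' * (f i - \<theta>) \<le> f i ^ k' * f i" using \<theta> by (intro mult_mono power_mono) auto
    then show ?thesis by (simp add: k' mult.commute)
  qed
  have "(m / 2) ^ k = c ^ k' * (\<theta> ^ k' * (m - c * \<theta>))"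
  proof -
    have "c * \<theta> = m / 2" using c by (simp add: \<theta>_def)
    then have "c ^ k' * (\<theta> ^ k' * (m - c * \<theta>)) = (m / 2) ^ k' * (m - m / 2)"
      by (metis mult.assoc power_mult_distrib)
    then show ?thesis by (simp add: k')
  qed
  also have "\<theta> ^ k' * (m - c * \<theta>) = (\<Sum>i\<in>V. \<theta> ^ k' * (f i - \<theta>))"
    by (simp add: m_def c_def sum_subtractf flip: sum_distrib_left)
  also have "c ^ k' * \<dots> \<le> c ^ k' * (\<Sum>i\<in>V. f i ^ k)"
    using c by (intro mult_left_mono sum_mono pt) auto
  finally show ?thesis by (simp add: m_def c_def k')
qed

text \<open>A threshold argument, with \<open>F\<close> the \<open>p\<close>-th moment and
  \<open>\<theta> = (F / n)^(1/p)\<close>: terms with \<open>f i <= \<theta>\<close> cost at most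
  \<open>\<theta>^k\<close> each, larger ones at most \<open>f i^p * \<theta>^(k-p)\<close>, and the
  choice of \<open>\<theta>\<close> bounds both totals by \<open>n * \<theta>^k\<close>. In the
  second factor every \<open>f i\<close> is at most \<open>F^(1/p)\<close>. In the product the
  powers of \<open>F\<close> combine to \<open>F^2\<close>.\<close>

lemma moment_product_upper:
  fixes f :: "'a \<Rightarrow> real" and p :: real and n :: real
  assumes V: "finite V" "V \<noteq> {}" and f: "\<And>i. i \<in> V \<Longrightarrow> 0 < f i" and k: "0 < k" and kp: "real k \<le> p" and n: "real (card V) \<le> n"
  shows "(\<Sum>i\<in>V. f i ^ k) * (\<Sum>i\<in>V. f i ^ k * (f i powr (p - real k))\<^sup>2)
     \<le> 2 * n powr (1 - real k / p) * (\<Sum>i\<in>V. f i powr p)\<^sup>2"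
proof -
  define F where "F = (\<Sum>i\<in>V. f i powr p)"
  have p: "0 < p" using k kp by linarith
  have "0 < card V" using V by (simp add: card_gt_0_iff)
  then have n0: "0 < n" using n by linarith
  have "0 < f i powr p" if "i \<in> V" for i using f[OF that] by simp
  then have F0: "0 < F" unfolding F_def using V by (intro sum_pos) auto
  define \<theta> where "\<theta> = (F / n) powr (1 / p)"
  have \<theta>: "0 < \<theta>" using F0 n0 by (simp add: \<theta>_def)
  have \<theta>p: "\<theta> powr p = F / n" using p F0 n0 by (simp add: \<theta>_def powr_powr)
  have pt: "f i ^ k \<le> \<theta> powr real k + f i powr p * \<theta> powr (real k - p)" if i: "i \<in> V" for i
  proof (cases "f i \<le> \<theta>")
    case True
    have "f i ^ k = f i powr real k" using f[OF i] by (simp add: powr_realpow)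
    also have "\<dots> \<le> \<theta> powr real k" using True f[OF i] by (intro powr_mono2) auto
    finally show ?thesis by (simp add: add_increasing2)
  next
    case False
    have "f i ^ k = f i powr p * f i powr (real k - p)" using f[OF i] by (simp add: powr_realpow flip: powr_add)
    also have "\<dots> \<le> f i powr p * \<theta> powr (real k - p)"
      using False \<theta> kp by (intro mult_left_mono powr_mono2') auto
    finally show ?thesis by (simp add: add_increasing)
  qed
  have "(\<Sum>i\<in>V. f i ^ k) \<le> (\<Sum>i\<in>V. \<theta> powr real k + f i powr p * \<theta> powr (real k - p))"
    by (intro sum_mono pt)
  also have "\<dots> = real (card V) * \<theta> powr real k + F * \<theta> powr (real k - p)"
    by (simp add: sum.distrib F_def sum_distrib_right)
  also have "F * \<theta> powr (real k - p) = n * \<theta> powr real k"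
  proof -
    have "F = n * \<theta> powr p" using \<theta>p n0 by simp
    then show ?thesis using \<theta> by (simp add: mult.assoc flip: powr_add)
  qed
  also have "real (card V) * \<theta> powr real k + n * \<theta> powr real k \<le> 2 * n * \<theta> powr real k"
    using n by (simp add: mult_right_mono)
  finally have A: "(\<Sum>i\<in>V. f i ^ k) \<le> 2 * n * \<theta> powr real k" .
  have pt2: "f i ^ k * (f i powr (p - real k))\<^sup>2 \<le> f i powr p * F powr ((p - real k) / p)" if i: "i \<in> V" for i
  proof -
    have fi: "f i \<le> F powr (1 / p)"
    proof -
      have "f i powr p \<le> F" unfolding F_def using V(1) i by (intro member_le_sum) auto
      then have "(f i powr p) powr (1 / p) \<le> F powr (1 / p)" using p by (intro powr_mono2) auto
      then show ?thesis using p f[OF i] by (simp add: powr_powr)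
    qed
    have "f i ^ k * (f i powr (p - real k))\<^sup>2 = f i powr p * f i powr (p - real k)"
      using f[OF i] by (simp add: power2_eq_square powr_realpow[symmetric] flip: powr_add)
    also have "\<dots> \<le> f i powr p * (F powr (1 / p)) powr (p - real k)"
      using fi f[OF i] kp by (intro mult_left_mono powr_mono2) auto
    finally show ?thesis by (simp add: powr_powr)
  qed
  have B: "(\<Sum>i\<in>V. f i ^ k * (f i powr (p - real k))\<^sup>2) \<le> F * F powr ((p - real k) / p)"
  proof -
    have "(\<Sum>i\<in>V. f i ^ k * (f i powr (p - real k))\<^sup>2) \<le> (\<Sum>i\<in>V. f i powr p * F powr ((p - real k) / p))"
      by (intro sum_mono pt2)
    then show ?thesis by (simp add: F_def sum_distrib_right)
  qed
  have "(\<Sum>i\<in>V. f i ^ k) * (\<Sum>i\<in>V. f i ^ k * (f i powr (p - real k))\<^sup>2) \<le> (2 * n * \<theta> powr real k) * (F * F powr ((p - real k) / p))"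
    using f F0 n0 less_imp_le[OF f] by (intro mult_mono A B sum_nonneg) (auto intro!: mult_nonneg_nonneg)
  also have "\<dots> = 2 * (n * n powr (- (real k / p))) * F * (F powr (real k / p) * F powr ((p - real k) / p))"
    using F0 n0 by (simp add: \<theta>_def powr_powr powr_divide powr_minus field_simps)
  also have "F powr (real k / p) * F powr ((p - real k) / p) = F"
    using F0 p by (simp add: field_simps flip: powr_add)
  also have "n * n powr (- (real k / p)) = n powr (1 - real k / p)"
    using n0 powr_add[of n 1 "- (real k / p)"] by simp
  finally show ?thesis by (simp add: F_def power2_eq_square mult.assoc)
qed

lemma size_tokens_eq:
  assumes "valid_input n N val"
  shows "size (tokens n val) = (\<Sum>i=1..N. freq n val i)"
proof -
  have sub: "set_mset (tokens n val) \<subseteq> {1..N}"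
    using assms unfolding val_in_tokens subset_iff valid_input_def by fastforce
  have "size (tokens n val) = (\<Sum>i\<in>set_mset (tokens n val). count (tokens n val) i)" by (rule size_multiset_overloaded_eq)
  also have "\<dots> = (\<Sum>i=1..N. count (tokens n val) i)"
    using sub by (intro sum.mono_neutral_left) (auto simp: count_eq_zero_iff)
  finally show ?thesis by (simp add: count_tokens)
qed

lemma size_tokens_le: "size (tokens n val) \<le> n"
proof -
  have "size (tokens n val) \<le> (\<Sum>v<n. 1)"
    unfolding tokens_def size_sum_set by (intro sum_mono) (simp add: opt_mset_def split: option.split)
  then show ?thesis by simp
qed

text \<open>The inverse of \<open>n * (r / n)^k\<close>, the factor between the moment and the mean
  in \<open>sample_mean\<close>.\<close>

definition scale :: "nat \<Rightarrow> nat \<Rightarrow> nat \<Rightarrow> real" where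
  "scale n k r = real n ^ (k - 1) / real r ^ k"

text \<open>After scaling, the second moment is at most
  \<open>F_k * F_(2p-k) + 2^k * scale * F_(2p-k)\<close>. The second term is reduced to the first by
  \<open>scale <= 4^k * A^(k-1) * F_k\<close>; since the mean number of hits is
  \<open>F_k / scale\<close>, this says that it is bounded below. Then
  \<open>2^k * 4^k = 8^k\<close>.\<close>

lemma scaled_sample_moments:
  fixes p A :: real
  assumes n: "0 < n" and h: "spread_out n g r val h" and val: "valid_input n N val"
    and rm: "r * size (tokens n val) \<le> n" "n < 2 * r * size (tokens n val)"
    and k: "2 \<le> k" and kp: "real k \<le> p" and A: "1 \<le> A"
    and F0: "real (num_distinct n N val) \<le> A * real n powr (1 / (real k - 1))"
  shows "expect (sample_law n N k g val h) (\<lambda>x. scale n k r * est (p - real k) x) = freq_moment n N val p"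
    and "expect (sample_law n N k g val h) (\<lambda>x. (scale n k r * est (p - real k) x)\<^sup>2)
       \<le> (2 * (1 + 8 ^ k * A ^ (k - 1))) * real n powr (1 - real k / p) * (freq_moment n N val p)\<^sup>2"
    and "0 < freq_moment n N val p"
proof -
  define m where "m = size (tokens n val)"
  define f where "f = (\<lambda>i. real (freq n val i))"
  define V where "V = {i\<in>{1..N}. freq n val i > 0}"
  define Fk where "Fk = (\<Sum>i\<in>V. f i ^ k)"
  define G where "G = (\<Sum>i\<in>V. f i ^ k * (f i powr (p - real k))\<^sup>2)"
  define \<rho> where "\<rho> = (real r / real n) ^ k"
  define \<kappa> where "\<kappa> = scale n k r"
  have r0: "0 < r" and m0: "0 < m" using rm n by (auto simp: m_def intro: Nat.gr0I)
  have n0: "0 < real n" using n by simp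
  have \<kappa>0: "0 < \<kappa>" using n0 r0 by (simp add: \<kappa>_def scale_def)
  have \<kappa>\<rho>: "\<kappa> * (real n * \<rho>) = 1"
  proof -
    obtain k' where "k = Suc k'" using k by (cases k) auto
    then show ?thesis using n0 r0 by (simp add: \<kappa>_def scale_def \<rho>_def power_divide)
  qed
  have finV: "finite V" by (simp add: V_def)
  have f0: "f i = 0" if "i \<in> {1..N} - V" for i using that by (auto simp: V_def f_def)
  have fpos: "0 < f i" if "i \<in> V" for i using that by (auto simp: V_def f_def)
  have toV: "(\<Sum>i=1..N. F i) = (\<Sum>i\<in>V. F i)" if "\<And>i. f i = 0 \<Longrightarrow> F i = 0" for F :: "nat \<Rightarrow> real"
    using f0 that by (intro sum.mono_neutral_right) (auto simp: V_def)
  have msum: "real m = (\<Sum>i\<in>V. f i)"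
  proof -
    have "real m = (\<Sum>i=1..N. f i)" by (simp add: m_def size_tokens_eq[OF val] f_def)
    then show ?thesis by (subst (asm) toV) auto
  qed
  have V0: "V \<noteq> {}" using msum m0 by auto
  have cV: "card V = num_distinct n N val" by (simp add: V_def num_distinct_def)
  have cVn: "real (card V) \<le> real n"
  proof -
    have "real (card V) = (\<Sum>i\<in>V. 1)" by simp
    also have "\<dots> \<le> (\<Sum>i\<in>V. f i)" by (intro sum_mono) (auto simp: V_def f_def)
    also have "\<dots> = real m" by (rule msum[symmetric])
    also have "\<dots> \<le> real n" using size_tokens_le[of n val] by (simp add: m_def)
    finally show ?thesis .
  qed
  have Fp: "freq_moment n N val p = (\<Sum>i\<in>V. f i powr p)"
    using toV[of "\<lambda>i. f i powr p"] by (simp add: freq_moment_def f_def)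
  show "0 < freq_moment n N val p"
  proof -
    have "0 < f i powr p" if "i \<in> V" for i using fpos[OF that] by simp
    then show ?thesis unfolding Fp using finV V0 by (intro sum_pos) auto
  qed
  have a: "(real (r * freq n val i) / real n) ^ k = \<rho> * f i ^ k" for i
    by (simp add: \<rho>_def f_def power_mult_distrib power_divide)
  have "expect (sample_law n N k g val h) (\<lambda>x. \<kappa> * est (p - real k) x)
      = \<kappa> * (real n * (\<Sum>i=1..N. \<rho> * f i ^ k * f i powr (p - real k)))"
    by (simp only: integral_mult_right_zero sample_mean[OF n h] a) (simp add: f_def)
  also have "(\<Sum>i=1..N. \<rho> * f i ^ k * f i powr (p - real k)) = \<rho> * (\<Sum>i\<in>V. f i powr p)"
  proof -
    have "(\<Sum>i=1..N. \<rho> * f i ^ k * f i powr (p - real k)) = (\<Sum>i\<in>V. \<rho> * f i ^ k * f i powr (p - real k))"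
      by (rule toV) simp
    also have "\<dots> = (\<Sum>i\<in>V. \<rho> * f i powr p)"
      using fpos by (intro sum.cong refl) (simp add: powr_realpow[symmetric] mult.assoc flip: powr_add)
    finally show ?thesis by (simp add: sum_distrib_left)
  qed
  finally show "expect (sample_law n N k g val h) (\<lambda>x. scale n k r * est (p - real k) x) = freq_moment n N val p"
    using \<kappa>\<rho> unfolding Fp \<kappa>_def[symmetric] by (simp only: mult.assoc[symmetric] mult_1_left)
  have c: "r * freq n val i \<le> n" for i
  proof -
    have "freq n val i \<le> size (tokens n val)" by (metis count_le_size count_tokens)
    then have "r * freq n val i \<le> r * size (tokens n val)" by simp
    then show ?thesis using rm(1) by linarith
  qed
  have "expect (sample_law n N k g val h) (\<lambda>x. (\<kappa> * est (p - real k) x)\<^sup>2)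
     = \<kappa>\<^sup>2 * expect (sample_law n N k g val h) (\<lambda>x. (est (p - real k) x)\<^sup>2)"
    by (simp add: power_mult_distrib)
  also have "\<dots> \<le> \<kappa>\<^sup>2 * ((real n)\<^sup>2 * (\<Sum>i=1..N. \<rho> * f i ^ k) * (\<Sum>i=1..N. \<rho> * f i ^ k * (f i powr (p - real k))\<^sup>2)
      + real n * 2 ^ k * (\<Sum>i=1..N. \<rho> * f i ^ k * (f i powr (p - real k))\<^sup>2))"
    using sample_second_moment[OF n h c, of N k "p - real k"] unfolding a by (intro mult_left_mono) (auto simp: f_def)
  also have "(\<Sum>i=1..N. \<rho> * f i ^ k) = \<rho> * Fk"
    using k by (subst toV) (auto simp: Fk_def sum_distrib_left)
  also have "(\<Sum>i=1..N. \<rho> * f i ^ k * (f i powr (p - real k))\<^sup>2) = \<rho> * G"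
    using k by (subst toV) (auto simp: G_def sum_distrib_left mult.assoc)
  also have "\<kappa>\<^sup>2 * ((real n)\<^sup>2 * (\<rho> * Fk) * (\<rho> * G) + real n * 2 ^ k * (\<rho> * G))
     = (\<kappa> * (real n * \<rho>))\<^sup>2 * (Fk * G) + 2 ^ k * \<kappa> * (\<kappa> * (real n * \<rho>)) * G"
    by (simp add: power2_eq_square algebra_simps)
  also have "\<dots> = Fk * G + 2 ^ k * \<kappa> * G" by (simp add: \<kappa>\<rho>)
  also have "\<dots> \<le> Fk * G + 2 ^ k * (4 ^ k * A ^ (k - 1) * Fk) * G"
  proof -
    have G0: "0 \<le> G" unfolding G_def using fpos by (intro sum_nonneg mult_nonneg_nonneg) (auto simp: less_imp_le)
    \<comment> \<open>This explains the exponent \<open>1 / (k - 1)\<close>: the number of distinct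
      values enters through its \<open>(k - 1)\<close>-st power.\<close>
    have cA: "real (card V) ^ (k - 1) \<le> A ^ (k - 1) * real n"
    proof -
      have "real (card V) ^ (k - 1) \<le> (A * real n powr (1 / (real k - 1))) ^ (k - 1)"
        using F0 by (intro power_mono) (auto simp: cV)
      also have "\<dots> = A ^ (k - 1) * (real n powr (1 / (real k - 1))) powr real (k - 1)"
        using n0 by (simp add: power_mult_distrib powr_realpow)
      also have "(real n powr (1 / (real k - 1))) powr real (k - 1) = real n"
        using k n0 by (simp add: powr_powr of_nat_diff)
      finally show ?thesis .
    qed
    \<comment> \<open>The factor \<open>4^k\<close> collects the 2 lost in replication and the 2
      lost in \<open>power_sum_lower\<close>.\<close>
    have "real n ^ k \<le> (2 * real r * real m) ^ k"
    proof -
      have "real n \<le> real (2 * r * m)" using rm(2) unfolding m_def by linarith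
      then show ?thesis by (intro power_mono) auto
    qed
    also have "\<dots> = 4 ^ k * real r ^ k * (real m / 2) ^ k"
    proof -
      have "2 * real r * real m = 4 * real r * (real m / 2)" by simp
      then show ?thesis by (metis power_mult_distrib)
    qed
    also have "\<dots> \<le> 4 ^ k * real r ^ k * (real (card V) ^ (k - 1) * Fk)"
      unfolding msum Fk_def using k fpos finV V0 by (intro mult_left_mono power_sum_lower) (auto simp: less_imp_le)
    also have "\<dots> \<le> 4 ^ k * real r ^ k * (A ^ (k - 1) * real n * Fk)"
    proof -
      have "0 \<le> Fk" unfolding Fk_def using fpos by (intro sum_nonneg) (auto simp: less_imp_le)
      then show ?thesis using cA by (intro mult_left_mono mult_right_mono) auto
    qed
    finally have 1: "real n ^ k \<le> 4 ^ k * real r ^ k * (A ^ (k - 1) * real n * Fk)" .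
    have "real n ^ (k - 1) * real n = real n ^ k"
      using k by (metis One_nat_def Suc_diff_Suc Suc_le_lessD diff_zero less_le_trans numeral_2_eq_2 power_Suc2 zero_less_Suc)
    then have "real n ^ (k - 1) * real n \<le> (4 ^ k * A ^ (k - 1) * Fk * real r ^ k) * real n"
      using 1 by (simp add: mult_ac)
    then have "real n ^ (k - 1) \<le> 4 ^ k * A ^ (k - 1) * Fk * real r ^ k"
      using n0 by (simp only: mult_le_cancel_right_pos)
    then have "\<kappa> \<le> 4 ^ k * A ^ (k - 1) * Fk"
      using r0 by (simp add: \<kappa>_def scale_def divide_le_eq)
    then show ?thesis using G0 by (intro add_left_mono mult_right_mono mult_left_mono) auto
  qed
  also have "\<dots> = (1 + 8 ^ k * A ^ (k - 1)) * (Fk * G)"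
  proof -
    have "(8::real) ^ k = 2 ^ k * 4 ^ k" using power_mult_distrib[of "2::real" 4 k] by simp
    then show ?thesis by (simp add: algebra_simps)
  qed
  also have "\<dots> \<le> (1 + 8 ^ k * A ^ (k - 1)) * (2 * real n powr (1 - real k / p) * (freq_moment n N val p)\<^sup>2)"
    unfolding Fp Fk_def G_def using A k kp fpos finV V0 cVn
    by (intro mult_left_mono moment_product_upper) auto
  finally show "expect (sample_law n N k g val h) (\<lambda>x. (scale n k r * est (p - real k) x)\<^sup>2)
       \<le> (2 * (1 + 8 ^ k * A ^ (k - 1))) * real n powr (1 - real k / p) * (freq_moment n N val p)\<^sup>2"
    unfolding \<kappa>_def by (simp only: mult_ac)
qed

section \<open>Median of means\<close>

text \<open>The latest sample comes first, as in \<open>outs\<close>.\<close>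

primrec iid :: "nat \<Rightarrow> 'a pmf \<Rightarrow> 'a list pmf" where
  "iid 0 M = return_pmf []"
| "iid (Suc R) M = bind_pmf (iid R M) (\<lambda>xs. map_pmf (\<lambda>x. x # xs) M)"

lemma finite_iid: "finite (set_pmf M) \<Longrightarrow> finite (set_pmf (iid R M))"
  by (induction R) auto

lemma length_iid: "xs \<in> set_pmf (iid R M) \<Longrightarrow> length xs = R"
  by (induction R arbitrary: xs) auto

lemma iid_add: "iid (b + a) M = bind_pmf (iid a M) (\<lambda>xs. map_pmf (\<lambda>ys. ys @ xs) (iid b M))"
proof (induction b)
  case 0
  then show ?case by (simp add: bind_return_pmf')
next
  case (Suc b)
  then show ?case
    by (simp add: map_bind_pmf bind_assoc_pmf bind_map_pmf pmf.map_comp comp_def)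
qed

text \<open>The raw second moment may stand in for the variance, since subtracting the square of the
  mean only helps.\<close>

lemma iid_sum_variance:
  fixes X :: "'a \<Rightarrow> real"
  assumes M: "finite (set_pmf M)" and mean: "expect M X = \<mu>"
    and var: "expect M (\<lambda>x. (X x)\<^sup>2) \<le> v"
  shows "expect (iid R M) (\<lambda>xs. ((\<Sum>x\<leftarrow>xs. X x) - real R * \<mu>)\<^sup>2) \<le> real R * v"
proof (induction R)
  case (Suc R)
  let ?D = "\<lambda>xs. (\<Sum>x\<leftarrow>xs. X x) - real R * \<mu>"
  have inner: "expect M (\<lambda>x. ((\<Sum>x\<leftarrow>x # xs. X x) - real (Suc R) * \<mu>)\<^sup>2) \<le> (?D xs)\<^sup>2 + v" for xs
  proof -
    have "(\<lambda>x. ((\<Sum>x\<leftarrow>x # xs. X x) - real (Suc R) * \<mu>)\<^sup>2) = (\<lambda>x. (?D xs - \<mu>)\<^sup>2 + 2 * (?D xs - \<mu>) * X x + (X x)\<^sup>2)"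
      by (rule ext) (simp add: power2_eq_square algebra_simps)
    then have "expect M (\<lambda>x. ((\<Sum>x\<leftarrow>x # xs. X x) - real (Suc R) * \<mu>)\<^sup>2)
       = (?D xs - \<mu>)\<^sup>2 + 2 * (?D xs - \<mu>) * \<mu> + expect M (\<lambda>x. (X x)\<^sup>2)"
      using mean by (simp add: integrable_measure_pmf_finite[OF M])
    also have "\<dots> = (?D xs)\<^sup>2 - \<mu>\<^sup>2 + expect M (\<lambda>x. (X x)\<^sup>2)"
      by (simp add: power2_eq_square algebra_simps)
    finally show ?thesis using var zero_le_power2[of \<mu>] by linarith
  qed
  have "expect (iid (Suc R) M) (\<lambda>xs. ((\<Sum>x\<leftarrow>xs. X x) - real (Suc R) * \<mu>)\<^sup>2)
    = expect (iid R M) (\<lambda>xs. expect M (\<lambda>x. ((\<Sum>x\<leftarrow>x # xs. X x) - real (Suc R) * \<mu>)\<^sup>2))"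
    unfolding iid.simps using M by (subst expectation_bind_nonneg) (auto simp: finite_iid)
  also have "\<dots> \<le> expect (iid R M) (\<lambda>xs. (?D xs)\<^sup>2 + v)"
    using M inner by (intro expectation_mono_pmf finite_iid)
  also have "\<dots> = expect (iid R M) (\<lambda>xs. (?D xs)\<^sup>2) + v"
    using M by (simp add: integrable_measure_pmf_finite finite_iid)
  also have "\<dots> \<le> real (Suc R) * v" using Suc by (simp add: algebra_simps)
  finally show ?case .
qed simp

text \<open>Chebyshev's inequality; \<open>9 * v\<close> is chosen to give the probability
  \<open>1/9\<close> that \<open>iid_num_bad\<close> asks for.\<close>

lemma iid_mean_deviation:
  fixes X :: "'a \<Rightarrow> real"
  assumes M: "finite (set_pmf M)" and mean: "expect M X = \<mu>"
    and var: "expect M (\<lambda>x. (X x)\<^sup>2) \<le> v" and R: "0 < R" and d: "0 < d" and Rv: "9 * v \<le> real R * d\<^sup>2"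
  shows "Pr (iid R M) {xs. d < \<bar>(\<Sum>x\<leftarrow>xs. X x) / real R - \<mu>\<bar>} \<le> 1 / 9"
proof -
  have v0: "0 \<le> v" using var by (rule order_trans[rotated]) (simp add: Bochner_Integration.integral_nonneg)
  have "(\<integral>\<^sup>+xs. ennreal (((\<Sum>x\<leftarrow>xs. X x) - real R * \<mu>)\<^sup>2) \<partial>iid R M) \<le> ennreal (real R * v)"
    using iid_sum_variance[OF M mean var, of R] M
    by (subst nn_integral_eq_expectation) (auto simp: finite_iid ennreal_leI)
  then have "Pr (iid R M) {xs. (real R * d)\<^sup>2 \<le> ((\<Sum>x\<leftarrow>xs. X x) - real R * \<mu>)\<^sup>2} \<le> real R * v / (real R * d)\<^sup>2"
    using R d v0 by (intro prob_ge_le_nn_integral) auto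
  also have "\<dots> \<le> 1 / 9"
    using Rv R d by (simp add: field_simps power2_eq_square)
  finally have "Pr (iid R M) {xs. (real R * d)\<^sup>2 \<le> ((\<Sum>x\<leftarrow>xs. X x) - real R * \<mu>)\<^sup>2} \<le> 1 / 9" .
  moreover have "Pr (iid R M) {xs. d < \<bar>(\<Sum>x\<leftarrow>xs. X x) / real R - \<mu>\<bar>}
     \<le> Pr (iid R M) {xs. (real R * d)\<^sup>2 \<le> ((\<Sum>x\<leftarrow>xs. X x) - real R * \<mu>)\<^sup>2}"
  proof (intro measure_pmf.finite_measure_mono subsetI)
    fix xs assume "xs \<in> {xs. d < \<bar>(\<Sum>x\<leftarrow>xs. X x) / real R - \<mu>\<bar>}"
    then have "real R * d \<le> real R * \<bar>(\<Sum>x\<leftarrow>xs. X x) / real R - \<mu>\<bar>" using R by simp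
    also have "\<dots> = \<bar>(\<Sum>x\<leftarrow>xs. X x) - real R * \<mu>\<bar>" 
    proof -
      have "real R * ((\<Sum>x\<leftarrow>xs. X x) / real R - \<mu>) = (\<Sum>x\<leftarrow>xs. X x) - real R * \<mu>"
        using R by (simp add: right_diff_distrib)
      then show ?thesis by (metis abs_mult abs_of_nat)
    qed
    finally have "\<bar>real R * d\<bar> \<le> \<bar>(\<Sum>x\<leftarrow>xs. X x) - real R * \<mu>\<bar>" using R d by simp
    then show "xs \<in> {xs. (real R * d)\<^sup>2 \<le> ((\<Sum>x\<leftarrow>xs. X x) - real R * \<mu>)\<^sup>2}" by (simp add: abs_le_square_iff)
  qed simp
  ultimately show ?thesis by linarith
qed

primrec num_bad :: "nat \<Rightarrow> ('a list \<Rightarrow> bool) \<Rightarrow> nat \<Rightarrow> 'a list \<Rightarrow> nat" where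
  "num_bad R bad 0 xs = 0"
| "num_bad R bad (Suc G) xs = (if bad (take R xs) then 1 else 0) + num_bad R bad G (drop R xs)"

lemma num_bad_eq: "num_bad R bad G xs = card {j. j < G \<and> bad (take R (drop (j * R) xs))}"
proof (induction G arbitrary: xs)
  case (Suc G)
  have "{j. j < Suc G \<and> bad (take R (drop (j * R) xs))}
     = (if bad (take R xs) then {0} else {}) \<union> Suc ` {j. j < G \<and> bad (take R (drop (j * R) (drop R xs)))}"
    by (auto simp: less_Suc_eq_0_disj add.commute image_iff)
  also have "card \<dots> = (if bad (take R xs) then 1 else 0) + card {j. j < G \<and> bad (take R (drop (j * R) (drop R xs)))}"
    by (subst card_Un_disjoint) (auto simp: card_image)
  finally show ?case using Suc by simp
qed simp

text \<open>An exponential moment in base 4: a group contributes at most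
  \<open>1 + 3/9 = 4/3\<close>, while \<open>G <= 2 * num_bad\<close> means
  \<open>4 ^ num_bad >= 2 ^ G\<close>. Markov's inequality leaves
  \<open>(4/3)^G / 2^G\<close>.\<close>

lemma iid_num_bad:
  assumes bad: "Pr (iid R M) {xs. bad xs} \<le> 1 / 9"
  shows "Pr (iid (G * R) M) {xs. G \<le> 2 * num_bad R bad G xs} \<le> (2 / 3) ^ G"
proof -
  have one: "(\<integral>\<^sup>+ys. ennreal (4 ^ (if bad ys then 1 else 0)) \<partial>iid R M) \<le> ennreal (4 / 3)"
  proof -
    have "(\<integral>\<^sup>+ys. ennreal (4 ^ (if bad ys then 1 else 0)) \<partial>iid R M) = (\<integral>\<^sup>+ys. 1 + 3 * indicator {xs. bad xs} ys \<partial>iid R M)"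
      by (intro nn_integral_cong) (auto simp: indicator_def)
    also have "\<dots> = 1 + 3 * emeasure (iid R M) {xs. bad xs}"
      by (simp add: nn_integral_add nn_integral_cmult)
    also have "\<dots> \<le> 1 + 3 * ennreal (1 / 9)"
      using bad by (intro add_left_mono mult_left_mono) (auto simp: measure_pmf.emeasure_eq_measure ennreal_leI)
    also have "3 * ennreal (1 / 9) = ennreal (1 / 3)"
      by (subst ennreal_numeral[symmetric], subst ennreal_mult[symmetric]) auto
    also have "1 + ennreal (1 / 3) = ennreal (4 / 3)"
      by (subst ennreal_1[symmetric], subst ennreal_plus[symmetric]) auto
    finally show ?thesis .
  qed
  have "(\<integral>\<^sup>+xs. ennreal (4 ^ num_bad R bad G xs) \<partial>iid (G * R) M) \<le> ennreal ((4 / 3) ^ G)"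
  proof (induction G)
    case (Suc G)
    have "(\<integral>\<^sup>+xs. ennreal (4 ^ num_bad R bad (Suc G) xs) \<partial>iid (Suc G * R) M)
      = (\<integral>\<^sup>+xs. (\<integral>\<^sup>+ys. ennreal (4 ^ num_bad R bad (Suc G) (ys @ xs)) \<partial>iid R M) \<partial>iid (G * R) M)"
      unfolding mult_Suc iid_add by simp
    also have "\<dots> = (\<integral>\<^sup>+xs. (\<integral>\<^sup>+ys. ennreal (4 ^ (if bad ys then 1 else 0)) * ennreal (4 ^ num_bad R bad G xs) \<partial>iid R M) \<partial>iid (G * R) M)"
      by (intro nn_integral_cong nn_integral_cong_AE AE_pmfI)
         (auto simp: length_iid power_add ennreal_mult')
    also have "\<dots> = (\<integral>\<^sup>+xs. (\<integral>\<^sup>+ys. ennreal (4 ^ (if bad ys then 1 else 0)) \<partial>iid R M) * ennreal (4 ^ num_bad R bad G xs) \<partial>iid (G * R) M)"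
      by (simp add: nn_integral_multc)
    also have "\<dots> \<le> (\<integral>\<^sup>+xs. ennreal (4 / 3) * ennreal (4 ^ num_bad R bad G xs) \<partial>iid (G * R) M)"
      using one by (intro nn_integral_mono mult_right_mono) auto
    also have "\<dots> = ennreal (4 / 3) * (\<integral>\<^sup>+xs. ennreal (4 ^ num_bad R bad G xs) \<partial>iid (G * R) M)"
      by (simp add: nn_integral_cmult)
    also have "\<dots> \<le> ennreal (4 / 3) * ennreal ((4 / 3) ^ G)" by (intro mult_left_mono Suc) auto
    also have "\<dots> = ennreal ((4 / 3) ^ Suc G)" by (simp flip: ennreal_mult)
    finally show ?case .
  qed simp
  then have "Pr (iid (G * R) M) {xs. 2 ^ G \<le> (4::real) ^ num_bad R bad G xs} \<le> (4 / 3) ^ G / 2 ^ G"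
    by (intro prob_ge_le_nn_integral) auto
  also have "(4 / 3) ^ G / 2 ^ G = ((2::real) / 3) ^ G" using power_divide[of "4 / 3 :: real" 2 G] by simp
  finally have "Pr (iid (G * R) M) {xs. 2 ^ G \<le> (4::real) ^ num_bad R bad G xs} \<le> (2 / 3) ^ G" .
  moreover have "Pr (iid (G * R) M) {xs. G \<le> 2 * num_bad R bad G xs}
     \<le> Pr (iid (G * R) M) {xs. 2 ^ G \<le> (4::real) ^ num_bad R bad G xs}"
  proof (intro measure_pmf.finite_measure_mono subsetI)
    fix xs assume "xs \<in> {xs. G \<le> 2 * num_bad R bad G xs}"
    then have "(2::real) ^ G \<le> 2 ^ (2 * num_bad R bad G xs)" by (intro power_increasing) auto
    then show "xs \<in> {xs. 2 ^ G \<le> (4::real) ^ num_bad R bad G xs}" by (simp add: power_mult)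
  qed simp
  ultimately show ?thesis by linarith
qed

text \<open>The smallest \<open>y j\<close> that is at least as large as half of all \<open>y i\<close>; only meaningful for \<open>0 < G\<close>.\<close>

definition median :: "nat \<Rightarrow> (nat \<Rightarrow> real) \<Rightarrow> real" where
  "median G y = Min {y j |j. j < G \<and> G \<le> 2 * card {i. i < G \<and> y i \<le> y j}}"

text \<open>All good values, more than half of the total, lie at or below the largest good one, so
  it is a candidate and the minimum is at most \<open>b\<close>. A candidate below \<open>a\<close>
  would have only bad values at or below it, fewer than half.\<close>

lemma median_between:
  assumes bad: "2 * card {j. j < G \<and> \<not> (a \<le> y j \<and> y j \<le> b)} < G"
  shows "a \<le> median G y \<and> median G y \<le> b"
proof -
  let ?B = "{j. j < G \<and> \<not> (a \<le> y j \<and> y j \<le> b)}"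
  let ?C = "{j. j < G \<and> a \<le> y j \<and> y j \<le> b}"
  let ?S = "{y j |j. j < G \<and> G \<le> 2 * card {i. i < G \<and> y i \<le> y j}}"
  have "card ?B + card ?C = card (?B \<union> ?C)" by (subst card_Un_disjoint) auto
  also have "?B \<union> ?C = {..<G}" by auto
  finally have card: "card ?B + card ?C = G" by simp
  then have "?C \<noteq> {}" using bad by (metis add.right_neutral card.empty less_not_refl3 linorder_not_le mult_2 trans_le_add1 le_refl)
  define j where "j = arg_max_on y ?C"
  have j: "j \<in> ?C" "\<And>i. i \<in> ?C \<Longrightarrow> y i \<le> y j"
  proof -
    have "Max (y ` ?C) \<in> y ` ?C" using \<open>?C \<noteq> {}\<close> by (intro Max_in) auto
    then obtain j' where "j' \<in> ?C" "y j' = Max (y ` ?C)" by auto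
    then have "\<exists>j\<in>?C. \<forall>i\<in>?C. y i \<le> y j" by (intro bexI[of _ j']) auto
    then have "is_arg_max y (\<lambda>x. x \<in> ?C) j"
      unfolding j_def arg_max_on_def arg_max_def is_arg_max_linorder by (intro someI_ex[of "\<lambda>x. x \<in> ?C \<and> (\<forall>y'. y' \<in> ?C \<longrightarrow> y y' \<le> y x)"]) blast
    then show "j \<in> ?C" "\<And>i. i \<in> ?C \<Longrightarrow> y i \<le> y j" by (auto simp: is_arg_max_linorder)
  qed
  have "card ?C \<le> card {i. i < G \<and> y i \<le> y j}" using j by (intro card_mono) auto
  then have "G \<le> 2 * card {i. i < G \<and> y i \<le> y j}" using card bad by linarith
  then have jS: "y j \<in> ?S" using j(1) by blast
  have fin: "finite ?S" by simp
  have "Min ?S \<in> ?S" using fin jS by (intro Min_in) auto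
  then obtain i where i: "i < G" "G \<le> 2 * card {l. l < G \<and> y l \<le> y i}" "Min ?S = y i" by blast
  have "Min ?S \<le> y j" by (rule Min_le[OF fin jS])
  also have "y j \<le> b" using j(1) by simp
  finally have "Min ?S \<le> b" .
  moreover have "a \<le> Min ?S"
  proof (rule ccontr)
    assume "\<not> a \<le> Min ?S"
    then have "{l. l < G \<and> y l \<le> y i} \<subseteq> ?B" using i(3) by auto
    then have "card {l. l < G \<and> y l \<le> y i} \<le> card ?B" by (intro card_mono) auto
    then show False using i(2) bad by linarith
  qed
  ultimately show ?thesis by (simp add: median_def)
qed

section \<open>The sampling algorithm\<close>

text \<open>The number of non-NULL nodes must be known to all before the doubling, since it decides
  when to stop.\<close>

definition prelim :: "nat \<Rightarrow> nat \<Rightarrow> nat \<Rightarrow> nat \<Rightarrow> nat \<Rightarrow> st rule list" where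
  "prelim n g t W J = loc (\<lambda>q. q\<lparr>arg := (case inp q of None \<Rightarrow> 0 | Some i \<Rightarrow> 1)\<rparr>) # summ n W t
     @ loc (\<lambda>q. q\<lparr>cnt := tot q, arg := 0, tot := 0, home := (case inp q of None \<Rightarrow> [] | Some i \<Rightarrow> [i])\<rparr>)
     # doubling n g J"

lemma size_tokens_sum: "size (tokens n val) = (\<Sum>v<n. case val v of None \<Rightarrow> 0 | Some i \<Rightarrow> 1)"
  unfolding tokens_def size_sum_set by (intro sum.cong refl) (simp add: opt_mset_def split: option.split)

lemma prob_exec_append_le:
  assumes P: "apx d (exec n b P \<sigma>) (return_pmf \<sigma>')" and Q: "Pr (exec n b Q \<sigma>') B \<le> e" and d: "0 \<le> d"
  shows "Pr (exec n b (P @ Q) \<sigma>) B \<le> d + e"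
proof -
  have "apx (d + 0) (exec n b (P @ Q) \<sigma>) (exec n b Q \<sigma>')"
    by (rule apx_exec_append[OF P apx_refl d]) simp
  from apx_prob[OF this, of B] Q d show ?thesis by simp
qed

lemma prelim_prob:
  assumes n: "0 < n" and g: "0 < g" and val: "valid_input n N val" and N: "N < W"
    and W: "W * W \<le> 2 ^ b" "n * 2 ^ t < W" and m: "m = size (tokens n val)"
  shows "Pr (exec n b (prelim n g t W J) (config n (\<lambda>v. st0 (val v) [] 0 [])))
     {\<sigma>. \<not> (\<exists>h. spread_out n g (copies n m J) val h \<and> \<sigma> = base n val h m [])}
     \<le> 5 * real n ^ 3 * (1 / 2) ^ t + real J * (real n * (3 * (1 / 2) ^ g))"
proof -
  let ?c = "\<lambda>v. case val v of None \<Rightarrow> 0::nat | Some i \<Rightarrow> 1"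
  let ?h = "\<lambda>v. case val v of None \<Rightarrow> [] | Some i \<Rightarrow> [i]"
  let ?F = "\<lambda>v. (st0 (val v) [] 0 [])\<lparr>arg := ?c v\<rparr>"
  let ?B = "{\<sigma>. \<not> (\<exists>h. spread_out n g (copies n m J) val h \<and> \<sigma> = base n val h m [])}"
  let ?L = "loc (\<lambda>q::st. q\<lparr>cnt := tot q, arg := 0, tot := 0, home := (case inp q of None \<Rightarrow> [] | Some i \<Rightarrow> [i])\<rparr>)"
  have mset_h: "mset (?h v) = opt_mset (val v)" for v by (simp add: opt_mset_def split: option.split)
  have sp: "spread_out n g 1 val ?h"
    using g unfolding spread_out_def mset_h tokens_def by (auto split: option.split)
  have bd: "x < 2 ^ b" if "x \<in># tokens n val" for x
  proof -
    have "x \<le> N" using that val unfolding val_in_tokens valid_input_def by fastforce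
    also have "N < W" by (rule N)
    also have "W \<le> W * W" by simp
    also note W(1)
    finally show ?thesis .
  qed
  have "apx (5 * real n ^ 3 * (real 1)\<^sup>2 * (1 / 2) ^ t) (exec n b (summ n W t) (config n ?F))
     (return_pmf (config n (\<lambda>v. (?F v)\<lparr>tot := (\<Sum>w<n. arg (?F w)), mass := 0, wgt := 0, key := 0\<rparr>)))"
    by (rule summ_apx[OF n _ _ W(1)]) (use W(2) in \<open>auto split: option.split\<close>)
  moreover have "(\<Sum>w<n. arg (?F w)) = m" by (simp add: m size_tokens_sum)
  ultimately have s: "apx (5 * real n ^ 3 * (1 / 2) ^ t) (exec n b (summ n W t) (config n ?F))
     (return_pmf (config n (\<lambda>v. (?F v)\<lparr>tot := m, mass := 0, wgt := 0, key := 0\<rparr>)))" by simp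
  have "Pr (exec n b (summ n W t @ (?L # doubling n g J)) (config n ?F)) ?B
     \<le> 5 * real n ^ 3 * (1 / 2) ^ t + real J * (real n * (3 * (1 / 2) ^ g))"
  proof (rule prob_exec_append_le[OF s])
    have "(\<lambda>v. (\<lambda>q. q\<lparr>cnt := tot q, arg := 0, tot := 0, home := (case inp q of None \<Rightarrow> [] | Some i \<Rightarrow> [i])\<rparr>)
      ((?F v)\<lparr>tot := m, mass := 0, wgt := 0, key := 0\<rparr>)) = (\<lambda>v. st0 (val v) (?h v) m [])"
      by (simp add: st0_def)
    then show "Pr (exec n b (?L # doubling n g J) (config n (\<lambda>v. (?F v)\<lparr>tot := m, mass := 0, wgt := 0, key := 0\<rparr>))) ?B
       \<le> real J * (real n * (3 * (1 / 2) ^ g))"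
      unfolding exec_loc by (simp only: doubling_prob[OF n sp m bd])
  qed simp
  moreover have "(\<lambda>v. (\<lambda>q. q\<lparr>arg := (case inp q of None \<Rightarrow> 0 | Some i \<Rightarrow> 1)\<rparr>) (st0 (val v) [] 0 [])) = ?F"
    by (simp add: st0_def)
  ultimately show ?thesis unfolding prelim_def by (simp only: exec_loc)
qed

text \<open>The hypothesis holds for every earlier list \<open>z\<close> with the same
  \<open>\<mu>\<close>, so in the ideal law each sample is independent of the preceding ones; the
  replication \<open>h\<close> stays fixed throughout.\<close>

lemma sample_loop_apx:
  assumes it: "\<And>z. apx \<delta> (exec n b it (base n val h m z))
      (map_pmf (\<lambda>x. base n val h m (x # z)) \<mu>)" and \<delta>: "0 \<le> \<delta>"
  shows "apx (real R * \<delta>) (exec n b (concat (replicate R it)) (base n val h m []))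
     (map_pmf (\<lambda>xs. base n val h m xs) (iid R \<mu>))"
proof (induction R)
  case 0
  then show ?case by (simp add: apx_refl)
next
  case (Suc R)
  have "apx (real R * \<delta> + (0 + \<delta>)) (bind_pmf (exec n b (concat (replicate R it)) (base n val h m [])) (exec n b it))
     (bind_pmf (iid R \<mu>) (\<lambda>xs. map_pmf (\<lambda>x. base n val h m (x # xs)) \<mu>))"
  proof -
    have 1: "apx (0 + \<delta>) (bind_pmf (iid R \<mu>) (\<lambda>xs. exec n b it (base n val h m xs)))
       (bind_pmf (iid R \<mu>) (\<lambda>xs. map_pmf (\<lambda>x. base n val h m (x # xs)) \<mu>))"
      by (rule apx_bind[OF apx_refl]) (use it \<delta> in auto)
    have 2: "apx (real R * \<delta> + 0) (bind_pmf (exec n b (concat (replicate R it)) (base n val h m [])) (exec n b it))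
       (bind_pmf (map_pmf (\<lambda>xs. base n val h m xs) (iid R \<mu>)) (exec n b it))"
      by (rule apx_bind[OF Suc]) (use \<delta> apx_refl in auto)
    show ?thesis by (rule apx_trans[OF 2[simplified bind_map_pmf add_0_right] 1]) (use \<delta> in auto)
  qed
  moreover have "exec n b (concat (replicate (Suc R) it)) (base n val h m [])
     = bind_pmf (exec n b (concat (replicate R it)) (base n val h m [])) (exec n b it)"
    by (simp add: exec_append flip: replicate_append_same)
  ultimately show ?case by (simp add: map_bind_pmf pmf.map_comp comp_def algebra_simps)
qed

text \<open>If all inputs are NULL, there is nothing to replicate and the moment is 0.\<close>

definition sampling_result :: "nat \<Rightarrow> nat \<Rightarrow> real \<Rightarrow> nat \<Rightarrow> nat \<Rightarrow> nat \<Rightarrow> st \<Rightarrow> real" where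
  "sampling_result n k p J G s q = (if cnt q = 0 then 0 else median G (\<lambda>j.
     (\<Sum>x\<leftarrow>take s (drop (j * s) (outs q)). scale n k (copies n (cnt q) J) * est (p - real k) x) / real s))"

definition sampling_alg :: "nat \<Rightarrow> nat \<Rightarrow> nat \<Rightarrow> nat \<Rightarrow> nat \<Rightarrow> nat \<Rightarrow> nat \<Rightarrow> nat \<Rightarrow> nat \<Rightarrow> st rule list" where
  "sampling_alg n N k g t W Q J R = prelim n g t W J @ concat (replicate R (sample_iter n N k g t W Q))"

lemma freq_moment_nonneg: "0 \<le> freq_moment n N val p"
  by (simp add: freq_moment_def sum_nonneg)

text \<open>After a successful replication the samples are independent up to the error per sample.
  The bound on \<open>s\<close> becomes the hypothesis of \<open>iid_mean_deviation\<close> when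
  multiplied by the squared moment; the median fails only if half of the groups do.\<close>

lemma sampling_alg_prob:
  fixes p A \<epsilon> :: real
  assumes n: "0 < n" and g: "0 < g" and val: "valid_input n N val" and N: "N < W" and Q: "0 < Q" "Q * W \<le> 2 ^ b"
    and W: "W * W \<le> 2 ^ b" "n * n ^ k * 2 ^ t < W" and J: "n < 2 * 2 ^ J"
    and k: "2 \<le> k" and kp: "real k \<le> p" and A: "1 \<le> A"
    and F0: "real (num_distinct n N val) \<le> A * real n powr (1 / (real k - 1))"
    and \<epsilon>: "0 < \<epsilon>" and s: "9 * (2 * (1 + 8 ^ k * A ^ (k - 1))) * real n powr (1 - real k / p) \<le> real s * \<epsilon>\<^sup>2"
  shows "Pr (exec n b (sampling_alg n N k g t W Q J (G * s)) (config n (\<lambda>v. st0 (val v) [] 0 [])))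
     {\<sigma>. \<exists>u<n. \<not> approximates \<epsilon> (sampling_result n k p J G s (\<sigma> u)) (freq_moment n N val p)}
     \<le> 5 * real n ^ 3 * (1 / 2) ^ t + real J * (real n * (3 * (1 / 2) ^ g))
       + (real (G * s) * (real n ^ Suc k / real Q + ((real n)\<^sup>2 * (2 / 3) ^ (2 * t) + 2 * (5 * real n ^ 3 * (real (n ^ k))\<^sup>2 * (1 / 2) ^ t)))
       + (2 / 3) ^ G)"
proof -
  define m where "m = size (tokens n val)"
  define r where "r = copies n m J"
  define F where "F = freq_moment n N val p"
  let ?\<delta> = "real n ^ Suc k / real Q + ((real n)\<^sup>2 * (2 / 3) ^ (2 * t) + 2 * (5 * real n ^ 3 * (real (n ^ k))\<^sup>2 * (1 / 2) ^ t))"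
  let ?bad = "{\<sigma>. \<exists>u<n. \<not> approximates \<epsilon> (sampling_result n k p J G s (\<sigma> u)) F}"
  let ?it = "sample_iter n N k g t W Q"
  have nW: "n * 2 ^ t < W"
  proof -
    have "n * 1 * 2 ^ t \<le> n * n ^ k * 2 ^ t" using n by (intro mult_right_mono mult_left_mono) auto
    then show ?thesis using W(2) by linarith
  qed
  have loop: "Pr (exec n b (concat (replicate (G * s) ?it)) \<sigma>) ?bad \<le> real (G * s) * ?\<delta> + (2 / 3) ^ G"
    if \<sigma>: "\<exists>h. spread_out n g (copies n m J) val h \<and> \<sigma> = base n val h m []" for \<sigma>
  proof -
    obtain h where h: "spread_out n g r val h" and \<sigma>h: "\<sigma> = base n val h m []"
      using \<sigma> unfolding r_def by blast
    let ?\<mu> = "sample_law n N k g val h"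
    have rm: "r * m \<le> n" unfolding r_def m_def by (intro copies_le size_tokens_le)
    have "apx (real (G * s) * ?\<delta>) (exec n b (concat (replicate (G * s) ?it)) \<sigma>)
       (map_pmf (\<lambda>xs. base n val h m xs) (iid (G * s) ?\<mu>))"
      unfolding \<sigma>h by (intro sample_loop_apx sample_iter_apx[OF n _ h _ val N Q W]) (use k rm in \<open>auto simp: m_def\<close>)
    then have "Pr (exec n b (concat (replicate (G * s) ?it)) \<sigma>) ?bad
       \<le> Pr (map_pmf (\<lambda>xs. base n val h m xs) (iid (G * s) ?\<mu>)) ?bad + real (G * s) * ?\<delta>"
      by (rule apx_prob) simp
    also have "Pr (map_pmf (\<lambda>xs. base n val h m xs) (iid (G * s) ?\<mu>)) ?bad \<le> (2 / 3) ^ G"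
    proof (cases "m = 0")
      case True
      have "F = 0"
      proof -
        have "freq n val i = 0" if "i \<in> {1..N}" for i
          using True size_tokens_eq[OF val] that by (simp add: m_def)
        then show ?thesis by (simp add: F_def freq_moment_def)
      qed
      then have e: "(\<lambda>xs. base n val h m xs) -` ?bad = {}"
        by (auto simp: sampling_result_def st0_def True approximates_def)
      show ?thesis unfolding measure_map_pmf e by simp
    next
      case False
      define X where "X = (\<lambda>x. scale n k r * est (p - real k) x)"
      define bd where "bd = (\<lambda>xs. \<epsilon> * F < \<bar>(\<Sum>x\<leftarrow>xs. X x) / real s - F\<bar>)"
      have rm2: "n < 2 * r * m" unfolding r_def using False J by (intro copies_gt) auto
      have mom: "expect ?\<mu> X = F"
        "expect ?\<mu> (\<lambda>x. (X x)\<^sup>2) \<le> (2 * (1 + 8 ^ k * A ^ (k - 1))) * real n powr (1 - real k / p) * F\<^sup>2"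
        "0 < F"
        using scaled_sample_moments[OF n h val rm[unfolded m_def] rm2[unfolded m_def] k kp A F0]
        unfolding X_def F_def by auto
      have s0: "0 < s"
      proof (rule Nat.gr0I)
        assume "s = 0"
        then have "9 * (2 * (1 + 8 ^ k * A ^ (k - 1))) * real n powr (1 - real k / p) \<le> 0" using s by simp
        moreover have "0 < 9 * (2 * (1 + 8 ^ k * A ^ (k - 1))) * real n powr (1 - real k / p)"
          using n A by (intro mult_pos_pos) (auto intro!: add_pos_nonneg)
        ultimately show False by linarith
      qed
      have "Pr (iid s ?\<mu>) {xs. bd xs} \<le> 1 / 9"
        unfolding bd_def
      proof (rule iid_mean_deviation[OF finite_sample_law[OF n] mom(1,2) s0])
        show "0 < \<epsilon> * F" using \<epsilon> mom(3) by simp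
        have "9 * (2 * (1 + 8 ^ k * A ^ (k - 1))) * real n powr (1 - real k / p) * F\<^sup>2 \<le> real s * \<epsilon>\<^sup>2 * F\<^sup>2"
          using s by (intro mult_right_mono) auto
        then show "9 * ((2 * (1 + 8 ^ k * A ^ (k - 1))) * real n powr (1 - real k / p) * F\<^sup>2) \<le> real s * (\<epsilon> * F)\<^sup>2"
          by (simp only: power_mult_distrib mult.assoc)
      qed
      then have nb: "Pr (iid (G * s) ?\<mu>) {xs. G \<le> 2 * num_bad s bd G xs} \<le> (2 / 3) ^ G"
        by (rule iid_num_bad)
      have "Pr (map_pmf (\<lambda>xs. base n val h m xs) (iid (G * s) ?\<mu>)) ?bad
        \<le> Pr (iid (G * s) ?\<mu>) {xs. G \<le> 2 * num_bad s bd G xs}"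
        unfolding measure_map_pmf
      proof (intro measure_pmf.finite_measure_mono subsetI)
        fix xs assume xs: "xs \<in> (\<lambda>xs. base n val h m xs) -` ?bad"
        let ?y = "\<lambda>j. (\<Sum>x\<leftarrow>take s (drop (j * s) xs). X x) / real s"
        have res: "sampling_result n k p J G s (st0 (val u) (h u) m xs) = median G ?y" for u
          using False by (simp add: sampling_result_def st0_def X_def r_def)
        have "\<not> approximates \<epsilon> (median G ?y) F"
          using xs by (auto simp: res)
        then have "\<not> ((1 - \<epsilon>) * F \<le> median G ?y \<and> median G ?y \<le> (1 + \<epsilon>) * F)" by (simp add: approximates_def)
        then have "G \<le> 2 * card {j. j < G \<and> \<not> ((1 - \<epsilon>) * F \<le> ?y j \<and> ?y j \<le> (1 + \<epsilon>) * F)}"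
          using median_between[of G "(1 - \<epsilon>) * F" ?y "(1 + \<epsilon>) * F"] by linarith
        also have "{j. j < G \<and> \<not> ((1 - \<epsilon>) * F \<le> ?y j \<and> ?y j \<le> (1 + \<epsilon>) * F)} = {j. j < G \<and> bd (take s (drop (j * s) xs))}"
          unfolding bd_def by (intro Collect_cong conj_cong refl) (auto simp: algebra_simps abs_if split: if_splits)
        finally show "xs \<in> {xs. G \<le> 2 * num_bad s bd G xs}" by (simp add: num_bad_eq)
      qed simp
      with nb show ?thesis by linarith
    qed
    finally show ?thesis by linarith
  qed
  have "Pr (bind_pmf (exec n b (prelim n g t W J) (config n (\<lambda>v. st0 (val v) [] 0 []))) (exec n b (concat (replicate (G * s) ?it)))) ?bad
     \<le> 5 * real n ^ 3 * (1 / 2) ^ t + real J * (real n * (3 * (1 / 2) ^ g)) + (real (G * s) * ?\<delta> + (2 / 3) ^ G)"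
    by (rule prob_bind_le[OF prelim_prob[OF n g val N W(1) nW m_def]]) (use loop in auto)
  then show ?thesis unfolding sampling_alg_def exec_append F_def .
qed

section \<open>The exact algorithm\<close>

text \<open>\<open>chosen\<close> holds the previous value, and an empty \<open>outs\<close> marks
  the first iteration. Once the values are exhausted the maximum is 0, whose frequency 0 adds
  nothing.\<close>

definition exact_iter :: "nat \<Rightarrow> nat \<Rightarrow> nat \<Rightarrow> st rule list" where
  "exact_iter n t W = loc (\<lambda>q. q\<lparr>key := (case inp q of Some i \<Rightarrow> if outs q = [] \<or> i < chosen q then i else 0 | None \<Rightarrow> 0)\<rparr>)
     # spread (2 * t)
     @ loc (\<lambda>q. q\<lparr>chosen := key q, key := 0, arg := (if inp q = Some (key q) then 1 else 0)\<rparr>)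
     # summ n W t
     @ [loc (\<lambda>q. q\<lparr>outs := (chosen q, tot q) # outs q, arg := 0, tot := 0\<rparr>)]"

definition next_value :: "nat \<Rightarrow> (nat \<Rightarrow> nat option) \<Rightarrow> (nat \<times> nat) list \<Rightarrow> nat \<Rightarrow> nat" where
  "next_value n val z c = Max ((\<lambda>v. case val v of Some i \<Rightarrow> if z = [] \<or> i < c then i else 0 | None \<Rightarrow> 0) ` {..<n})"

lemma exact_iter_apx:
  assumes n: "0 < n" and val: "valid_input n N val" and N: "N < W" and W: "W * W \<le> 2 ^ b" "n * 2 ^ t < W"
  shows "apx ((real n)\<^sup>2 * (2 / 3) ^ (2 * t) + 5 * real n ^ 3 * (1 / 2) ^ t)
    (exec n b (exact_iter n t W) (config n (\<lambda>v. (st0 (val v) [] 0 z)\<lparr>chosen := c\<rparr>)))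
    (return_pmf (config n (\<lambda>v. (st0 (val v) [] 0 ((next_value n val z c, freq n val (next_value n val z c)) # z))\<lparr>chosen := next_value n val z c\<rparr>)))"
proof -
  let ?k = "\<lambda>v. case val v of Some i \<Rightarrow> if z = [] \<or> i < c then i else 0 | None \<Rightarrow> 0"
  let ?s = "\<lambda>v. st0 (val v) [] 0 z"
  define c' where "c' = next_value n val z c"
  let ?F1 = "\<lambda>v. (?s v)\<lparr>chosen := c, key := ?k v\<rparr>"
  let ?F2 = "\<lambda>v. (?s v)\<lparr>chosen := c', arg := (if val v = Some c' then 1 else 0)\<rparr>"
  let ?fin = "return_pmf (config n (\<lambda>v. (st0 (val v) [] 0 ((c', freq n val c') # z))\<lparr>chosen := c'\<rparr>))"
  let ?C = "[loc (\<lambda>q::st. q\<lparr>outs := (chosen q, tot q) # outs q, arg := 0, tot := 0\<rparr>)]"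
  let ?B = "loc (\<lambda>q::st. q\<lparr>chosen := key q, key := 0, arg := (if inp q = Some (key q) then 1 else 0)\<rparr>) # summ n W t @ ?C"
  let ?e = "5 * real n ^ 3 * (1 / 2) ^ t"
  have kb: "?k v < 2 ^ b" if "v < n" for v
  proof -
    have "?k v \<le> N" using val that by (auto simp: valid_input_def split: option.split)
    also have "N < W" by (rule N)
    also have "W \<le> W * W" by simp
    also note W(1)
    finally show ?thesis .
  qed
  have p2: "apx (?e + 0) (exec n b (summ n W t @ ?C) (config n ?F2)) ?fin"
  proof (rule apx_exec_append)
    have "apx (5 * real n ^ 3 * (real 1)\<^sup>2 * (1 / 2) ^ t) (exec n b (summ n W t) (config n ?F2))
      (return_pmf (config n (\<lambda>v. (?F2 v)\<lparr>tot := (\<Sum>w<n. arg (?F2 w)), mass := 0, wgt := 0, key := 0\<rparr>)))"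
      by (rule summ_apx[OF n _ _ W(1)]) (use W(2) in auto)
    moreover have "(\<Sum>w<n. arg (?F2 w)) = freq n val c'" by (simp add: freq_eq_sum)
    ultimately show "apx ?e (exec n b (summ n W t) (config n ?F2))
      (return_pmf (config n (\<lambda>v. (?F2 v)\<lparr>tot := freq n val c', mass := 0, wgt := 0, key := 0\<rparr>)))" by simp
    show "apx 0 (exec n b ?C (config n (\<lambda>v. (?F2 v)\<lparr>tot := freq n val c', mass := 0, wgt := 0, key := 0\<rparr>))) ?fin"
      by (simp add: st0_def apx_refl)
  qed auto
  have "apx ((real n)\<^sup>2 * (2 / 3) ^ (2 * t) + (?e + 0)) (exec n b (spread (2 * t) @ ?B) (config n ?F1)) ?fin"
  proof (rule apx_exec_append)
    show "apx ((real n)\<^sup>2 * (2 / 3) ^ (2 * t)) (exec n b (spread (2 * t)) (config n ?F1))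
       (return_pmf (config n (\<lambda>v. (?F1 v)\<lparr>key := Max ((\<lambda>v. key (?F1 v)) ` {..<n})\<rparr>)))"
      by (rule spread_apx[OF n]) (use kb in simp)
    have M: "Max ((\<lambda>v. key (?F1 v)) ` {..<n}) = c'" by (simp add: c'_def next_value_def)
    have "(\<lambda>v. (\<lambda>q. q\<lparr>chosen := key q, key := 0, arg := (if inp q = Some (key q) then 1 else 0)\<rparr>)
       ((?F1 v)\<lparr>key := c'\<rparr>)) = ?F2"
      by (simp add: st0_def cong: if_cong)
    then show "apx (?e + 0) (exec n b ?B (config n (\<lambda>v. (?F1 v)\<lparr>key := Max ((\<lambda>v. key (?F1 v)) ` {..<n})\<rparr>))) ?fin"
      unfolding M exec_loc using p2 by (simp only:)
  qed auto
  moreover have "(\<lambda>v. (\<lambda>q. q\<lparr>key := (case inp q of Some i \<Rightarrow> if outs q = [] \<or> i < chosen q then i else 0 | None \<Rightarrow> 0)\<rparr>)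
      ((?s v)\<lparr>chosen := c\<rparr>)) = ?F1"
    by (simp add: st0_def cong: if_cong option.case_cong)
  ultimately show ?thesis unfolding exact_iter_def c'_def[symmetric] exec_loc by (simp only: add_0_right)
qed

primrec exact_state :: "nat \<Rightarrow> (nat \<Rightarrow> nat option) \<Rightarrow> nat \<Rightarrow> (nat \<times> nat) list \<times> nat" where
  "exact_state n val 0 = ([], 0)"
| "exact_state n val (Suc j) = (let (z, c) = exact_state n val j; c' = next_value n val z c in ((c', freq n val c') # z, c'))"

lemma exact_loop_apx:
  assumes n: "0 < n" and val: "valid_input n N val" and N: "N < W" and W: "W * W \<le> 2 ^ b" "n * 2 ^ t < W"
  shows "apx (real R * ((real n)\<^sup>2 * (2 / 3) ^ (2 * t) + 5 * real n ^ 3 * (1 / 2) ^ t))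
    (exec n b (concat (replicate R (exact_iter n t W))) (config n (\<lambda>v. st0 (val v) [] 0 [])))
    (return_pmf (config n (\<lambda>v. (st0 (val v) [] 0 (fst (exact_state n val R)))\<lparr>chosen := snd (exact_state n val R)\<rparr>)))"
proof (induction R)
  case 0
  then show ?case by (simp add: apx_refl st0_def)
next
  case (Suc R)
  let ?\<delta> = "(real n)\<^sup>2 * (2 / 3) ^ (2 * t) + 5 * real n ^ 3 * (1 / 2) ^ t"
  obtain z c where zc: "exact_state n val R = (z, c)" by fastforce
  have "apx (real R * ?\<delta> + ?\<delta>) (exec n b (concat (replicate R (exact_iter n t W)) @ exact_iter n t W) (config n (\<lambda>v. st0 (val v) [] 0 [])))
     (return_pmf (config n (\<lambda>v. (st0 (val v) [] 0 ((next_value n val z c, freq n val (next_value n val z c)) # z))\<lparr>chosen := next_value n val z c\<rparr>)))"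
    by (rule apx_exec_append[OF Suc]) (use exact_iter_apx[OF assms, where z = z and c = c] in \<open>auto simp: zc\<close>)
  moreover have "concat (replicate (Suc R) (exact_iter n t W)) = concat (replicate R (exact_iter n t W)) @ exact_iter n t W"
    by (simp flip: replicate_append_same)
  moreover have "real R * ?\<delta> + ?\<delta> = real (Suc R) * ?\<delta>" by (simp add: algebra_simps)
  moreover have "exact_state n val (Suc R) = ((next_value n val z c, freq n val (next_value n val z c)) # z, next_value n val z c)"
    by (simp add: zc Let_def)
  ultimately show ?case by (simp only: fst_conv snd_conv)
qed

definition exact_result :: "real \<Rightarrow> st \<Rightarrow> real" where
  "exact_result p q = (\<Sum>x\<leftarrow>outs q. real (snd x) powr p)"

text \<open>The invariant is the set \<open>D\<close> of values processed so far: those occurring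
  values that are not below the last one. Each iteration moves the maximum of the rest into
  \<open>D\<close>. At most \<open>n\<close> values occur, so \<open>n\<close> iterations suffice;
  surplus ones only record the value 0.\<close>

lemma exact_state_moment:
  assumes n: "0 < n" and val: "valid_input n N val"
  shows "(\<Sum>x\<leftarrow>fst (exact_state n val n). real (snd x) powr p) = freq_moment n N val p"
proof -
  define V where "V = {i. \<exists>v<n. val v = Some i}"
  have VN: "V \<subseteq> {1..N}" using val by (fastforce simp: V_def valid_input_def)
  have finV: "finite V" using VN finite_subset by blast
  have cV: "card V \<le> n"
  proof -
    have "V \<subseteq> (\<lambda>v. the (val v)) ` {..<n}" by (force simp: V_def)
    then have "card V \<le> card ((\<lambda>v. the (val v)) ` {..<n})" by (intro card_mono) auto
    also have "\<dots> \<le> n" using card_image_le[of "{..<n}"] by fastforce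
    finally show ?thesis .
  qed
  have fV: "freq n val i = 0" if "i \<notin> V" for i using that by (auto simp: freq_def V_def)
  have f0: "freq n val 0 = 0" using fV VN by force
  let ?S = "\<lambda>D. \<Sum>i\<in>D. real (freq n val i) powr p"
  have "\<exists>D\<subseteq>V. (\<forall>i\<in>V. (z = [] \<or> i < c) \<longleftrightarrow> i \<notin> D) \<and> (\<Sum>x\<leftarrow>z. real (snd x) powr p) = ?S D \<and> (D = V \<or> card D = j)"
    if "exact_state n val j = (z, c)" for j z c
    using that
  proof (induction j arbitrary: z c)
    case 0
    then show ?case by (intro exI[of _ "{}"]) auto
  next
    case (Suc j)
    obtain z0 c0 where zc0: "exact_state n val j = (z0, c0)" by fastforce
    define c' where "c' = next_value n val z0 c0"
    have zc: "z = (c', freq n val c') # z0" "c = c'" using Suc.prems by (auto simp: zc0 Let_def c'_def)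
    obtain D where D: "D \<subseteq> V" "\<forall>i\<in>V. (z0 = [] \<or> i < c0) \<longleftrightarrow> i \<notin> D" "(\<Sum>x\<leftarrow>z0. real (snd x) powr p) = ?S D" "D = V \<or> card D = j"
      using Suc.IH[OF zc0] by blast
    have finD: "finite D" using D(1) finV finite_subset by blast
    have img: "(\<lambda>v. case val v of Some i \<Rightarrow> if z0 = [] \<or> i < c0 then i else 0 | None \<Rightarrow> 0) ` {..<n} \<subseteq> insert 0 (V - D)"
    proof
      fix x assume "x \<in> (\<lambda>v. case val v of Some i \<Rightarrow> if z0 = [] \<or> i < c0 then i else 0 | None \<Rightarrow> 0) ` {..<n}"
      then obtain v where v: "v < n" "x = (case val v of Some i \<Rightarrow> if z0 = [] \<or> i < c0 then i else 0 | None \<Rightarrow> 0)" by auto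
      show "x \<in> insert 0 (V - D)"
      proof (cases "val v")
        case (Some i)
        then have "i \<in> V" using v(1) by (auto simp: V_def)
        then show ?thesis using D(2) v(2) Some by (cases "z0 = [] \<or> i < c0") auto
      qed (use v(2) in simp)
    qed
    have img2: "V - D \<subseteq> (\<lambda>v. case val v of Some i \<Rightarrow> if z0 = [] \<or> i < c0 then i else 0 | None \<Rightarrow> 0) ` {..<n}"
    proof
      fix i assume i: "i \<in> V - D"
      then obtain v where v: "v < n" "val v = Some i" by (auto simp: V_def)
      have "z0 = [] \<or> i < c0" using i D(2) by blast
      then show "i \<in> (\<lambda>v. case val v of Some i \<Rightarrow> if z0 = [] \<or> i < c0 then i else 0 | None \<Rightarrow> 0) ` {..<n}"
        using v by (intro image_eqI[of _ _ v]) auto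
    qed
    have cin: "c' \<in> insert 0 (V - D)"
    proof -
      have "c' \<in> (\<lambda>v. case val v of Some i \<Rightarrow> if z0 = [] \<or> i < c0 then i else 0 | None \<Rightarrow> 0) ` {..<n}"
        unfolding c'_def next_value_def using n by (intro Max_in) (simp_all add: lessThan_nonempty)
      then show ?thesis by (rule subsetD[OF img])
    qed
    have cge: "i \<le> c'" if "i \<in> V - D" for i
      unfolding c'_def next_value_def by (intro Max_ge subsetD[OF img2 that]) simp
    show ?case
    proof (cases "D = V")
      case True
      then have "c' = 0" using cin by simp
      then show ?thesis using True D(3) by (intro exI[of _ V]) (simp add: zc f0)
    next
      case False
      then obtain i0 where i0: "i0 \<in> V - D" using D(1) by blast
      have "0 < i0" using i0 VN by force
      then have c'V: "c' \<in> V - D" using cin cge[OF i0] by auto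
      have "(z = [] \<or> i < c) \<longleftrightarrow> i \<notin> insert c' D" if i: "i \<in> V" for i
      proof (cases "i \<in> D")
        case True
        have "z0 \<noteq> []" "c0 \<le> i" using D(2)[rule_format, OF i] True by auto
        moreover have "z0 = [] \<or> c' < c0" using c'V D(2)[rule_format, of c'] by simp
        ultimately show ?thesis using True by (auto simp: zc)
      next
        case False
        then show ?thesis using cge[of i] i by (auto simp: zc)
      qed
      moreover have "card (insert c' D) = Suc j" using c'V D(4) False finD by auto
      moreover have "(\<Sum>x\<leftarrow>z. real (snd x) powr p) = ?S (insert c' D)" using c'V D(3) finD by (simp add: zc)
      ultimately show ?thesis using D(1) c'V by (intro exI[of _ "insert c' D"]) auto
    qed
  qed
  then obtain D where D: "D \<subseteq> V" "(\<Sum>x\<leftarrow>fst (exact_state n val n). real (snd x) powr p) = ?S D" "D = V \<or> card D = n"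
    by (metis prod.collapse)
  have "D = V" using D(1,3) cV card_seteq[OF finV D(1)] by auto
  then have "(\<Sum>x\<leftarrow>fst (exact_state n val n). real (snd x) powr p) = ?S V" using D(2) by simp
  also have "\<dots> = (\<Sum>i=1..N. real (freq n val i) powr p)"
    using VN fV by (intro sum.mono_neutral_left) auto
  finally show ?thesis by (simp add: freq_moment_def)
qed

lemma approximates_self: "0 < \<epsilon> \<Longrightarrow> 0 \<le> F \<Longrightarrow> approximates \<epsilon> F F"
  by (simp add: approximates_def algebra_simps)

lemma exact_alg_prob:
  assumes n: "0 < n" and val: "valid_input n N val" and N: "N < W" and W: "W * W \<le> 2 ^ b" "n * 2 ^ t < W" and \<epsilon>: "0 < \<epsilon>"
  shows "Pr (exec n b (concat (replicate n (exact_iter n t W))) (config n (\<lambda>v. st0 (val v) [] 0 [])))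
     {\<sigma>. \<exists>u<n. \<not> approximates \<epsilon> (exact_result p (\<sigma> u)) (freq_moment n N val p)}
    \<le> real n * ((real n)\<^sup>2 * (2 / 3) ^ (2 * t) + 5 * real n ^ 3 * (1 / 2) ^ t)"
proof -
  let ?\<sigma> = "config n (\<lambda>v. (st0 (val v) [] 0 (fst (exact_state n val n)))\<lparr>chosen := snd (exact_state n val n)\<rparr>)"
  let ?bad = "{\<sigma>. \<exists>u<n. \<not> approximates \<epsilon> (exact_result p (\<sigma> u)) (freq_moment n N val p)}"
  have "exact_result p (?\<sigma> u) = freq_moment n N val p" if "u < n" for u
    using that exact_state_moment[OF n val, of p] by (simp add: exact_result_def st0_def)
  then have "?\<sigma> \<notin> ?bad" using approximates_self[OF \<epsilon> freq_moment_nonneg] by auto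
  then have "Pr (return_pmf ?\<sigma>) ?bad = 0" by simp
  with apx_prob[OF exact_loop_apx[OF n val N W, of n], of ?bad] show ?thesis by simp
qed

section \<open>Choice of parameters\<close>

text \<open>The theorem asks for natural numbers as local states. The sorted list determines the
  inbox.\<close>

definition enc_st :: "st \<Rightarrow> nat" where
  "enc_st s = to_nat (inp s, home s, cnt s, outs s, arg s, key s, mass s, wgt s,
     sorted_list_of_multiset (inbox s), chosen s, tot s, saved s)"

lemma inj_enc_st: "inj enc_st"
proof (rule injI)
  fix x y assume "enc_st x = enc_st y"
  then have eq: "(inp x, home x, cnt x, outs x, arg x, key x, mass x, wgt x, sorted_list_of_multiset (inbox x), chosen x, tot x, saved x)
     = (inp y, home y, cnt y, outs y, arg y, key y, mass y, wgt y, sorted_list_of_multiset (inbox y), chosen y, tot y, saved y)"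
    unfolding enc_st_def by (simp only: to_nat_split inj_eq[OF inj_to_nat])
  then have "inbox x = inbox y" by (metis mset_sorted_list_of_multiset prod.inject)
  with eq show "x = y" by (intro st.equality) auto
qed

lemma length_spread: "length (spread t) = t"
  by (simp add: spread_def)

lemma length_summ: "length (summ n W t) = 3 * t + 3"
  by (simp add: summ_def length_spread)

lemma length_throw: "length (throw sl l Q) = Q"
  by (simp add: throw_def length_concat comp_def sum_list_triv)

lemma length_sample_iter: "length (sample_iter n N k g t W Q) = k * g + 8 * t + 10"
  by (simp add: sample_iter_def sample_tail_def length_spread length_summ length_throw length_concat comp_def sum_list_triv)

lemma length_sampling_alg:
  "length (sampling_alg n N k g t W Q J R) = 3 * t + 5 + J * (2 * g + 1) + R * (k * g + 8 * t + 10)"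
  by (simp add: sampling_alg_def prelim_def doubling_def dbl_phase_def length_summ length_throw length_concat
      length_sample_iter comp_def sum_list_triv sum_list_replicate)

lemma length_exact_alg: "length (concat (replicate R (exact_iter n t W))) = R * (5 * t + 6)"
  by (simp add: exact_iter_def length_spread length_summ length_concat sum_list_replicate)

text \<open>The values range up to \<open>a * n ^ a\<close>, and \<open>d\<close> is the exponent of
  the failure probability.\<close>

locale params =
  fixes p A :: real and k a d :: nat
  assumes k: "2 \<le> k" and kp: "real k \<le> p" and A: "1 \<le> A"
begin

text \<open>With \<open>v = 2^(-lg n) <= 1/n\<close>, every basic error is pushed below
  \<open>v ^ h\<close>. Up to \<open>n\<close> repetitions cost one factor \<open>v\<close>, and
  \<open>8 * v^4 <= 1/2\<close> covers the number of error terms; \<open>v ^ d\<close> is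
  left.\<close>

definition "h = d + 5"
text \<open>In \<open>5 * n^(2 k + 3) * (1/2)^t\<close> the powers of \<open>n\<close> use up
  \<open>2 k + 3\<close> factors \<open>v\<close>, the constant 5 uses three, and \<open>h\<close>
  remain.\<close>

definition "\<tau> = 2 * k + 6 + h"
text \<open>Room for \<open>n^(k+1) * 2^t\<close> and for the value range
  \<open>a * n^a <= 2^(2 a lg n)\<close>; the excess makes both inequalities strict.\<close>

definition "w = k + 3 + \<tau> + 2 * a"
text \<open>The 9 from Chebyshev's inequality times the constant of
  \<open>scaled_sample_moments\<close>.\<close>

definition "K = 9 * (2 * (1 + 8 ^ k * A ^ (k - 1)))"

definition lg :: "nat \<Rightarrow> nat" where "lg n = nat \<lceil>log 2 (real n)\<rceil>"
definition "t n = \<tau> * lg n"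
text \<open>Of the exponent, one unit pays for the union bound over the nodes, three for
  \<open>3 * lg n\<close>, and \<open>h\<close> remain.\<close>

definition "g n = (h + 4) * lg n"
definition "Q n = (2::nat) ^ ((k + 1 + h) * lg n)"
definition "W n = (2::nat) ^ (w * lg n)"
text \<open>Enough for two digits in base \<open>W\<close> and for a key below
  \<open>Q * W\<close>.\<close>

definition "b n = (2 * w + k + 1 + h) * lg n"
text \<open>The factor 2 is due to \<open>(2/3)^2 <= 1/2\<close>.\<close>

definition "G n = 2 * h * lg n"
definition s :: "nat \<Rightarrow> real \<Rightarrow> nat" where "s n \<epsilon> = nat \<lceil>K * real n powr (1 - real k / p) / \<epsilon>\<^sup>2\<rceil>"

definition "sampling_prog n N \<epsilon> = sampling_alg n N k (g n) (t n) (W n) (Q n) (lg n) (G n * s n \<epsilon>)"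
definition "exact_prog n = concat (replicate n (exact_iter n (t n) (W n)))"

lemma lg_bounds:
  assumes "2 \<le> n"
  shows "n \<le> 2 ^ lg n" "1 \<le> lg n" "real (lg n) \<le> 2 * log 2 (real n)" "lg n \<le> n"
proof -
  have l1: "1 \<le> log 2 (real n)" using assms by simp
  have lg: "real (lg n) = of_int \<lceil>log 2 (real n)\<rceil>" using l1 by (simp add: lg_def)
  have ge: "log 2 (real n) \<le> real (lg n)" unfolding lg by (rule le_of_int_ceiling)
  have lt: "real (lg n) < log 2 (real n) + 1" unfolding lg using ceiling_correct[of "log 2 (real n)"] by linarith
  have "real n = 2 powr log 2 (real n)" using assms by simp
  also have "\<dots> \<le> 2 powr real (lg n)" using ge by simp
  finally have "real n \<le> real (2 ^ lg n)" by (simp add: powr_realpow)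
  then show "n \<le> 2 ^ lg n" by (simp only: of_nat_le_iff)
  show "1 \<le> lg n" using ge l1 by linarith
  show le2: "real (lg n) \<le> 2 * log 2 (real n)" using lt l1 by linarith
  show "lg n \<le> n"
  proof -
    have "real n < 2 powr real n" by (simp add: powr_realpow)
    then have "log 2 (real n) < real n" using assms by (simp add: log_less_iff)
    then show ?thesis using lt by linarith
  qed
qed

lemma h5: "5 \<le> h" by (simp add: h_def)

lemma K_pos: "0 < K" using A by (auto simp: K_def intro!: add_pos_nonneg)

lemma size_conditions:
  assumes n: "2 \<le> n" and N: "N \<le> a * n ^ a"
  shows "N < W n" "W n * W n \<le> 2 ^ b n" "Q n * W n \<le> 2 ^ b n" "n * n ^ k * 2 ^ t n < W n" "n * 2 ^ t n < W n"
    "0 < Q n" "n < 2 * 2 ^ lg n" "0 < g n"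
proof -
  note lg = lg_bounds[OF n]
  have pw: "n ^ j \<le> 2 ^ (j * lg n)" for j
    using power_mono[OF lg(1), of j] by (simp add: mult.commute flip: power_mult)
  have "a \<le> 2 ^ a" by (simp add: less_imp_le)
  also have "(2::nat) ^ a \<le> 2 ^ (a * lg n)" using lg(2) by (intro power_increasing) auto
  finally have "a * n ^ a \<le> 2 ^ (a * lg n) * 2 ^ (a * lg n)" by (intro mult_mono pw) auto
  also have "\<dots> = 2 ^ (2 * a * lg n)" by (simp add: mult_2 algebra_simps flip: power_add)
  also have "\<dots> < 2 ^ (w * lg n)"
  proof (rule power_strict_increasing)
    have "2 * a < w" by (simp add: w_def)
    then show "2 * a * lg n < w * lg n" using lg(2) by simp
  qed simp
  finally show "N < W n" using N by (simp add: W_def)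
  show "W n * W n \<le> 2 ^ b n"
    unfolding W_def b_def power_add[symmetric] by (intro power_increasing) (auto simp: algebra_simps)
  show "Q n * W n \<le> 2 ^ b n"
    unfolding W_def b_def Q_def power_add[symmetric] by (intro power_increasing) (auto simp: algebra_simps)
  have "n * n ^ k * 2 ^ t n \<le> 2 ^ (Suc k * lg n) * 2 ^ t n"
    using pw[of "Suc k"] by (intro mult_right_mono) auto
  also have "\<dots> = 2 ^ ((Suc k + \<tau>) * lg n)" by (simp add: t_def algebra_simps flip: power_add)
  also have "\<dots> < 2 ^ (w * lg n)"
  proof (rule power_strict_increasing)
    have "Suc k + \<tau> < w" by (simp add: w_def)
    then show "(Suc k + \<tau>) * lg n < w * lg n" by (rule mult_strict_right_mono) (use lg(2) in simp)
  qed simp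
  finally show big: "n * n ^ k * 2 ^ t n < W n" by (simp add: W_def)
  have "n * 1 * 2 ^ t n \<le> n * n ^ k * 2 ^ t n" using n by (intro mult_right_mono mult_left_mono) auto
  with big show "n * 2 ^ t n < W n" by linarith
  show "0 < Q n" by (simp add: Q_def)
  show "n < 2 * 2 ^ lg n" using lg(1) n by linarith
  show "0 < g n" using lg(2) by (simp add: g_def)
qed

lemma failure_terms:
  assumes n: "2 \<le> n"
  defines "v \<equiv> (1 / 2 :: real) ^ lg n"
  shows "0 < v" "v \<le> 1 / 2" "real n * v \<le> 1"
    and "5 * real n ^ 3 * (real (n ^ k))\<^sup>2 * (1 / 2) ^ t n \<le> v ^ h"
    and "5 * real n ^ 3 * (1 / 2) ^ t n \<le> v ^ h"
    and "(real n)\<^sup>2 * (2 / 3) ^ (2 * t n) \<le> v ^ h"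
    and "real (lg n) * (real n * (3 * (1 / 2) ^ g n)) \<le> v ^ h"
    and "real n ^ Suc k / real (Q n) \<le> v ^ h"
    and "(2 / 3) ^ G n \<le> v ^ h"
proof -
  note lg = lg_bounds[OF n]
  show v0: "0 < v" by (simp add: v_def)
  show v2: "v \<le> 1 / 2" using power_decreasing[OF lg(2), of "1 / 2 :: real"] by (simp add: v_def)
  have "real n \<le> 2 ^ lg n" using lg(1) by (metis of_nat_le_iff of_nat_numeral of_nat_power)
  then have "real n * v \<le> 2 ^ lg n * v" using v0 by simp
  also have "\<dots> = 1" by (simp add: v_def power_one_over)
  finally show nv: "real n * v \<le> 1" .
  have nvj: "real n ^ j * v ^ j \<le> 1" for j
    using power_le_one[of "real n * v" j] nv v0 by (simp add: power_mult_distrib)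
  have pv: "(1 / 2) ^ (j * lg n) = v ^ j" for j by (simp add: v_def mult.commute flip: power_mult)
  have vj: "v ^ (j + i) \<le> v ^ i" for i j using v0 v2 by (intro power_decreasing) auto
  \<comment> \<open>The bookkeeping device: \<open>j\<close> factors \<open>v\<close> cancel
    \<open>n^j\<close>, \<open>i\<close> factors absorb the constant \<open>c\<close>, and
    \<open>h\<close> factors survive.\<close>
  have shrink: "c * real n ^ j * v ^ (j + i + h) \<le> v ^ h" if c: "0 \<le> c" "c * v ^ i \<le> 1" for c i j
  proof -
    have "c * real n ^ j * v ^ (j + i + h) = (real n ^ j * v ^ j) * (c * v ^ i) * v ^ h"
      by (simp add: power_add mult_ac)
    also have "\<dots> \<le> 1 * 1 * v ^ h"
      using nvj[of j] c v0 by (intro mult_mono) auto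
    finally show ?thesis by simp
  qed
  have v3: "5 * v ^ 3 \<le> 1"
  proof -
    have "v ^ 3 \<le> (1 / 2) ^ 3" using v0 v2 by (intro power_mono) auto
    then show ?thesis by (simp add: power3_eq_cube)
  qed
  have tv: "(1 / 2) ^ t n = v ^ \<tau>" by (simp add: t_def pv)
  have five: "5 * v ^ i \<le> 1" if "3 \<le> i" for i
  proof -
    have "v ^ i \<le> v ^ 3" using v0 v2 that by (intro power_decreasing) auto
    then show ?thesis using v3 by linarith
  qed
  have "5 * real n ^ 3 * (real (n ^ k))\<^sup>2 * (1 / 2) ^ t n = 5 * real n ^ (2 * k + 3) * v ^ ((2 * k + 3) + 3 + h)"
    unfolding tv \<tau>_def by (simp add: power_add power_mult mult_ac power2_eq_square flip: power_mult_distrib)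
  also have "\<dots> \<le> v ^ h" by (rule shrink) (use five in auto)
  finally show "5 * real n ^ 3 * (real (n ^ k))\<^sup>2 * (1 / 2) ^ t n \<le> v ^ h" .
  have "5 * real n ^ 3 * (1 / 2) ^ t n = 5 * real n ^ 3 * v ^ (3 + (2 * k + 3) + h)"
    unfolding tv \<tau>_def by (simp add: add_ac)
  also have "\<dots> \<le> v ^ h" by (rule shrink) (use five in auto)
  finally show "5 * real n ^ 3 * (1 / 2) ^ t n \<le> v ^ h" .
  have two: "((2::real) / 3) ^ (2 * j) \<le> (1 / 2) ^ j" for j
  proof -
    have "((2::real) / 3) ^ (2 * j) = (4 / 9) ^ j" by (simp add: power_mult power2_eq_square)
    also have "\<dots> \<le> (1 / 2) ^ j" by (intro power_mono) auto
    finally show ?thesis .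
  qed
  have "(real n)\<^sup>2 * (2 / 3) ^ (2 * t n) \<le> (real n)\<^sup>2 * v ^ \<tau>"
    using two[of "t n"] unfolding tv by (intro mult_left_mono) auto
  also have "\<dots> = 1 * (real n)\<^sup>2 * v ^ (2 + (2 * k + 4) + h)" unfolding \<tau>_def by (simp add: add_ac)
  also have "\<dots> \<le> v ^ h" by (rule shrink) (use v0 v2 in \<open>auto intro!: power_le_one\<close>)
  finally show "(real n)\<^sup>2 * (2 / 3) ^ (2 * t n) \<le> v ^ h" .
  have lv: "real (lg n) * v \<le> 1"
  proof -
    have "real (lg n) * v \<le> real n * v" using lg(4) v0 by (intro mult_right_mono) auto
    then show ?thesis using nv by linarith
  qed
  have "3 * real (lg n) * v ^ 3 \<le> 1"
  proof -
    have "3 * real (lg n) * v ^ 3 = (real (lg n) * v) * (3 * v\<^sup>2)" by (simp add: power3_eq_cube power2_eq_square)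
    also have "\<dots> \<le> 1 * 1"
    proof (intro mult_mono lv)
      have "v\<^sup>2 \<le> (1 / 2)\<^sup>2" using v0 v2 by (intro power_mono) auto
      then show "3 * v\<^sup>2 \<le> 1" by (simp add: power2_eq_square)
    qed (use v0 in auto)
    finally show ?thesis by simp
  qed
  then have "(3 * real (lg n)) * real n ^ 1 * v ^ (1 + 3 + h) \<le> v ^ h" by (intro shrink) auto
  moreover have "(1 / 2) ^ g n = v ^ (1 + 3 + h)" unfolding g_def pv by (simp add: add_ac)
  ultimately show "real (lg n) * (real n * (3 * (1 / 2) ^ g n)) \<le> v ^ h" by (simp only: power_one_right mult_ac)
  have "real n ^ Suc k / real (Q n) = real n ^ Suc k * (1 / 2) ^ ((k + 1 + h) * lg n)"
    by (simp add: Q_def power_one_over)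
  also have "\<dots> = 1 * real n ^ Suc k * v ^ (Suc k + 0 + h)" unfolding pv by (simp add: add_ac)
  also have "\<dots> \<le> v ^ h" by (rule shrink) auto
  finally show "real n ^ Suc k / real (Q n) \<le> v ^ h" .
  have "(2 / 3) ^ G n \<le> (1 / 2 :: real) ^ (h * lg n)" using two[of "h * lg n"] by (simp add: G_def mult.assoc)
  then show "(2 / 3) ^ G n \<le> v ^ h" by (simp add: pv)
qed

lemma small_failure:
  assumes n: "2 \<le> n"
  defines "v \<equiv> (1 / 2 :: real) ^ lg n"
  shows "8 * v ^ (h - 1) \<le> 1 / 2 * (1 / real n ^ d)"
proof -
  note ft = failure_terms[OF n, folded v_def]
  have "8 * v ^ (h - 1) = 8 * v ^ 4 * v ^ d" by (simp add: h_def power_add add.commute)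
  also have "8 * v ^ 4 \<le> 8 * (1 / 2) ^ 4" using ft(1,2) by (intro mult_left_mono power_mono) auto
  also have "(8::real) * (1 / 2) ^ 4 = 1 / 2" by (simp add: power4_eq_xxxx)
  finally have 1: "8 * v ^ (h - 1) \<le> 1 / 2 * v ^ d" using ft(1) by (simp add: mult_right_mono)
  have "v \<le> 1 / real n" using ft(3) n by (simp add: field_simps)
  then have "v ^ d \<le> (1 / real n) ^ d" using ft(1) by (intro power_mono) auto
  with 1 show ?thesis by (simp add: power_one_over)
qed

lemma exact_prog_prob:
  assumes n: "2 \<le> n" and N: "N \<le> a * n ^ a" and val: "valid_input n N val" and \<epsilon>: "0 < \<epsilon>"
  shows "Pr (exec n (b n) (exact_prog n) (config n (\<lambda>v. st0 (val v) [] 0 [])))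
     {\<sigma>. \<exists>u<n. \<not> approximates \<epsilon> (exact_result p (\<sigma> u)) (freq_moment n N val p)} \<le> 1 / 2 * (1 / real n ^ d)"
proof -
  note sc = size_conditions[OF n N]
  define v :: real where "v = (1 / 2) ^ lg n"
  note ft = failure_terms[OF n, folded v_def]
  have n0: "0 < n" using n by simp
  have hv: "v ^ h = v * v ^ (h - 1)" using h5 by (simp flip: power_Suc)
  have "real n * ((real n)\<^sup>2 * (2 / 3) ^ (2 * t n) + 5 * real n ^ 3 * (1 / 2) ^ t n) \<le> real n * (v ^ h + v ^ h)"
    using ft(5,6) by (intro mult_left_mono add_mono) auto
  also have "\<dots> = (real n * v) * (2 * v ^ (h - 1))" unfolding hv by (simp add: algebra_simps)
  also have "\<dots> \<le> 1 * (8 * v ^ (h - 1))" using ft(1,3) by (intro mult_mono) auto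
  also have "\<dots> \<le> 1 / 2 * (1 / real n ^ d)" using small_failure[OF n] by (simp add: v_def)
  finally show ?thesis unfolding exact_prog_def using exact_alg_prob[OF n0 val sc(1,2,5) \<epsilon>, of p] by linarith
qed

lemma s_ge:
  assumes "0 < \<epsilon>"
  shows "K * real n powr (1 - real k / p) \<le> real (s n \<epsilon>) * \<epsilon>\<^sup>2"
proof -
  have "K * real n powr (1 - real k / p) / \<epsilon>\<^sup>2 \<le> real (s n \<epsilon>)" unfolding s_def by (rule real_nat_ceiling_ge)
  then show ?thesis using assms by (simp add: divide_le_eq)
qed

text \<open>The bound \<open>G n * s n \<epsilon> <= n\<close> keeps the accumulated error within a
  factor \<open>n\<close> of the error per sample. The target is half of \<open>1 / n^d\<close>
  because the comparison with uniform targets doubles it.\<close>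

lemma sampling_prog_prob:
  assumes n: "2 \<le> n" and N: "N \<le> a * n ^ a" and val: "valid_input n N val" and \<epsilon>: "0 < \<epsilon>"
    and F0: "real (num_distinct n N val) \<le> A * real n powr (1 / (real k - 1))" and R: "G n * s n \<epsilon> \<le> n"
  shows "Pr (exec n (b n) (sampling_prog n N \<epsilon>) (config n (\<lambda>v. st0 (val v) [] 0 [])))
     {\<sigma>. \<exists>u<n. \<not> approximates \<epsilon> (sampling_result n k p (lg n) (G n) (s n \<epsilon>) (\<sigma> u)) (freq_moment n N val p)} \<le> 1 / 2 * (1 / real n ^ d)"
proof -
  note sc = size_conditions[OF n N]
  define v :: real where "v = (1 / 2) ^ lg n"
  note ft = failure_terms[OF n, folded v_def]
  have n0: "0 < n" using n by simp
  have hv: "v ^ h = v * v ^ (h - 1)" using h5 by (simp flip: power_Suc)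
  have Rr: "real (G n * s n \<epsilon>) \<le> real n" using R by (simp only: of_nat_le_iff)
  have pos: "0 \<le> v ^ (h - 1)" using ft(1) by simp
  have h1: "v ^ h \<le> 1 / 2 * v ^ (h - 1)" unfolding hv using ft(2) pos by (intro mult_right_mono) auto
  have "Pr (exec n (b n) (sampling_prog n N \<epsilon>) (config n (\<lambda>v. st0 (val v) [] 0 [])))
     {\<sigma>. \<exists>u<n. \<not> approximates \<epsilon> (sampling_result n k p (lg n) (G n) (s n \<epsilon>) (\<sigma> u)) (freq_moment n N val p)}
    \<le> 5 * real n ^ 3 * (1 / 2) ^ t n + real (lg n) * (real n * (3 * (1 / 2) ^ g n))
       + (real (G n * s n \<epsilon>) * (real n ^ Suc k / real (Q n) + ((real n)\<^sup>2 * (2 / 3) ^ (2 * t n) + 2 * (5 * real n ^ 3 * (real (n ^ k))\<^sup>2 * (1 / 2) ^ t n)))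
       + (2 / 3) ^ G n)"
    unfolding sampling_prog_def
    by (rule sampling_alg_prob[OF n0 sc(8) val sc(1,6,3,2,4,7) k kp A F0 \<epsilon>]) (use s_ge[OF \<epsilon>] in \<open>simp add: K_def\<close>)
  also have "\<dots> \<le> v ^ h + v ^ h + (real n * (v ^ h + (v ^ h + 2 * v ^ h)) + v ^ h)"
    using ft Rr by (intro add_mono mult_mono mult_left_mono) (auto intro!: add_nonneg_nonneg)
  also have "\<dots> = 3 * v ^ h + 4 * ((real n * v) * v ^ (h - 1))" unfolding hv by (simp add: algebra_simps)
  also have "\<dots> \<le> 3 * (1 / 2 * v ^ (h - 1)) + 4 * (1 * v ^ (h - 1))"
    using h1 ft(3) pos by (intro add_mono mult_left_mono mult_right_mono) auto
  also have "\<dots> \<le> 8 * v ^ (h - 1)" using pos by simp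
  also have "\<dots> \<le> 1 / 2 * (1 / real n ^ d)" using small_failure[OF n] by (simp add: v_def)
  finally show ?thesis .
qed

definition "const = 2 * real h * (K + 1) * real (k * (h + 4) + 8 * \<tau> + 10) + real (3 * \<tau> + 2 * h + 14)"

text \<open>For \<open>\<epsilon> < 1\<close> the quantity \<open>X\<close> is at least 1, so it
  absorbs both the rounding up in \<open>s\<close> and the preliminary phase.\<close>

lemma length_sampling_prog_le:
  assumes n: "2 \<le> n" and \<epsilon>: "0 < \<epsilon>" "\<epsilon> < 1"
  shows "real (length (sampling_prog n N \<epsilon>)) \<le> const * (4 / (ln 2)\<^sup>2) * (1 / \<epsilon>\<^sup>2) * real n powr (1 - real k / p) * (ln (real n))\<^sup>2"
proof -
  note lg = lg_bounds[OF n]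
  define X where "X = real n powr (1 - real k / p) / \<epsilon>\<^sup>2"
  define L where "L = real (lg n)"
  have p0: "0 < p" using k kp by linarith
  have L1: "1 \<le> L" using lg(2) by (simp add: L_def)
  have X1: "1 \<le> X"
  proof -
    have "1 \<le> real n powr (1 - real k / p)" using n kp p0 by (intro ge_one_powr_ge_zero) auto
    moreover have "\<epsilon>\<^sup>2 \<le> 1" using \<epsilon> by (simp add: power_le_one)
    ultimately have "\<epsilon>\<^sup>2 \<le> real n powr (1 - real k / p)" by linarith
    then show ?thesis using \<epsilon> by (simp add: X_def)
  qed
  have sX: "real (s n \<epsilon>) \<le> (K + 1) * X"
  proof -
    have "0 \<le> K * X" using K_pos X1 by (intro mult_nonneg_nonneg) auto
    then have "real (s n \<epsilon>) \<le> K * X + 1"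
      unfolding s_def X_def times_divide_eq_right[symmetric] using ceiling_correct[of "K * (real n powr (1 - real k / p) / \<epsilon>\<^sup>2)"] by linarith
    also have "\<dots> \<le> (K + 1) * X" using X1 by (simp add: distrib_right)
    finally show ?thesis .
  qed
  have 1: "real (G n * s n \<epsilon> * (k * g n + 8 * t n + 10)) \<le> 2 * real h * (K + 1) * real (k * (h + 4) + 8 * \<tau> + 10) * (L\<^sup>2 * X)"
  proof -
    have "real (k * g n + 8 * t n + 10) \<le> real (k * (h + 4) + 8 * \<tau> + 10) * L"
      using L1 by (simp add: g_def t_def L_def distrib_right mult.assoc)
    then have "real (G n) * real (s n \<epsilon>) * real (k * g n + 8 * t n + 10)
       \<le> (2 * real h * L) * ((K + 1) * X) * (real (k * (h + 4) + 8 * \<tau> + 10) * L)"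
      using sX L1 K_pos X1 by (intro mult_mono) (auto simp: G_def L_def)
    then show ?thesis by (simp only: of_nat_mult power2_eq_square mult_ac)
  qed
  have 2: "real (3 * t n + 5 + lg n * (2 * g n + 1)) \<le> real (3 * \<tau> + 2 * h + 14) * (L\<^sup>2 * X)"
  proof -
    have LL: "L \<le> L\<^sup>2" "1 \<le> L\<^sup>2" using L1 mult_left_mono[of 1 L L] by (auto simp: power2_eq_square intro: order_trans)
    have "real (3 * t n + 5 + lg n * (2 * g n + 1)) = 3 * real \<tau> * L + 5 + (2 * (real h + 4)) * L\<^sup>2 + L"
      by (simp add: t_def g_def L_def power2_eq_square algebra_simps)
    also have "\<dots> \<le> 3 * real \<tau> * L\<^sup>2 + 5 * L\<^sup>2 + (2 * (real h + 4)) * L\<^sup>2 + L\<^sup>2"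
      using LL by (intro add_mono mult_left_mono) auto
    also have "\<dots> = real (3 * \<tau> + 2 * h + 14) * (L\<^sup>2 * 1)" by (simp add: algebra_simps)
    also have "\<dots> \<le> real (3 * \<tau> + 2 * h + 14) * (L\<^sup>2 * X)" using X1 by (intro mult_left_mono) auto
    finally show ?thesis .
  qed
  have "real (length (sampling_prog n N \<epsilon>)) = real (3 * t n + 5 + lg n * (2 * g n + 1)) + real (G n * s n \<epsilon> * (k * g n + 8 * t n + 10))"
    by (simp only: sampling_prog_def length_sampling_alg of_nat_add)
  also have "\<dots> \<le> const * (L\<^sup>2 * X)"
    using 1 2 unfolding const_def distrib_right by linarith
  also have "\<dots> \<le> const * ((4 / (ln 2)\<^sup>2 * (ln (real n))\<^sup>2) * X)"
  proof -
    have "L \<le> 2 * (ln (real n) / ln 2)" using lg(3) by (simp add: L_def log_def)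
    then have "L\<^sup>2 \<le> (2 * (ln (real n) / ln 2))\<^sup>2" using L1 by (intro power_mono) auto
    then have "L\<^sup>2 \<le> 4 / (ln 2)\<^sup>2 * (ln (real n))\<^sup>2" by (simp add: power_mult_distrib power_divide)
    moreover have "0 \<le> const" using K_pos by (simp add: const_def)
    ultimately show ?thesis using X1 by (intro mult_left_mono mult_right_mono) auto
  qed
  also have "\<dots> = const * (4 / (ln 2)\<^sup>2) * (1 / \<epsilon>\<^sup>2) * real n powr (1 - real k / p) * (ln (real n))\<^sup>2"
    by (simp add: X_def)
  finally show ?thesis .
qed

text \<open>An iteration of the exact algorithm has \<open>5 t + 6\<close> rounds, fewer than one
  sample takes; a sampling program no longer than the exact one therefore has at most
  \<open>n\<close> samples.\<close>

lemma sampling_repetitions_le: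
  assumes n: "2 \<le> n" and le: "length (sampling_prog n N \<epsilon>) \<le> length (exact_prog n)"
  shows "G n * s n \<epsilon> \<le> n"
proof -
  have "G n * s n \<epsilon> * (k * g n + 8 * t n + 10) \<le> n * (5 * t n + 6)"
    using le by (simp only: sampling_prog_def exact_prog_def length_sampling_alg length_exact_alg)
  also have "\<dots> \<le> n * (k * g n + 8 * t n + 10)" by (intro mult_left_mono) auto
  finally show ?thesis by (metis add_gr_0 mult_le_cancel2 zero_less_numeral)
qed

text \<open>The length of the exact program is \<open>O(n^2)\<close> whatever
  \<open>\<epsilon>\<close> is, so \<open>n * T <= D * n^3\<close>. As \<open>n >= 2\<close>, the
  excess of \<open>c\<close> over 3 pays for \<open>2 * D\<close>, and the factor is at most
  \<open>exp (1/2) <= 2\<close>.\<close>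

lemma sampler_factor:
  assumes n: "2 \<le> n" and c: "3 + log 2 (2 * real (5 * \<tau> + 6)) \<le> c" and T: "T \<le> length (exact_prog n)"
  shows "(1 + 1 / real n powr c) ^ (n * T) \<le> 2"
proof -
  note lg = lg_bounds[OF n]
  define D where "D = real (5 * \<tau> + 6)"
  have D0: "0 < D" by (simp add: D_def)
  have n0: "0 < real n" using n by simp
  have "T \<le> n * (5 * t n + 6)" using T by (simp only: exact_prog_def length_exact_alg)
  also have "\<dots> \<le> n * ((5 * \<tau> + 6) * lg n)" using lg(2) by (intro mult_left_mono) (auto simp: t_def algebra_simps)
  also have "\<dots> \<le> n * ((5 * \<tau> + 6) * n)" using lg(4) by (intro mult_left_mono) auto
  finally have "n * T \<le> n * (n * ((5 * \<tau> + 6) * n))" by (intro mult_left_mono) auto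
  then have "real (n * T) \<le> real (n * (n * ((5 * \<tau> + 6) * n)))" by (simp only: of_nat_le_iff)
  then have nT: "real (n * T) \<le> D * real n powr 3"
    using n0 by (simp add: D_def powr_numeral power3_eq_cube mult_ac)
  have "2 * D = 2 powr log 2 (2 * D)" using D0 by simp
  also have "\<dots> \<le> 2 powr (c - 3)" by (rule powr_mono) (use c in \<open>simp_all add: D_def\<close>)
  also have "\<dots> \<le> real n powr (c - 3)"
  proof (rule powr_mono2)
    have "1 \<le> 2 * D" by (simp add: D_def)
    then have "0 \<le> log 2 (2 * D)" by simp
    then show "0 \<le> c - 3" using c unfolding D_def[symmetric] by linarith
  qed (use n in auto)
  finally have "2 * D * real n powr 3 \<le> real n powr (c - 3) * real n powr 3" by (intro mult_right_mono) auto
  also have "\<dots> = real n powr c" by (simp only: powr_add[symmetric] diff_add_cancel)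
  finally have c3: "2 * D * real n powr 3 \<le> real n powr c" .
  have "(1 + 1 / real n powr c) ^ (n * T) \<le> exp (1 / real n powr c) ^ (n * T)"
    by (intro power_mono exp_ge_add_one_self) auto
  also have "\<dots> = exp (real (n * T) / real n powr c)" by (simp flip: exp_of_nat_mult)
  also have "\<dots> \<le> exp (1 / 2)"
  proof -
    have "real (n * T) / real n powr c \<le> 1 / 2" using nT c3 n0 by (simp add: divide_le_eq)
    then show ?thesis by simp
  qed
  also have "\<dots> \<le> 2"
  proof -
    have "(exp (1 / 2 :: real))\<^sup>2 = exp 1" by (simp add: power2_eq_square flip: exp_add)
    also have "\<dots> \<le> 2\<^sup>2" using exp_le by simp
    finally show ?thesis by (rule power2_le_imp_le) simp
  qed
  finally show ?thesis .
qed

lemma bits_le: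
  assumes "2 \<le> n"
  shows "real (b n) \<le> 2 * real (2 * w + k + 1 + h) * log 2 (real n)"
proof -
  have "real (b n) = real (2 * w + k + 1 + h) * real (lg n)" by (simp only: b_def of_nat_mult)
  also have "\<dots> \<le> real (2 * w + k + 1 + h) * (2 * log 2 (real n))"
    using lg_bounds(3)[OF assms] by (intro mult_left_mono) auto
  finally show ?thesis by (simp only: mult.assoc mult.left_commute[of 2])
qed

end

section \<open>The case of one node and the final assembly\<close>

lemma freq_moment_single:
  assumes "valid_input 1 N val"
  shows "freq_moment 1 N val p = (if val 0 = None then 0 else 1)"
proof -
  have fr: "freq 1 val i = (if val 0 = Some i then 1 else 0)" for i by (simp add: freq_eq_sum)
  show ?thesis
  proof (cases "val 0")
    case None
    then show ?thesis by (simp add: freq_moment_def fr[unfolded One_nat_def])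
  next
    case (Some j)
    then have j: "j \<in> {1..N}" using assms by (auto simp: valid_input_def)
    have "freq_moment 1 N val p = (\<Sum>i=1..N. if j = i then 1 else 0)"
      unfolding freq_moment_def fr Some by (intro sum.cong) auto
    also have "\<dots> = 1" using j by simp
    finally show ?thesis using Some by simp
  qed
qed

theorem theorem3:
  fixes p :: real and k :: nat and a :: nat and A :: real and d :: nat
  assumes "2 \<le> p" and "2 \<le> k" and "real k \<le> p"
  shows "\<exists>c0::real. \<forall>c\<ge>c0.
    \<exists>(C::real) (B::real) (alg :: nat \<Rightarrow> nat \<Rightarrow> real \<Rightarrow> nat gossip_alg) (T :: nat \<Rightarrow> nat \<Rightarrow> real \<Rightarrow> nat).
      \<forall>(n::nat) (N::nat) (\<epsilon>::real). n \<ge> 1 \<longrightarrow> N \<le> a * n ^ a \<longrightarrow> \<epsilon> > 0 \<longrightarrow>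
        real (T n N \<epsilon>) \<le> C * (1 / \<epsilon>\<^sup>2) * real n powr (1 - real k / p) * (ln (real n))\<^sup>2 \<and>
        message_bits_le (alg n N \<epsilon>) (B * log 2 (real n)) \<and>
        (\<forall>val S. valid_input n N val \<longrightarrow>
           real (num_distinct n N val) \<le> A * real n powr (1 / (real k - 1)) \<longrightarrow>
           gossip_sampler n (1 / real n powr c) S \<longrightarrow>
           measure_pmf.prob (gossip_run n (alg n N \<epsilon>) S val (T n N \<epsilon>))
             {(h, \<sigma>). \<forall>u<n. approximates \<epsilon> (result (alg n N \<epsilon>) (\<sigma> u)) (freq_moment n N val p)}
           \<ge> 1 - 1 / real n ^ d)"
proof -
  \<comment> \<open>\<open>params\<close> wants \<open>1 <= A\<close>; enlarging \<open>A\<close>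
    only weakens the condition on the number of distinct values.\<close>
  define A' where "A' = max 1 A"
  interpret P: params p A' k a d using assms by unfold_locales (auto simp: A'_def)
  define ini where "ini = (\<lambda>v. st0 v [] 0 [])"
  define C where "C = P.const * (4 / (ln 2)\<^sup>2)"
  define B where "B = 2 * real (2 * P.w + k + 1 + P.h)"
  \<comment> \<open>For \<open>n = 1\<close> the logarithms vanish, so no round and no bit is
    allowed, and the node computes the moment from its own input. For \<open>\<epsilon> >= 1\<close>
    the answer 0 is acceptable, while the round bound may be below 1.\<close>
  define small where "small = (\<lambda>(n::nat) \<epsilon>. n = 1 \<or> (1::real) \<le> \<epsilon>)"
  define fast where "fast = (\<lambda>n N \<epsilon>. length (P.sampling_prog n N \<epsilon>) \<le> length (P.exact_prog n))"
  \<comment> \<open>The shorter program is taken: being no longer than the sampling program gives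
    the round bound, being no longer than the exact one gives the factor 2 in the comparison with
    uniform targets.\<close>
  define prog where "prog = (\<lambda>n N \<epsilon>. if small n \<epsilon> then [] else if fast n N \<epsilon> then P.sampling_prog n N \<epsilon> else P.exact_prog n)"
  define res where "res = (\<lambda>n N \<epsilon>. if small n \<epsilon> then (\<lambda>q. if n = 1 \<and> inp q \<noteq> None then 1 else 0)
      else if fast n N \<epsilon> then sampling_result n k p (P.lg n) (P.G n) (P.s n \<epsilon>) else exact_result p)"
  define bt where "bt = (\<lambda>n \<epsilon>. if small n \<epsilon> then 0 else P.b n)"
  define alg where "alg = (\<lambda>n N \<epsilon>. compile (bt n \<epsilon>) enc_st ini (prog n N \<epsilon>) (res n N \<epsilon>))"
  define T where "T = (\<lambda>n N \<epsilon>. length (prog n N \<epsilon>))"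
  have C0: "0 \<le> C" using P.K_pos by (simp add: C_def P.const_def)
  show ?thesis
  proof (rule exI[of _ "3 + log 2 (2 * real (5 * P.\<tau> + 6))"], intro allI impI, rule exI[of _ C], rule exI[of _ B],
      rule exI[of _ alg], rule exI[of _ T], intro allI impI conjI)
    fix c :: real and n N :: nat and \<epsilon> :: real
    assume c: "3 + log 2 (2 * real (5 * P.\<tau> + 6)) \<le> c" and n1: "1 \<le> n" and N: "N \<le> a * n ^ a" and \<epsilon>: "0 < \<epsilon>"
    have big: "2 \<le> n \<and> \<epsilon> < 1" if "\<not> small n \<epsilon>" using that n1 by (auto simp: small_def)
    show "real (T n N \<epsilon>) \<le> C * (1 / \<epsilon>\<^sup>2) * real n powr (1 - real k / p) * (ln (real n))\<^sup>2"
    proof (cases "small n \<epsilon>")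
      case True
      then show ?thesis using C0 by (simp add: T_def prog_def)
    next
      case False
      have "length (prog n N \<epsilon>) \<le> length (P.sampling_prog n N \<epsilon>)" using False by (simp add: prog_def fast_def)
      then have "real (T n N \<epsilon>) \<le> real (length (P.sampling_prog n N \<epsilon>))" by (simp add: T_def)
      also have "\<dots> \<le> C * (1 / \<epsilon>\<^sup>2) * real n powr (1 - real k / p) * (ln (real n))\<^sup>2"
        unfolding C_def using big[OF False] \<epsilon> by (intro P.length_sampling_prog_le) auto
      finally show ?thesis .
    qed
    show "message_bits_le (alg n N \<epsilon>) (B * log 2 (real n))"
    proof -
      have "real (bt n \<epsilon>) \<le> B * log 2 (real n)"
      proof (cases "small n \<epsilon>")
        case True
        have "0 \<le> log 2 (real n)" using n1 by simp
        then show ?thesis using True by (simp add: bt_def B_def)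
      next
        case False
        then show ?thesis using P.bits_le[of n] big[OF False] by (simp add: bt_def B_def)
      qed
      then show ?thesis unfolding alg_def by (rule message_bits_compile)
    qed
    fix val :: "nat \<Rightarrow> nat option" and S :: "nat execution \<Rightarrow> (nat \<Rightarrow> nat) pmf"
    assume val: "valid_input n N val" and F0: "real (num_distinct n N val) \<le> A * real n powr (1 / (real k - 1))"
      and S: "gossip_sampler n (1 / real n powr c) S"
    let ?F = "freq_moment n N val p"
    have n0: "0 < n" using n1 by simp
    have F0': "real (num_distinct n N val) \<le> A' * real n powr (1 / (real k - 1))"
    proof -
      have "A * real n powr (1 / (real k - 1)) \<le> A' * real n powr (1 / (real k - 1))"
        by (intro mult_right_mono) (auto simp: A'_def)
      then show ?thesis using F0 by linarith
    qed
    define q where "q = (if small n \<epsilon> then 0 else 1 / 2 * (1 / real n ^ d))"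
    have fail: "measure_pmf.prob (exec n (bt n \<epsilon>) (prog n N \<epsilon>) (config n (\<lambda>v. ini (val v))))
        {\<sigma>. \<exists>u<n. \<not> approximates \<epsilon> (res n N \<epsilon> (\<sigma> u)) ?F} \<le> q"
    proof (cases "small n \<epsilon>")
      case True
      have "approximates \<epsilon> (res n N \<epsilon> (config n (\<lambda>v. ini (val v)) u)) ?F" if u: "u < n" for u
      proof (cases "n = 1")
        case True
        then have "res n N \<epsilon> (config n (\<lambda>v. ini (val v)) u) = ?F"
          using u freq_moment_single[of N val p] val by (simp add: res_def small_def ini_def st0_def)
        then show ?thesis using approximates_self[OF \<epsilon> freq_moment_nonneg] by simp
      next
        case False
        then have "1 \<le> \<epsilon>" using True by (simp add: small_def)
        then have "(1 - \<epsilon>) * ?F \<le> 0" "0 \<le> (1 + \<epsilon>) * ?F"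
          using freq_moment_nonneg[of n N val p] by (auto intro: mult_nonpos_nonneg)
        then show ?thesis using True False by (simp add: approximates_def res_def)
      qed
      then show ?thesis using True by (simp add: prog_def q_def indicator_def)
    next
      case False
      note n2 = conjunct1[OF big[OF False]]
      show ?thesis
      proof (cases "fast n N \<epsilon>")
        case True
        then have "P.G n * P.s n \<epsilon> \<le> n" unfolding fast_def by (rule P.sampling_repetitions_le[OF n2])
        then show ?thesis
          using P.sampling_prog_prob[OF n2 N val \<epsilon> F0'] False True by (simp add: prog_def res_def bt_def q_def ini_def)
      next
        case False
        then show ?thesis
          using P.exact_prog_prob[OF n2 N val \<epsilon>] \<open>\<not> small n \<epsilon>\<close> by (simp add: prog_def res_def bt_def q_def ini_def)
      qed
    qed
    have fac: "(1 + 1 / real n powr c) ^ (n * length (prog n N \<epsilon>)) \<le> 2"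
    proof (cases "small n \<epsilon>")
      case True
      then show ?thesis by (simp add: prog_def)
    next
      case False
      have "length (prog n N \<epsilon>) \<le> length (P.exact_prog n)" using False by (simp add: prog_def fast_def)
      then show ?thesis using big[OF False] c by (intro P.sampler_factor) auto
    qed
    have "1 - 2 * q \<le> measure_pmf.prob (gossip_run n (alg n N \<epsilon>) S val (T n N \<epsilon>))
             {(h, \<sigma>). \<forall>u<n. approximates \<epsilon> (result (alg n N \<epsilon>) (\<sigma> u)) ?F}"
      unfolding alg_def T_def
      by (rule prob_gossip_run_compile[OF n0 inj_enc_st S _ fail fac]) simp
    moreover have "2 * q \<le> 1 / real n ^ d" by (simp add: q_def)
    ultimately show "1 - 1 / real n ^ d \<le> measure_pmf.prob (gossip_run n (alg n N \<epsilon>) S val (T n N \<epsilon>))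
             {(h, \<sigma>). \<forall>u<n. approximates \<epsilon> (result (alg n N \<epsilon>) (\<sigma> u)) ?F}" by linarith
  qed
qed

end
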